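(* Let $M>1$. There is a dense subset of $\mathcal{LP}_M$ such that for every $J$ in it, $\sigma(J)$ is a Cantor set of zero lower box-counting dimension, and the spectral type of $J$ is purely singular continuous.
   Context: For bounded sequences $a=(a_n)_{n\in\mathbb{Z}}$ with $a_n>0$ and $b=(b_n)_{n\in\mathbb{Z}}$ real, the Jacobi matrix $J=J_{a,b}$ acts on $\ell^2(\mathbb{Z})$ by $[Ju]_n = a_{n-1}u_{n-1} + b_n u_n + a_n u_{n+1}$. Set $\langle J\rangle := \max\{\|a\|_\infty, \|a^{-1}\|_\infty, \|b\|_\infty\}$. $J$ is $p$-periodic if $a_{n+p}=a_n$ and $b_{n+p}=b_n$ for all $n$, and limit-periodic if it is an operator-norm limit of periodic Jacobi matrices. For $M>1$, $\mathcal{LP}_M$ denotes the set of limit-periodic Jacobi matrices $J$ with $\langle J\rangle\le M$, with the operator-norm metric. A Cantor set is a compact subset of $\mathbb{R}$ with empty interior and no isolated points. The spectral type is purely singular continuous if every spectral measure $\mu_\psi$, $\psi\in\ell^2(\mathbb{Z})$, is supported on a Lebesgue-null set and has no atoms. *)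

theory Defs
  imports "HOL-Analysis.Analysis"
begin

definition l2 :: "(int \<Rightarrow> complex) set" where
  "l2 = {u. (\<lambda>n. (cmod (u n))\<^sup>2) summable_on UNIV}"

definition l2norm :: "(int \<Rightarrow> complex) \<Rightarrow> real" where
  "l2norm u = sqrt (\<Sum>\<^sub>\<infinity>n. (cmod (u n))\<^sup>2)"

definition l2inner :: "(int \<Rightarrow> complex) \<Rightarrow> (int \<Rightarrow> complex) \<Rightarrow> complex" where
  "l2inner u v = (\<Sum>\<^sub>\<infinity>n. cnj (u n) * v n)"

definition jac_op :: "(int \<Rightarrow> real) \<Rightarrow> (int \<Rightarrow> real) \<Rightarrow> (int \<Rightarrow> complex) \<Rightarrow> int \<Rightarrow> complex" where
  "jac_op a b u = (\<lambda>n. of_real (a (n - 1)) * u (n - 1) + of_real (b n) * u n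
                        + of_real (a n) * u (n + 1))"

definition jacobi_coeffs :: "(int \<Rightarrow> real) \<Rightarrow> (int \<Rightarrow> real) \<Rightarrow> bool" where
  "jacobi_coeffs a b \<longleftrightarrow> (\<forall>n. a n > 0) \<and> bounded (range a) \<and>
     bounded (range (\<lambda>n. 1 / a n)) \<and> bounded (range b)"

definition jac_dist :: "(int \<Rightarrow> real) \<times> (int \<Rightarrow> real) \<Rightarrow> (int \<Rightarrow> real) \<times> (int \<Rightarrow> real) \<Rightarrow> real" where
  "jac_dist J J' = Sup {l2norm (\<lambda>n. jac_op (fst J) (snd J) u n - jac_op (fst J') (snd J') u n) | u.
                          u \<in> l2 \<and> l2norm u \<le> 1}"

definition jac_periodic :: "(int \<Rightarrow> real) \<Rightarrow> (int \<Rightarrow> real) \<Rightarrow> bool" where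
  "jac_periodic a b \<longleftrightarrow> jacobi_coeffs a b \<and>
     (\<exists>p::int. p > 0 \<and> (\<forall>n. a (n + p) = a n \<and> b (n + p) = b n))"

definition jac_limit_periodic :: "(int \<Rightarrow> real) \<Rightarrow> (int \<Rightarrow> real) \<Rightarrow> bool" where
  "jac_limit_periodic a b \<longleftrightarrow> jacobi_coeffs a b \<and>
     (\<exists>P :: nat \<Rightarrow> (int \<Rightarrow> real) \<times> (int \<Rightarrow> real).
        (\<forall>k. jac_periodic (fst (P k)) (snd (P k))) \<and>
        (\<lambda>k. jac_dist (P k) (a, b)) \<longlonglongrightarrow> 0)"

definition LP :: "real \<Rightarrow> ((int \<Rightarrow> real) \<times> (int \<Rightarrow> real)) set" where
  "LP M = {(a, b). jac_limit_periodic a b \<and>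
              (\<forall>n. \<bar>a n\<bar> \<le> M \<and> \<bar>1 / a n\<bar> \<le> M \<and> \<bar>b n\<bar> \<le> M)}"

text \<open>Spectrum (J is self-adjoint, so it suffices to consider real E).\<close>

definition jac_spectrum :: "(int \<Rightarrow> real) \<Rightarrow> (int \<Rightarrow> real) \<Rightarrow> real set" where
  "jac_spectrum a b = {E. \<not> bij_betw (\<lambda>u n. jac_op a b u n - of_real E * u n) l2 l2}"

text \<open>mu is the spectral measure of psi: a finite Borel measure on R with
  integral of x^k equal to <psi, J^k psi> for all k (this determines mu uniquely
  since J is bounded).\<close>

definition spectral_measure :: "(int \<Rightarrow> real) \<Rightarrow> (int \<Rightarrow> real) \<Rightarrow> (int \<Rightarrow> complex) \<Rightarrow> real measure \<Rightarrow> bool" where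
  "spectral_measure a b \<psi> \<mu> \<longleftrightarrow> sets \<mu> = sets borel \<and> finite_measure \<mu> \<and>
     (\<forall>k::nat. integrable \<mu> (\<lambda>x. x ^ k) \<and>
        complex_of_real (\<integral>x. x ^ k \<partial>\<mu>) = l2inner \<psi> ((jac_op a b ^^ k) \<psi>))"

definition purely_sing_cont :: "(int \<Rightarrow> real) \<Rightarrow> (int \<Rightarrow> real) \<Rightarrow> bool" where
  "purely_sing_cont a b \<longleftrightarrow> (\<forall>\<psi> \<in> l2. \<forall>\<mu>. spectral_measure a b \<psi> \<mu> \<longrightarrow>
      (\<exists>N \<in> sets borel. emeasure lborel N = 0 \<and> emeasure \<mu> (UNIV - N) = 0) \<and>
      (\<forall>x. emeasure \<mu> {x} = 0))"

definition cantor_set :: "real set \<Rightarrow> bool" where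
  "cantor_set K \<longleftrightarrow> compact K \<and> interior K = {} \<and> (\<forall>x\<in>K. x islimpt K)"

definition cover_num :: "real set \<Rightarrow> real \<Rightarrow> nat" where
  "cover_num K \<epsilon> = (LEAST n. \<exists>C. finite C \<and> card C = n \<and> K \<subseteq> (\<Union>c\<in>C. cball c \<epsilon>))"

definition lower_box_dim :: "real set \<Rightarrow> ereal" where
  "lower_box_dim K = Liminf (at_right 0) (\<lambda>\<epsilon>. ereal (ln (real (cover_num K \<epsilon>)) / ln (1 / \<epsilon>)))"

end

theory Submission
  imports Defs "HOL-Real_Asymp.Real_Asymp"
begin

text \<open>Only \<open>b\<close> is perturbed. Given a periodic \<open>J\<close> and an energy \<open>E\<close>, shearing the monodromy matrix by two
  small changes of \<open>b\<close> per (long) period opens a gap at \<open>E\<close>. By compactness finitely many periodic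
  perturbations have spectra with empty intersection. Concatenating long blocks of these gives a
  periodic operator with period \<open>P\<close>: at every energy, approximate eigenvectors decay exponentially
  into the middle of some block and can be cut there, so they live on a single period. Hence the spectrum
  is covered by \<open>O(P)\<close> intervals of length exponentially small in \<open>P\<close>. This survives small perturbations,
  and so does Gordon's estimate for periodic operators. A limit of such operators whose successive
  differences decrease fast enough has a spectrum of zero lower box dimension, in particular a Lebesgue
  null set, and no eigenvalues. An isolated point of the spectrum would be an eigenvalue, so the spectrum
  is a Cantor set.\<close>

section \<open>Symmetric operators on a Hilbert space\<close>

text \<open>A limit of operators retains only those properties of its approximants that hold on
  balls of known radius. Each requirement is therefore an estimate at a level \<open>k\<close>
  (\<open>covered\<close>, \<open>gordon\<close>) valid on a whole sup-norm ball of
  \<open>b\<close>, and spectral information is carried by lower bounds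
  \<open>norm (J u - E u) >= kappa * norm u\<close>. For symmetric operators such a bound is
  equivalent to bijectivity of \<open>J - E\<close>, and a perturbation costs only its own size.
  Lower box dimension asks for good scales along a sequence only: O(P) intervals of length exp(-cP)
  give a quotient of order log P / P. This works because the number of blocks and their common gap
  constant are fixed before the block length, which can then be increased freely. Perturbing
  \<open>b\<close> alone leaves the bounds on \<open>a\<close> and \<open>1 / a\<close> untouched,
  so room has to be made only in the bound on \<open>b\<close>. Spectral measures are known through
  their moments only. Powers of \<open>1 - (x - E)^2 / S^2\<close> take the place of indicator
  functions, and the corresponding operator powers are controlled in norm.\<close>

definition bounded_below :: "('h::real_normed_vector \<Rightarrow> 'h) \<Rightarrow> bool" where
  "bounded_below A \<longleftrightarrow> (\<exists>\<kappa>>0. \<forall>u. norm (A u) \<ge> \<kappa> * norm u)"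

lemma bounded_belowI: "\<kappa> > 0 \<Longrightarrow> (\<And>u. norm (A u) \<ge> \<kappa> * norm u) \<Longrightarrow> bounded_below A"
  unfolding bounded_below_def by blast

locale symmetric_operator = bounded_linear A
  for A :: "'h::{real_inner,complete_space} \<Rightarrow> 'h" +
  assumes symmetric: "inner (A x) y = inner x (A y)"
begin

lemma symmetric_operator_shift: "symmetric_operator (\<lambda>u. A u - c *\<^sub>R u)"
proof -
  have "bounded_linear (\<lambda>u. A u - c *\<^sub>R u)"
    by (intro bounded_linear_sub bounded_linear_axioms bounded_linear_scaleR_right)
  then show ?thesis
    by (simp add: symmetric_operator_def symmetric_operator_axioms_def inner_diff_left
        inner_diff_right symmetric)
qed

lemma pos_norm_bound: obtains K where "K > 0" "\<And>u. norm (A u) \<le> K * norm u"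
  using pos_bounded by (metis mult.commute)

text \<open>The cross term of the square gains \<open>(norm (A u))^2 / K^2\<close> twice; one copy
  pays for the quadratic term.\<close>

lemma contraction_norm_le:
  assumes K: "K > 0" "\<And>u. norm (A u) \<le> K * norm u"
  shows "(norm (u - (1/K\<^sup>2) *\<^sub>R A (A u)))\<^sup>2 \<le> (norm u)\<^sup>2 - (norm (A u))\<^sup>2 / K\<^sup>2"
proof -
  define l where "l = 1/K\<^sup>2"
  have "(norm (u - l *\<^sub>R A (A u)))\<^sup>2
      = (norm u)\<^sup>2 - 2 * l * (norm (A u))\<^sup>2 + l\<^sup>2 * (norm (A (A u)))\<^sup>2"
    by (simp add: power2_norm_eq_inner inner_diff_left inner_diff_right symmetric
        power2_eq_square[of l] inner_commute algebra_simps)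
  then have "(norm (u - (1/K\<^sup>2) *\<^sub>R A (A u)))\<^sup>2
      = (norm u)\<^sup>2 - 2 / K\<^sup>2 * (norm (A u))\<^sup>2 + (norm (A (A u)))\<^sup>2 / K^4"
    by (simp add: l_def power_divide)
  also have "(norm (A (A u)))\<^sup>2 \<le> (K * norm (A u))\<^sup>2"
    by (rule power_mono[OF K(2)]) simp
  then have "(norm (A (A u)))\<^sup>2 / K^4 \<le> (norm (A u))\<^sup>2 / K\<^sup>2"
    using K(1) by (simp add: field_simps power2_eq_square power4_eq_xxxx)
  finally show ?thesis by simp
qed

text \<open>Surjectivity by solving \<open>A (A w) = y\<close> through the contraction
  \<open>w \<mapsto> w - (A (A w) - y) / K\<^sup>2\<close>.\<close>
lemma bij_if_bounded_below:
  assumes "bounded_below A"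
  shows "bij A"
proof -
  obtain \<kappa> where \<kappa>: "\<kappa> > 0" "\<And>u. norm (A u) \<ge> \<kappa> * norm u"
    using assms unfolding bounded_below_def by blast
  obtain K where K: "K > 0" "\<And>u. norm (A u) \<le> K * norm u"
    using pos_norm_bound by blast
  \<comment> \<open>The minimum with 1/2 keeps the radicand nonnegative without comparing
    \<open>\<kappa>\<close> and \<open>K\<close>.\<close>
  define q where "q = sqrt (1 - min (1/2) (\<kappa>\<^sup>2 / K\<^sup>2))"
  have m: "min (1/2) (\<kappa>\<^sup>2 / K\<^sup>2) > 0" using \<kappa>(1) K(1) by simp
  have q: "0 \<le> q" "q < 1" "q\<^sup>2 = 1 - min (1/2) (\<kappa>\<^sup>2 / K\<^sup>2)"
    using m min.cobounded1[of "1/2" "\<kappa>\<^sup>2 / K\<^sup>2"] unfolding q_def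
    by (simp_all del: min.cobounded1)
  have contr: "norm (u - (1/K\<^sup>2) *\<^sub>R A (A u)) \<le> q * norm u" for u
  proof (rule power2_le_imp_le)
    have "(norm (u - (1/K\<^sup>2) *\<^sub>R A (A u)))\<^sup>2 \<le> (norm u)\<^sup>2 - (norm (A u))\<^sup>2 / K\<^sup>2"
      by (rule contraction_norm_le[OF K])
    also have "(\<kappa> * norm u)\<^sup>2 \<le> (norm (A u))\<^sup>2"
      using \<kappa> by (intro power_mono) auto
    then have "(norm u)\<^sup>2 - (norm (A u))\<^sup>2 / K\<^sup>2 \<le> (norm u)\<^sup>2 - \<kappa>\<^sup>2 / K\<^sup>2 * (norm u)\<^sup>2"
      using K(1) by (simp add: power_mult_distrib divide_right_mono)
    also have "min (1/2) (\<kappa>\<^sup>2 / K\<^sup>2) * (norm u)\<^sup>2 \<le> \<kappa>\<^sup>2 / K\<^sup>2 * (norm u)\<^sup>2"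
      by (intro mult_right_mono) auto
    then have "(norm u)\<^sup>2 - \<kappa>\<^sup>2 / K\<^sup>2 * (norm u)\<^sup>2 \<le> (q * norm u)\<^sup>2"
      unfolding power_mult_distrib q(3) by (simp add: algebra_simps)
    finally show "(norm (u - (1/K\<^sup>2) *\<^sub>R A (A u)))\<^sup>2 \<le> (q * norm u)\<^sup>2" by simp
  qed (use q in auto)
  have "\<exists>w. A w = y" for y
  proof -
    define g where "g w = w - (1/K\<^sup>2) *\<^sub>R (A (A w) - y)" for w
    have "dist (g x) (g z) \<le> q * dist x z" for x z
    proof -
      have "g x - g z = (x - z) - (1/K\<^sup>2) *\<^sub>R A (A (x - z))"
        unfolding g_def by (simp add: diff algebra_simps)
      then show ?thesis using contr[of "x - z"] by (simp add: dist_norm)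
    qed
    then have "\<exists>!w. g w = w" using banach_fix_type[OF q(1,2), of g] by blast
    then obtain w where "g w = w" by blast
    then have "A (A w) = y" using K(1) by (simp add: g_def)
    then show ?thesis by blast
  qed
  moreover have "inj A"
  proof (rule injI)
    fix x y assume "A x = A y"
    then have "norm (A (x - y)) = 0" by (simp add: diff)
    with \<kappa>(2)[of "x - y"] \<kappa>(1) show "x = y"
      by (simp add: mult_le_0_iff)
  qed
  ultimately show ?thesis by (metis bijI surjI)
qed

text \<open>A gliding hump (Sokal's proof of the uniform boundedness principle), applied to the
  functionals \<open>v \<mapsto> \<langle>u, v\<rangle>\<close>.\<close>
lemma bounded_below_if_bij:
  assumes "bij A"
  shows "bounded_below A"
proof (rule ccontr)
  assume nb: "\<not> bounded_below A"
  define T where "T = inv A"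
  have AT: "A (T x) = x" for x
    unfolding T_def using assms by (simp add: bij_is_surj surj_f_inv_f)
  have "\<exists>u. norm u = 4 ^ n \<and> norm (A u) \<le> 1" for n :: nat
  proof -
    have "\<not> (\<forall>u. norm (A u) \<ge> (1 / 4 ^ n) * norm u)"
      using nb bounded_belowI[of "1/4^n" A] by auto
    then obtain u where u: "norm (A u) < (1 / 4 ^ n) * norm u" by (auto simp: not_le)
    then have nz: "norm u > 0" by (metis norm_eq_zero zero mult_zero_right less_irrefl zero_less_norm_iff)
    define w where "w = (4 ^ n / norm u) *\<^sub>R u"
    have "norm w = 4 ^ n" using nz by (simp add: w_def)
    moreover have "norm (A w) \<le> 1"
      using u nz by (simp add: w_def scaleR field_simps)
    ultimately show ?thesis by blast
  qed
  then obtain f where f: "\<And>n. norm (f n) = 4 ^ n" "\<And>n. norm (A (f n)) \<le> 1" by metis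
  \<comment> \<open>The pairings of \<open>f n\<close> with \<open>x + h\<close> and
    \<open>x - h\<close> differ by \<open>2 * inner (f n) h\<close>, so one sign of the hump leaves
    a pairing of size at least (4/3)^n. All later humps together have norm at most (1/2) (1/3)^n and
    destroy at most half of it.\<close>
  have step: "\<exists>x'. norm (x' - x) \<le> (1/3) ^ n \<and> \<bar>inner (f n) x'\<bar> \<ge> (1/3) ^ n * 4 ^ n" for x n
  proof -
    define h where "h = ((1/3) ^ n / norm (f n)) *\<^sub>R f n"
    have h: "norm h = (1/3) ^ n" "inner (f n) h = (1/3) ^ n * 4 ^ n"
      using f(1)[of n] by (auto simp: h_def power2_norm_eq_inner[symmetric] power2_eq_square)
    have "\<bar>inner (f n) (x + h)\<bar> \<ge> inner (f n) h \<or> \<bar>inner (f n) (x - h)\<bar> \<ge> inner (f n) h"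
      by (simp add: inner_add_right inner_diff_right) linarith
    then show ?thesis
    proof
      assume "\<bar>inner (f n) (x + h)\<bar> \<ge> inner (f n) h"
      then show ?thesis using h by (intro exI[of _ "x + h"]) simp
    next
      assume "\<bar>inner (f n) (x - h)\<bar> \<ge> inner (f n) h"
      then show ?thesis using h by (intro exI[of _ "x - h"]) simp
    qed
  qed
  have "\<exists>X. \<forall>n. norm (X (Suc n) - X n) \<le> (1/3) ^ n \<and> \<bar>inner (f n) (X (Suc n))\<bar> \<ge> (1/3) ^ n * 4 ^ n"
    using dependent_nat_choice[of "\<lambda>_ _. True"
        "\<lambda>n x x'. norm (x' - x) \<le> (1/3) ^ n \<and> \<bar>inner (f n) x'\<bar> \<ge> (1/3) ^ n * 4 ^ n"] step by auto
  then obtain X where X: "\<And>n. norm (X (Suc n) - X n) \<le> (1/3) ^ n"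
    "\<And>n. \<bar>inner (f n) (X (Suc n))\<bar> \<ge> (1/3) ^ n * 4 ^ n" by blast
  have far: "norm (X (n + k) - X n) \<le> (1/2) * (1/3) ^ n * 3 - (1/2) * (1/3) ^ (n + k) * 3" for n k
  proof (induction k)
    case (Suc k)
    have "norm (X (n + Suc k) - X n) \<le> norm (X (Suc (n + k)) - X (n + k)) + norm (X (n + k) - X n)"
      using norm_triangle_ineq[of "X (Suc (n + k)) - X (n + k)" "X (n + k) - X n"] by simp
    also have "\<dots> \<le> (1/3) ^ (n + k) + ((1/2) * (1/3) ^ n * 3 - (1/2) * (1/3) ^ (n + k) * 3)"
      using X(1)[of "n + k"] Suc by linarith
    finally show ?case by simp
  qed simp
  have far': "norm (X m - X n) \<le> (1/2) * (1/3) ^ n * 3" if "m \<ge> n" for m n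
  proof -
    obtain k where "m = n + k" using \<open>m \<ge> n\<close> le_Suc_ex by blast
    moreover have "(1/3 :: real) ^ (n + k) \<ge> 0" by (rule zero_le_power) simp
    then have "norm (X (n + k) - X n) \<le> (1/2) * (1/3) ^ n * 3" using far[of n k] by linarith
    ultimately show ?thesis by simp
  qed
  have "Cauchy X"
  proof (rule metric_CauchyI)
    fix e :: real assume "e > 0"
    then obtain N where N: "(1/3 :: real) ^ N < e / 3"
      using real_arch_pow_inv[of "e/3" "1/3"] by auto
    have "dist (X m) (X n) < e" if "m \<ge> N" "n \<ge> N" for m n
      using far'[OF that(1)] far'[OF that(2)] N norm_triangle_ineq4[of "X m - X N" "X n - X N"]
      by (simp add: dist_norm)
    then show "\<exists>M. \<forall>m\<ge>M. \<forall>n\<ge>M. dist (X m) (X n) < e" by blast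
  qed
  then obtain L where L: "X \<longlonglongrightarrow> L" using Cauchy_convergent convergent_def by blast
  have LX: "norm (L - X n) \<le> (1/2) * (1/3) ^ n * 3" for n
  proof (rule LIMSEQ_le_const2)
    show "(\<lambda>m. norm (X m - X n)) \<longlonglongrightarrow> norm (L - X n)" by (intro tendsto_intros L)
    show "\<exists>N. \<forall>m\<ge>N. norm (X m - X n) \<le> (1/2) * (1/3) ^ n * 3" using far' by blast
  qed
  have big: "norm (T L) \<ge> (1/2) * (4/3) ^ n" for n
  proof -
    have "\<bar>inner (f n) (L - X (Suc n))\<bar> \<le> norm (f n) * norm (L - X (Suc n))"
      by (rule Cauchy_Schwarz_ineq2)
    also have "\<dots> \<le> 4 ^ n * ((1/2) * (1/3) ^ n)"
      using LX[of "Suc n"] f(1)[of n] by (intro mult_mono) auto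
    finally have "\<bar>inner (f n) L\<bar> \<ge> (1/2) * ((1/3) ^ n * 4 ^ n)"
      using X(2)[of n] abs_triangle_ineq2_sym[of "inner (f n) (X (Suc n))" "inner (f n) L"]
      unfolding inner_diff_right by argo
    also have "(1/3) ^ n * 4 ^ n = (4/3 :: real) ^ n" by (simp flip: power_mult_distrib)
    \<comment> \<open>Surjectivity enters through \<open>L = A (T L)\<close>: symmetry moves
      \<open>A\<close> to \<open>f n\<close>, whose image has norm at most 1, so the fixed vector
      \<open>T L\<close> would have arbitrarily large norm.\<close>
    finally have "(1/2) * (4/3) ^ n \<le> \<bar>inner (f n) (A (T L))\<bar>" by (simp add: AT)
    also have "\<dots> = \<bar>inner (A (f n)) (T L)\<bar>" by (simp add: symmetric)
    also have "\<dots> \<le> norm (A (f n)) * norm (T L)" by (rule Cauchy_Schwarz_ineq2)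
    also have "\<dots> \<le> 1 * norm (T L)" using f(2) by (intro mult_right_mono) auto
    finally show ?thesis by simp
  qed
  obtain n where "2 * norm (T L) < (4/3) ^ n" using real_arch_pow[of "4/3" "2 * norm (T L)"] by auto
  with big[of n] show False by simp
qed

lemma bij_iff_bounded_below: "bij A \<longleftrightarrow> bounded_below A"
  using bij_if_bounded_below bounded_below_if_bij by blast

text \<open>With \<open>c\<close> the infimum of \<open>\<parallel>A u\<parallel>\<close> over unit vectors, \<open>B = A\<^sup>2 - c\<^sup>2\<close> is nonnegative,
  so \<open>\<parallel>B u\<parallel>\<^sup>2 \<le> K \<langle>B u, u\<rangle>\<close>; if \<open>c < r\<close> then both factors \<open>A \<plusminus> c\<close> of \<open>B\<close> are bounded below,
  which contradicts the choice of \<open>c\<close>.\<close>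
lemma norm_ge_of_spectral_gap:
  assumes gap: "\<And>c. \<bar>c\<bar> < r \<Longrightarrow> bij (\<lambda>u. A u - c *\<^sub>R u)"
  shows "norm (A u) \<ge> r * norm u"
proof (cases "u = 0")
  case False
  define S where "S = {norm (A v) | v. norm v = 1}"
  define c where "c = Inf S"
  define w where "w = (1 / norm u) *\<^sub>R u"
  have w: "norm w = 1" using False by (simp add: w_def)
  have bdd: "bdd_below S" by (rule bdd_belowI[of _ 0]) (auto simp: S_def)
  have ne: "S \<noteq> {}" using w S_def by auto
  have c0: "c \<ge> 0" unfolding c_def by (rule cInf_greatest[OF ne]) (auto simp: S_def)
  have cle1: "c \<le> norm (A v)" if "norm v = 1" for v
    unfolding c_def by (rule cInf_lower[OF _ bdd]) (use that S_def in auto)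
  have cle: "c * norm v \<le> norm (A v)" for v
  proof (cases "v = 0")
    case False
    then show ?thesis using cle1[of "(1 / norm v) *\<^sub>R v"] by (simp add: scaleR field_simps)
  qed auto
  have "c \<ge> r"
  proof (rule ccontr)
    assume "\<not> c \<ge> r"
    then have cr: "\<bar>c\<bar> < r" "\<bar>-c\<bar> < r" using c0 by auto
    interpret P: symmetric_operator "\<lambda>u. A u - c *\<^sub>R u" by (rule symmetric_operator_shift)
    interpret N: symmetric_operator "\<lambda>u. A u - (-c) *\<^sub>R u" by (rule symmetric_operator_shift)
    obtain c1 where c1: "c1 > 0" "\<And>v. norm (A v - c *\<^sub>R v) \<ge> c1 * norm v"
      using P.bounded_below_if_bij[OF gap[OF cr(1)]] unfolding bounded_below_def by blast
    obtain c2 where c2: "c2 > 0" "\<And>v. norm (A v - (-c) *\<^sub>R v) \<ge> c2 * norm v"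
      using N.bounded_below_if_bij[OF gap[OF cr(2)]] unfolding bounded_below_def by blast
    define B where "B v = A (A v) - c\<^sup>2 *\<^sub>R v" for v
    have Bfac: "B v = A (A v - (-c) *\<^sub>R v) - c *\<^sub>R (A v - (-c) *\<^sub>R v)" for v
      by (simp add: B_def diff add scaleR algebra_simps power2_eq_square)
    have Blow: "norm (B v) \<ge> c1 * c2 * norm v" for v
      using c1(2)[of "A v - (-c) *\<^sub>R v"] c2(2)[of v] c1(1) unfolding Bfac
      by (smt (verit, best) mult.assoc mult_left_mono)
    have Bsym: "inner (B x) y = inner x (B y)" for x y
      by (simp add: B_def inner_diff_left inner_diff_right symmetric)
    have Bin: "inner (B v) v = (norm (A v))\<^sup>2 - c\<^sup>2 * (norm v)\<^sup>2" for v
      by (simp add: B_def inner_diff_left power2_norm_eq_inner symmetric)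
    have Bpos: "inner (B v) v \<ge> 0" for v
    proof -
      have "(c * norm v)\<^sup>2 \<le> (norm (A v))\<^sup>2" using cle[of v] c0 by (intro power_mono) auto
      then show ?thesis by (simp add: Bin power_mult_distrib)
    qed
    obtain K where K: "K > 0" "\<And>u. norm (A u) \<le> K * norm u" using pos_norm_bound by blast
    have BK: "inner (B v) v \<le> K\<^sup>2 * (norm v)\<^sup>2" for v
    proof -
      have "(norm (A v))\<^sup>2 \<le> (K * norm v)\<^sup>2" by (rule power_mono[OF K(2)]) simp
      moreover have "0 \<le> c\<^sup>2 * (norm v)\<^sup>2" by simp
      ultimately show ?thesis unfolding Bin power_mult_distrib by linarith
    qed
    \<comment> \<open>The operator inequality B^2 <= K^2 B, from nonnegativity of the form of
      \<open>B\<close> at \<open>v - B v / K^2\<close>; no square root of \<open>B\<close> is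
      taken.\<close>
    have Bsq: "(norm (B v))\<^sup>2 \<le> K\<^sup>2 * inner (B v) v" for v
    proof -
      define l where "l = 1 / K\<^sup>2"
      have "0 \<le> inner (B (v - l *\<^sub>R B v)) (v - l *\<^sub>R B v)" by (rule Bpos)
      also have "B (v - l *\<^sub>R B v) = B v - l *\<^sub>R B (B v)"
        by (simp add: B_def diff add scaleR algebra_simps)
      also have "inner (B v - l *\<^sub>R B (B v)) (v - l *\<^sub>R B v)
          = inner (B v) v - 2 * l * (norm (B v))\<^sup>2 + l\<^sup>2 * inner (B (B v)) (B v)"
        by (simp add: inner_diff_left inner_diff_right Bsym power2_norm_eq_inner power2_eq_square[of l]
            inner_commute algebra_simps)
      also have "l\<^sup>2 * inner (B (B v)) (B v) \<le> l\<^sup>2 * (K\<^sup>2 * (norm (B v))\<^sup>2)"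
        using BK by (intro mult_left_mono) auto
      also have "\<dots> = l * (norm (B v))\<^sup>2" using K(1) by (simp add: l_def power2_eq_square)
      finally have "l * (norm (B v))\<^sup>2 \<le> inner (B v) v" by simp
      then show ?thesis using K(1) by (simp add: l_def field_simps)
    qed
    define d where "d = (c1 * c2)\<^sup>2 / K\<^sup>2"
    have d: "d > 0" using c1 c2 K by (simp add: d_def)
    have low: "sqrt (c\<^sup>2 + d) \<le> norm (A v)" if "norm v = 1" for v
    proof -
      have "(c1 * c2)\<^sup>2 \<le> (norm (B v))\<^sup>2" using Blow[of v] that c1 c2 by (intro power_mono) auto
      also have "\<dots> \<le> K\<^sup>2 * ((norm (A v))\<^sup>2 - c\<^sup>2)" using Bsq[of v] Bin[of v] that by simp
      finally have "c\<^sup>2 + d \<le> (norm (A v))\<^sup>2" using K(1) by (simp add: d_def field_simps)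
      then show ?thesis by (simp add: real_le_lsqrt)
    qed
    have "sqrt (c\<^sup>2 + d) \<le> c"
      unfolding c_def using low by (intro cInf_greatest[OF ne]) (auto simp: S_def c_def)
    moreover have "sqrt (c\<^sup>2 + d) > c" using d c0 by (intro real_less_rsqrt) auto
    ultimately show False by simp
  qed
  then have "r * norm u \<le> c * norm u" by (intro mult_right_mono) auto
  with cle[of u] show ?thesis by linarith
qed auto

text \<open>The numbers \<open>\<langle>Q\<^sup>k u, u\<rangle>\<close> are nonnegative and decrease in \<open>k\<close>, which makes \<open>Q\<^sup>n u\<close> a Cauchy
  sequence; its limit lies in the kernel of \<open>A\<close>.\<close>
lemma contraction_powers_tendsto_0:
  fixes R :: real
  assumes R: "R > 0" "\<And>u. norm (A u) \<le> R * norm u" and inj: "\<And>u. A u = 0 \<Longrightarrow> u = 0"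
  defines "Q \<equiv> \<lambda>u. u - (1 / R\<^sup>2) *\<^sub>R A (A u)"
  shows "(\<lambda>n. (Q ^^ n) u) \<longlonglongrightarrow> 0"
proof -
  have Qbl: "bounded_linear Q"
    unfolding Q_def
    by (intro bounded_linear_sub bounded_linear_ident bounded_linear_const_scaleR
        bounded_linear_compose[OF bounded_linear_axioms] bounded_linear_axioms)
  interpret Q: bounded_linear Q by (rule Qbl)
  have Qsym: "inner (Q x) y = inner x (Q y)" for x y
    by (simp add: Q_def inner_diff_left inner_diff_right symmetric)
  have Qpow: "inner ((Q ^^ n) x) y = inner x ((Q ^^ n) y)" for n x y
    by (induction n arbitrary: x y) (auto simp: Qsym funpow_swap1)
  have QA: "(Q ^^ n) (A x) = A ((Q ^^ n) x)" for n x
    by (induction n) (auto simp: Q_def diff scaleR)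
  have Qlin: "(Q ^^ n) (x - s *\<^sub>R y) = (Q ^^ n) x - s *\<^sub>R (Q ^^ n) y" for n x y s
    by (induction n) (auto simp: Q.diff Q.scaleR)
  define c where "c x k = inner ((Q ^^ k) x) x" for x k
  have dbl: "c x (n + m) = inner ((Q ^^ n) x) ((Q ^^ m) x)" for n m x
    unfolding c_def add.commute[of n m] funpow_add o_def by (subst Qpow) simp
  \<comment> \<open>An even index gives a square of a norm. An odd index leaves one extra factor
    \<open>Q\<close>, and \<open>Q\<close> is nonnegative because \<open>R\<close> bounds
    \<open>A\<close>.\<close>
  have pos: "c x k \<ge> 0" for x k
  proof (cases "even k")
    case True
    then obtain j where "k = j + j" by (metis evenE mult_2)
    then show ?thesis by (simp add: dbl)
  next
    case False
    then obtain j where j: "k = Suc (j + j)" by (metis oddE mult_2 Suc_eq_plus1)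
    define w where "w = (Q ^^ j) x"
    have "c x k = inner ((Q ^^ Suc j) x) ((Q ^^ j) x)"
      using dbl[of x "Suc j" j] j by simp
    also have "\<dots> = inner (Q w) w" by (simp add: w_def)
    also have "\<dots> = (norm w)\<^sup>2 - (norm (A w))\<^sup>2 / R\<^sup>2"
      by (simp add: Q_def inner_diff_left power2_norm_eq_inner symmetric)
    also have "\<dots> \<ge> 0"
      using power_mono[OF R(2)[of w], of 2] R(1) by (simp add: field_simps power_mult_distrib)
    finally show ?thesis .
  qed
  have dec: "c u (Suc k) \<le> c u k" for k
  proof -
    have "c u (Suc k) = inner ((Q ^^ k) (Q u)) u"
      by (simp add: c_def funpow_swap1)
    also have "(Q ^^ k) (Q u) = (Q ^^ k) u - (1 / R\<^sup>2) *\<^sub>R A ((Q ^^ k) (A u))"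
      unfolding QA[symmetric] Qlin[symmetric] by (simp add: Q_def)
    also have "inner \<dots> u = c u k - c (A u) k / R\<^sup>2"
      by (simp add: inner_diff_left symmetric c_def)
    finally show ?thesis using pos[of "A u" k] R(1) by simp
  qed
  have "decseq (c u)" using dec by (simp add: decseq_Suc_iff)
  then have "convergent (c u)"
    using decseq_convergent[of "c u" 0] pos unfolding convergent_def by blast
  then have Cc: "Cauchy (c u)" by (rule convergent_Cauchy)
  have "Cauchy (\<lambda>n. (Q ^^ n) u)"
  proof (rule metric_CauchyI)
    fix e :: real assume e: "e > 0"
    then obtain N where N: "\<And>m n. m \<ge> N \<Longrightarrow> n \<ge> N \<Longrightarrow> dist (c u m) (c u n) < e\<^sup>2 / 2"
      using metric_CauchyD[OF Cc, of "e\<^sup>2/2"] by auto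
    have "dist ((Q ^^ m) u) ((Q ^^ n) u) < e" if "m \<ge> N" "n \<ge> N" for m n
    proof -
      have "(norm ((Q ^^ m) u - (Q ^^ n) u))\<^sup>2 = (c u (m + m) - c u (m + n)) + (c u (n + n) - c u (m + n))"
        by (simp add: power2_norm_eq_inner inner_diff_left inner_diff_right dbl inner_commute)
      also have "\<dots> < e\<^sup>2 / 2 + e\<^sup>2 / 2"
        using N[of "m + m" "m + n"] N[of "n + n" "m + n"] that
        unfolding dist_real_def by (intro add_strict_mono) (smt (verit) trans_le_add1)+
      finally show ?thesis using e by (simp add: dist_norm power_less_imp_less_base)
    qed
    then show "\<exists>M. \<forall>m\<ge>M. \<forall>n\<ge>M. dist ((Q ^^ m) u) ((Q ^^ n) u) < e" by blast
  qed
  then obtain w where w: "(\<lambda>n. (Q ^^ n) u) \<longlonglongrightarrow> w" using Cauchy_convergent convergent_def by blast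
  have "(\<lambda>n. (Q ^^ Suc n) u) \<longlonglongrightarrow> Q w" using Q.tendsto[OF w] by simp
  then have "Q w = w" using LIMSEQ_Suc[OF w] LIMSEQ_unique by blast
  then have "A (A w) = 0" using R(1) by (simp add: Q_def)
  then have "w = 0" using inj by blast
  with w show ?thesis by simp
qed

text \<open>Each \<open>(Q ^^ n) u\<close> differs from \<open>u\<close> by an element of the range
  of \<open>A\<close> composed with itself. Since the iterates tend to 0, these elements tend to
  \<open>u\<close>.\<close>

lemma dense_range_square:
  assumes inj: "\<And>u. A u = 0 \<Longrightarrow> u = 0"
  shows "\<exists>X. (\<lambda>n. A (A (X n))) \<longlonglongrightarrow> u"
proof -
  obtain R where R: "R > 0" "\<And>u. norm (A u) \<le> R * norm u" using pos_norm_bound by blast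
  define Q where "Q = (\<lambda>u. u - (1 / R\<^sup>2) *\<^sub>R A (A u))"
  have "\<exists>x. (Q ^^ n) u = u - A (A x)" for n
  proof (induction n)
    case 0
    show ?case by (intro exI[of _ 0]) (simp add: zero)
  next
    case (Suc n)
    then obtain x where "(Q ^^ n) u = u - A (A x)" by blast
    then have "(Q ^^ Suc n) u = u - A (A (x + (1 / R\<^sup>2) *\<^sub>R (u - A (A x))))"
      by (simp add: Q_def add diff scaleR)
    then show ?case by blast
  qed
  then obtain X where X: "\<And>n. (Q ^^ n) u = u - A (A (X n))" by metis
  have "(\<lambda>n. u - A (A (X n))) \<longlonglongrightarrow> 0"
    using contraction_powers_tendsto_0[OF R, of u] inj unfolding Q_def[symmetric] X by blast
  then have "(\<lambda>n. u - (u - A (A (X n)))) \<longlonglongrightarrow> u - 0" by (intro tendsto_intros)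
  then show ?thesis by (intro exI[of _ X]) simp
qed

text \<open>The polynomial x (x - c) is negative only between 0 and c. A gap there, seen from its
  midpoint, is a lower bound |c| / 2 for \<open>A - c / 2\<close>, and squaring that bound completes
  the square.\<close>

lemma form_gap:
  assumes gap: "\<And>d. \<bar>d - c / 2\<bar> < \<bar>c\<bar> / 2 \<Longrightarrow> bij (\<lambda>u. A u - d *\<^sub>R u)"
  shows "inner (A (A u) - c *\<^sub>R A u) u \<ge> 0"
proof -
  interpret S: symmetric_operator "\<lambda>u. A u - (c/2) *\<^sub>R u" by (rule symmetric_operator_shift)
  have "norm (A u - (c/2) *\<^sub>R u) \<ge> (\<bar>c\<bar> / 2) * norm u"
  proof (rule S.norm_ge_of_spectral_gap)
    fix d assume "\<bar>d\<bar> < \<bar>c\<bar> / 2"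
    then have "bij (\<lambda>u. A u - (d + c/2) *\<^sub>R u)" by (intro gap) simp
    then show "bij (\<lambda>u. A u - (c/2) *\<^sub>R u - d *\<^sub>R u)" by (simp add: algebra_simps)
  qed
  then have "((\<bar>c\<bar> / 2) * norm u)\<^sup>2 \<le> (norm (A u - (c/2) *\<^sub>R u))\<^sup>2" by (intro power_mono) auto
  also have "\<dots> = inner (A (A u)) u - c * inner (A u) u + (c/2)\<^sup>2 * (norm u)\<^sup>2"
    unfolding power2_eq_square[of "c/2"]
    by (simp add: power2_norm_eq_inner inner_diff_left inner_diff_right symmetric
        inner_commute algebra_simps)
  also have "((\<bar>c\<bar> / 2) * norm u)\<^sup>2 = (c/2)\<^sup>2 * (norm u)\<^sup>2"
    by (simp add: power_mult_distrib power_divide)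
  finally show ?thesis by (simp add: inner_diff_left)
qed

text \<open>If \<open>B\<^sub>1 = A\<^sup>2 - cA\<close> and \<open>B\<^sub>2 = A\<^sup>2 + cA\<close> are nonnegative then so is
  \<open>B\<^sub>1 B\<^sub>2 (B\<^sub>1 + B\<^sub>2) = 2 A\<^sup>4 (A\<^sup>2 - c\<^sup>2)\<close>.\<close>
lemma bounded_below_if_isolated:
  assumes r: "r > 0" and gap: "\<And>d. d \<noteq> 0 \<Longrightarrow> \<bar>d\<bar> < r \<Longrightarrow> bij (\<lambda>u. A u - d *\<^sub>R u)"
    and inj: "\<And>u. A u = 0 \<Longrightarrow> u = 0"
  shows "bounded_below A"
proof -
  define B1 where "B1 u = A (A u) - r *\<^sub>R A u" for u
  define B2 where "B2 u = A (A u) - (-r) *\<^sub>R A u" for u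
  have p1: "inner (B1 u) u \<ge> 0" for u unfolding B1_def
  proof (rule form_gap)
    fix d assume "\<bar>d - r / 2\<bar> < \<bar>r\<bar> / 2"
    then have "d \<noteq> 0" "\<bar>d\<bar> < r" using r unfolding abs_if by (auto split: if_splits)
    then show "bij (\<lambda>u. A u - d *\<^sub>R u)" by (rule gap)
  qed
  have p2: "inner (B2 u) u \<ge> 0" for u unfolding B2_def
  proof (rule form_gap)
    fix d assume "\<bar>d - - r / 2\<bar> < \<bar>- r\<bar> / 2"
    then have "d \<noteq> 0" "\<bar>d\<bar> < r" using r unfolding abs_if by (auto split: if_splits)
    then show "bij (\<lambda>u. A u - d *\<^sub>R u)" by (rule gap)
  qed
  have cube: "norm (A (A (A u))) \<ge> r * norm (A (A u))" for u
  proof (rule power2_le_imp_le)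
    have "0 \<le> inner (B2 (B1 u)) (B1 u) + inner (B1 (B2 u)) (B2 u)" using p1 p2 by simp
    also have "\<dots> = 2 * ((norm (A (A (A u))))\<^sup>2 - r\<^sup>2 * (norm (A (A u)))\<^sup>2)"
      unfolding B1_def B2_def
      by (simp add: diff add scaleR power2_norm_eq_inner inner_diff_left inner_diff_right inner_add_left
          inner_add_right symmetric inner_commute power2_eq_square[of r] algebra_simps)
    finally show "(r * norm (A (A u)))\<^sup>2 \<le> (norm (A (A (A u))))\<^sup>2" by (simp add: power_mult_distrib)
  qed simp
  \<comment> \<open>\<open>cube\<close> is this bound on the range of the square of
    \<open>A\<close>; injectivity makes that range dense and continuity extends the bound.\<close>
  have "norm (A v) \<ge> r * norm v" for v
  proof -
    obtain X where X: "(\<lambda>n. A (A (X n))) \<longlonglongrightarrow> v" using dense_range_square[OF inj] by blast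
    show ?thesis
    proof (rule LIMSEQ_le)
      show "(\<lambda>n. r * norm (A (A (X n)))) \<longlonglongrightarrow> r * norm v" by (intro tendsto_intros X)
      show "(\<lambda>n. norm (A (A (A (X n))))) \<longlonglongrightarrow> norm (A v)" by (intro tendsto_intros X tendsto)
    qed (use cube in auto)
  qed
  with r show ?thesis by (rule bounded_belowI)
qed

text \<open>Quantitative orthogonality of eigenvectors: in \<open>(x - y) * inner v w\<close>
  symmetry cancels the terms with \<open>A\<close>, and only the residuals are left.\<close>

lemma inner_near_eigenvectors:
  assumes "norm v \<le> 1" "norm w \<le> 1" "norm (A v - x *\<^sub>R v) \<le> \<rho>" "norm (A w - y *\<^sub>R w) \<le> \<rho>"
  shows "\<bar>x - y\<bar> * \<bar>inner v w\<bar> \<le> 2 * \<rho>"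
proof -
  have "(x - y) * inner v w = inner v (A w - y *\<^sub>R w) - inner (A v - x *\<^sub>R v) w"
    by (simp add: inner_diff_left inner_diff_right symmetric algebra_simps)
  moreover have "\<bar>inner v (A w - y *\<^sub>R w)\<bar> \<le> 1 * \<rho>"
    using Cauchy_Schwarz_ineq2[of v "A w - y *\<^sub>R w"] assms
    by (meson mult_mono norm_ge_zero order_trans zero_le_one)
  moreover have "\<bar>inner (A v - x *\<^sub>R v) w\<bar> \<le> \<rho> * 1"
    using Cauchy_Schwarz_ineq2[of "A v - x *\<^sub>R v" w] assms
    by (meson mult_mono norm_ge_zero order_trans zero_le_one)
  ultimately show ?thesis by (simp flip: abs_mult)
qed

end

text \<open>Diagonal dominance of the Gram matrix: pair a vanishing combination with the vector of
  largest coefficient; the off-diagonal terms amount to at most half of that coefficient.\<close>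

lemma independent_if_nearly_orthogonal:
  fixes W :: "'h::real_inner set"
  assumes fin: "finite W" and unit: "\<And>w. w \<in> W \<Longrightarrow> norm w = 1"
    and near: "\<And>v w. v \<in> W \<Longrightarrow> w \<in> W \<Longrightarrow> v \<noteq> w \<Longrightarrow> \<bar>inner v w\<bar> \<le> 1 / (2 * real (card W))"
  shows "independent W"
proof (rule independent_if_scalars_zero[OF fin])
  fix f :: "'h \<Rightarrow> real" and x
  assume s: "(\<Sum>w\<in>W. f w *\<^sub>R w) = 0" and x: "x \<in> W"
  obtain m where m: "m \<in> W" "\<And>w. w \<in> W \<Longrightarrow> \<bar>f w\<bar> \<le> \<bar>f m\<bar>"
  proof -
    have "Max ((\<lambda>w. \<bar>f w\<bar>) ` W) \<in> (\<lambda>w. \<bar>f w\<bar>) ` W" using fin x by (intro Max_in) auto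
    then obtain m where "m \<in> W" "\<bar>f m\<bar> = Max ((\<lambda>w. \<bar>f w\<bar>) ` W)" by auto
    with fin show ?thesis by (intro that[of m]) auto
  qed
  have c: "real (card W) > 0" using fin x by (auto simp: card_gt_0_iff)
  have "0 = inner (\<Sum>w\<in>W. f w *\<^sub>R w) m" by (simp add: s)
  also have "\<dots> = (\<Sum>w\<in>W. f w * inner w m)" by (simp add: inner_sum_left)
  also have "\<dots> = f m + (\<Sum>w\<in>W - {m}. f w * inner w m)"
    using unit[OF m(1)] by (subst sum.remove[OF fin m(1)]) (simp flip: power2_norm_eq_inner)
  finally have "\<bar>f m\<bar> = \<bar>\<Sum>w\<in>W - {m}. f w * inner w m\<bar>" by linarith
  also have "\<dots> \<le> (\<Sum>w\<in>W - {m}. \<bar>f w * inner w m\<bar>)" by (rule sum_abs)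
  also have "\<dots> \<le> (\<Sum>w\<in>W - {m}. \<bar>f m\<bar> * (1 / (2 * real (card W))))"
    unfolding abs_mult using m near by (intro sum_mono mult_mono) auto
  also have "\<dots> \<le> real (card W) * (\<bar>f m\<bar> * (1 / (2 * real (card W))))"
    unfolding sum_constant using fin by (intro mult_right_mono) (auto simp: card_mono)
  also have "\<dots> = \<bar>f m\<bar> / 2" using c by simp
  finally have "f m = 0" by simp
  with m(2)[OF x] show "f x = 0" by simp
qed

text \<open>Well separated approximate eigenvalues have nearly orthogonal approximate eigenvectors, so an
  \<open>N\<close>-dimensional space accommodates at most \<open>N\<close> of them.\<close>
lemma (in symmetric_operator) cover_approx_eigenvalues:
  assumes B: "finite B" "card B = N" "N > 0" and \<rho>: "\<rho> > 0"
    and X: "\<And>x. x \<in> X \<Longrightarrow> \<exists>v\<in>span B. norm v = 1 \<and> norm (A v - x *\<^sub>R v) \<le> \<rho>"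
  shows "\<exists>F. finite F \<and> card F \<le> N \<and> (\<forall>x\<in>X. \<exists>c\<in>F. \<bar>x - c\<bar> \<le> 8 * \<rho> * real N)"
proof -
  \<comment> \<open>At separation beyond \<open>8 * \<rho> * N\<close> the inner products are at
    most 1 / (4 N), hence at most 1 / (2 (N + 1)), as required for independence of
    \<open>N + 1\<close> vectors.\<close>
  define s where "s = 8 * \<rho> * real N"
  define sep where "sep F \<longleftrightarrow> F \<subseteq> X \<and> finite F \<and> (\<forall>x\<in>F. \<forall>y\<in>F. x \<noteq> y \<longrightarrow> \<bar>x - y\<bar> > s)" for F
  have le: "card F \<le> N" if "sep F" for F
  proof (rule ccontr)
    assume "\<not> card F \<le> N"
    then obtain G where G: "G \<subseteq> F" "card G = Suc N" "finite G"
      by (meson not_less_eq_eq obtain_subset_with_card_n)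
    have "\<forall>x\<in>G. \<exists>v\<in>span B. norm v = 1 \<and> norm (A v - x *\<^sub>R v) \<le> \<rho>"
      using X G that by (auto simp: sep_def)
    then obtain v where v: "\<And>x. x \<in> G \<Longrightarrow> v x \<in> span B" "\<And>x. x \<in> G \<Longrightarrow> norm (v x) = 1"
      "\<And>x. x \<in> G \<Longrightarrow> norm (A (v x) - x *\<^sub>R v x) \<le> \<rho>" by metis
    have near: "\<bar>inner (v x) (v y)\<bar> \<le> 1 / (4 * real N)" if "x \<in> G" "y \<in> G" "x \<noteq> y" for x y
    proof -
      have "s * \<bar>inner (v x) (v y)\<bar> \<le> \<bar>x - y\<bar> * \<bar>inner (v x) (v y)\<bar>"
        using that G \<open>sep F\<close> by (intro mult_right_mono) (auto simp: sep_def less_imp_le subset_iff)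
      also have "\<dots> \<le> 2 * \<rho>" using that v by (intro inner_near_eigenvectors) auto
      finally show ?thesis using \<rho> B(3) by (simp add: s_def field_simps)
    qed
    have small: "1 / (4 * real N) \<le> 1 / (2 * real (Suc N))" "1 / (4 * real N) < 1"
      using B(3) by (auto simp: field_simps)
    have inj: "inj_on v G"
    proof (rule inj_onI, rule ccontr)
      fix x y assume xy: "x \<in> G" "y \<in> G" "v x = v y" "x \<noteq> y"
      then have "\<bar>inner (v x) (v x)\<bar> < 1" using near[of x y] small by simp
      then show False using v(2)[OF xy(1)] by (simp flip: power2_norm_eq_inner)
    qed
    have "independent (v ` G)"
    proof (rule independent_if_nearly_orthogonal)
      fix p q assume "p \<in> v ` G" "q \<in> v ` G" "p \<noteq> q"
      then show "\<bar>inner p q\<bar> \<le> 1 / (2 * real (card (v ` G)))"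
        using near small(1) by (auto simp: card_image[OF inj] G(2)) (metis order_trans)
    qed (use G v in auto)
    then have "card (v ` G) \<le> card B"
      using independent_span_bound[OF B(1)] v(1) by blast
    then show False by (simp add: card_image[OF inj] G(2) B(2))
  qed
  have "sep {}" by (simp add: sep_def)
  \<comment> \<open>A separated set of maximal cardinality is a net: a point far from all its
    elements could be added.\<close>
  then obtain F where F: "sep F" "\<And>G. sep G \<Longrightarrow> card G \<le> card F"
    using ex_has_greatest_nat[of sep "{}" card "Suc N"] le by (metis le_imp_less_Suc less_imp_le_nat)
  have "\<exists>c\<in>F. \<bar>x - c\<bar> \<le> s" if x: "x \<in> X" for x
  proof (rule ccontr)
    assume *: "\<not> (\<exists>c\<in>F. \<bar>x - c\<bar> \<le> s)"
    then have "sep (insert x F)"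
      using F(1) x unfolding sep_def by (auto simp: not_le abs_minus_commute)
    moreover have "x \<notin> F" using * \<rho> by (force simp: s_def)
    ultimately show False using F(2)[of "insert x F"] F(1) by (simp add: sep_def)
  qed
  then show ?thesis using F(1) le[OF F(1)] unfolding sep_def s_def by blast
qed

section \<open>Square-summable sequences and Jacobi operators\<close>

text \<open>Treated as a real Hilbert space whose inner product is the real part of
  \<open>l2inner\<close>. The energies and the coefficients of the operators are real, so the price
  is only a factor 2 when dimensions are counted.\<close>

typedef ell2 = l2 morphisms coord Ell2
  by (rule exI[of _ "\<lambda>_. 0"]) (simp add: l2_def)

lemma ell2_eqI: "(\<And>n. coord u n = coord v n) \<Longrightarrow> u = v"
  by (metis coord_inject ext)

lemma coord_Ell2: "u \<in> l2 \<Longrightarrow> coord (Ell2 u) = u"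
  by (rule Ell2_inverse)

lemma coord_summable: "(\<lambda>n. (cmod (coord u n))\<^sup>2) summable_on UNIV"
  using coord[of u] by (simp add: l2_def)

section \<open>Closure properties of square-summable sequences\<close>

lemma mult_le_sum_power2: "x * y \<le> x\<^sup>2 + (y :: real)\<^sup>2"
  using sum_squares_bound[of x y] zero_le_power2[of x] zero_le_power2[of y] by linarith

lemma nonneg_summable_on_comparison:
  fixes f g :: "'a \<Rightarrow> real"
  assumes "g summable_on A" "\<And>x. x \<in> A \<Longrightarrow> 0 \<le> f x" "\<And>x. x \<in> A \<Longrightarrow> f x \<le> g x"
  shows "f summable_on A"
proof -
  have "(\<lambda>x. norm (g x)) summable_on A"
    using assms(1) summable_on_iff_abs_summable_on_real by blast
  then have "(\<lambda>x. norm (f x)) summable_on A"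
  proof (rule Infinite_Sum.abs_summable_on_comparison_test)
    fix x assume "x \<in> A"
    then show "norm (f x) \<le> norm (g x)" using assms(2,3)[of x] by simp
  qed
  then show ?thesis by (rule abs_summable_summable)
qed

lemma l2I_finite:
  assumes "\<And>F. finite F \<Longrightarrow> (\<Sum>n\<in>F. (cmod (u n))\<^sup>2) \<le> c"
  shows "u \<in> l2"
  unfolding l2_def mem_Collect_eq
  by (rule nonneg_bdd_above_summable_on) (use assms in \<open>auto simp: bdd_above_def\<close>)

lemma l2_add: "u \<in> l2 \<Longrightarrow> v \<in> l2 \<Longrightarrow> (\<lambda>n. u n + v n) \<in> l2"
proof -
  assume "u \<in> l2" "v \<in> l2"
  then have "(\<lambda>n. 2 * (cmod (u n))\<^sup>2 + 2 * (cmod (v n))\<^sup>2) summable_on UNIV"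
    unfolding l2_def by (intro summable_on_add summable_on_cmult_right) auto
  then show ?thesis unfolding l2_def mem_Collect_eq
  proof (rule nonneg_summable_on_comparison)
    fix n
    have "(cmod (u n + v n))\<^sup>2 \<le> (cmod (u n) + cmod (v n))\<^sup>2"
      by (intro power_mono norm_triangle_ineq) auto
    then show "(cmod (u n + v n))\<^sup>2 \<le> 2 * (cmod (u n))\<^sup>2 + 2 * (cmod (v n))\<^sup>2"
      using sum_squares_bound[of "cmod (u n)" "cmod (v n)"]
      by (simp add: power2_sum)
  qed auto
qed

lemma l2_mult:
  assumes "u \<in> l2" "\<And>n. cmod (c n) \<le> K"
  shows "(\<lambda>n. c n * u n) \<in> l2"
proof -
  have "(\<lambda>n. K\<^sup>2 * (cmod (u n))\<^sup>2) summable_on UNIV"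
    using assms(1) unfolding l2_def by (intro summable_on_cmult_right) auto
  then show ?thesis unfolding l2_def mem_Collect_eq
    by (rule nonneg_summable_on_comparison)
       (auto simp: norm_mult power_mult_distrib intro!: mult_right_mono power_mono assms)
qed

lemma bij_shift: "bij (\<lambda>n::int. n + k)"
  by (rule bij_betw_byWitness[of _ "\<lambda>n. n - k"]) auto

lemma l2_shift: "u \<in> l2 \<Longrightarrow> (\<lambda>n. u (n + k)) \<in> l2"
  unfolding l2_def mem_Collect_eq
  using summable_on_reindex_bij_betw[OF bij_shift, of "\<lambda>n. (cmod (u n))\<^sup>2" k] by simp

lemma l2_finite_support: "finite A \<Longrightarrow> (\<And>n. n \<notin> A \<Longrightarrow> u n = 0) \<Longrightarrow> u \<in> l2"
  unfolding l2_def mem_Collect_eq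
  by (subst summable_on_cong_neutral[where T = A and g = "\<lambda>n. (cmod (u n))\<^sup>2"]) auto

instantiation ell2 :: real_vector
begin

definition zero_ell2 where "zero_ell2 = Ell2 (\<lambda>_. 0)"
definition plus_ell2 where "plus_ell2 u v = Ell2 (\<lambda>n. coord u n + coord v n)"
definition uminus_ell2 where "uminus_ell2 u = Ell2 (\<lambda>n. - coord u n)"
definition minus_ell2 where "minus_ell2 u v = Ell2 (\<lambda>n. coord u n - coord v n)"
definition scaleR_ell2 where "scaleR_ell2 r u = Ell2 (\<lambda>n. of_real r * coord u n)"

lemma coord_zero: "coord 0 n = 0"
  by (simp add: zero_ell2_def coord_Ell2 l2_def)

lemma coord_add: "coord (u + v) n = coord u n + coord v n"
  by (simp add: plus_ell2_def coord_Ell2 l2_add coord)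

lemma coord_scaleR: "coord (r *\<^sub>R u) n = of_real r * coord u n"
  by (simp add: scaleR_ell2_def coord_Ell2 l2_mult[where K = "\<bar>r\<bar>"] coord)

lemma coord_uminus: "coord (- u) n = - coord u n"
  using l2_mult[of "coord u" "\<lambda>_. -1" 1] by (simp add: uminus_ell2_def coord_Ell2 coord)

lemma coord_diff: "coord (u - v) n = coord u n - coord v n"
proof -
  have "(\<lambda>n. coord u n + (- 1) * coord v n) \<in> l2"
    by (intro l2_add l2_mult[where K = 1] coord) auto
  then show ?thesis by (simp add: minus_ell2_def coord_Ell2)
qed

instance
  by standard (auto intro!: ell2_eqI simp: coord_add coord_zero coord_uminus coord_diff coord_scaleR algebra_simps)

end

lemma inner_summable: "(\<lambda>n. inner (coord u n) (coord v n)) summable_on UNIV"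
proof -
  have "(\<lambda>n. (cmod (coord u n))\<^sup>2 + (cmod (coord v n))\<^sup>2) summable_on UNIV"
    by (intro summable_on_add coord_summable)
  then have "(\<lambda>n. norm (inner (coord u n) (coord v n))) summable_on UNIV"
  proof (rule nonneg_summable_on_comparison)
    fix n
    have "norm (inner (coord u n) (coord v n)) \<le> cmod (coord u n) * cmod (coord v n)"
      by (simp add: Cauchy_Schwarz_ineq2)
    also have "\<dots> \<le> (cmod (coord u n))\<^sup>2 + (cmod (coord v n))\<^sup>2"
      by (rule mult_le_sum_power2)
    finally show "norm (inner (coord u n) (coord v n)) \<le> (cmod (coord u n))\<^sup>2 + (cmod (coord v n))\<^sup>2" .
  qed auto
  then show ?thesis by (rule abs_summable_summable)
qed

instantiation ell2 :: real_inner
begin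

definition inner_ell2 where "inner_ell2 u v = (\<Sum>\<^sub>\<infinity>n. inner (coord u n) (coord v n))"
definition norm_ell2 where "norm_ell2 u = sqrt (inner u (u :: ell2))"
definition sgn_ell2 where "sgn_ell2 (u :: ell2) = u /\<^sub>R norm u"
definition dist_ell2 where "dist_ell2 u v = norm (u - v :: ell2)"
definition uniformity_ell2 :: "(ell2 \<times> ell2) filter" where
  "uniformity_ell2 = (INF e\<in>{0<..}. principal {(x, y). dist x y < e})"
definition open_ell2 :: "ell2 set \<Rightarrow> bool" where
  "open_ell2 S \<longleftrightarrow> (\<forall>x\<in>S. \<forall>\<^sub>F (x', y) in uniformity. x' = x \<longrightarrow> y \<in> S)"

instance
proof
  fix x y z :: ell2 and r s :: real
  show "dist x y = norm (x - y)" by (rule dist_ell2_def)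
  show "uniformity = (INF e\<in>{0<..}. principal {(x::ell2, y). dist x y < e})" by (rule uniformity_ell2_def)
  show "open U = (\<forall>x\<in>U. \<forall>\<^sub>F (x', y) in uniformity. x' = x \<longrightarrow> y \<in> U)" for U :: "ell2 set"
    by (rule open_ell2_def)
  show "sgn x = x /\<^sub>R norm x" by (rule sgn_ell2_def)
  show "norm x = sqrt (inner x x)" by (rule norm_ell2_def)
  show "inner x y = inner y x" by (simp add: inner_ell2_def inner_commute)
  show "inner (x + y) z = inner x z + inner y z"
    by (simp add: inner_ell2_def coord_add inner_add_left infsum_add inner_summable)
  have "inner (complex_of_real r * p) q = r * inner p q" for p q
    by (simp flip: scaleR_conv_of_real)
  then show "inner (r *\<^sub>R x) y = r * inner x y"
    by (simp add: inner_ell2_def coord_scaleR infsum_cmult_right')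
  show "0 \<le> inner x x" unfolding inner_ell2_def by (rule infsum_nonneg) simp
  show "inner x x = 0 \<longleftrightarrow> x = 0"
  proof
    assume 0: "inner x x = 0"
    have "inner (coord x n) (coord x n) = 0" for n
      by (rule nonneg_infsum_le_0D[of "\<lambda>n. inner (coord x n) (coord x n)" UNIV])
         (use 0 inner_summable[of x x] in \<open>auto simp: inner_ell2_def\<close>)
    then show "x = 0" by (intro ell2_eqI) (simp add: coord_zero)
  qed (simp add: inner_ell2_def coord_zero)
qed

end

lemma norm_ell2_power2: "(norm u)\<^sup>2 = (\<Sum>\<^sub>\<infinity>n. (cmod (coord u n))\<^sup>2)"
  by (simp add: power2_norm_eq_inner inner_ell2_def)

lemma l2norm_coord: "l2norm (coord u) = norm u"
  by (simp add: l2norm_def flip: norm_ell2_power2)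

lemma Re_l2inner_coord: "Re (l2inner (coord u) (coord v)) = inner u v"
proof -
  have "(\<lambda>n. cmod (cnj (coord u n) * coord v n)) summable_on UNIV"
  proof (rule nonneg_summable_on_comparison[OF summable_on_add[OF coord_summable[of u] coord_summable[of v]]])
    show "cmod (cnj (coord u n) * coord v n) \<le> (cmod (coord u n))\<^sup>2 + (cmod (coord v n))\<^sup>2" for n
      by (simp add: norm_mult mult_le_sum_power2)
  qed auto
  then have "(\<lambda>n. cnj (coord u n) * coord v n) summable_on UNIV" by (rule abs_summable_summable)
  then have "Re (l2inner (coord u) (coord v)) = (\<Sum>\<^sub>\<infinity>n. Re (cnj (coord u n) * coord v n))"
    unfolding l2inner_def by (rule infsum_Re[symmetric])
  also have "\<dots> = inner u v" by (simp add: inner_ell2_def inner_complex_def)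
  finally show ?thesis .
qed

section \<open>Mass on finite windows, and completeness\<close>

definition energy :: "ell2 \<Rightarrow> int set \<Rightarrow> real" where
  "energy u A = (\<Sum>n\<in>A. (cmod (coord u n))\<^sup>2)"

lemma energy_nonneg: "energy u A \<ge> 0"
  by (simp add: energy_def sum_nonneg)

lemma energy_mono: "finite B \<Longrightarrow> A \<subseteq> B \<Longrightarrow> energy u A \<le> energy u B"
  unfolding energy_def by (rule sum_mono2) auto

lemma energy_le_norm: "finite A \<Longrightarrow> energy u A \<le> (norm u)\<^sup>2"
  unfolding energy_def norm_ell2_power2 by (rule finite_sum_le_infsum) (auto intro: coord_summable)

lemma cmod_coord_le: "cmod (coord u n) \<le> norm u"
proof (rule power2_le_imp_le)
  show "(cmod (coord u n))\<^sup>2 \<le> (norm u)\<^sup>2" using energy_le_norm[of "{n}" u] by (simp add: energy_def)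
qed simp

lemma norm_le_if_energy_le:
  assumes "\<And>F. finite F \<Longrightarrow> energy u F \<le> c\<^sup>2" "c \<ge> 0"
  shows "norm u \<le> c"
proof (rule power2_le_imp_le)
  show "(norm u)\<^sup>2 \<le> c\<^sup>2" unfolding norm_ell2_power2
    by (rule infsum_le_finite_sums) (use assms in \<open>auto simp: coord_summable energy_def\<close>)
qed (rule assms)

lemma norm_finite_support:
  assumes "finite A" "\<And>n. n \<notin> A \<Longrightarrow> coord u n = 0"
  shows "(norm u)\<^sup>2 = energy u A"
proof -
  have "(norm u)\<^sup>2 = (\<Sum>\<^sub>\<infinity>n\<in>A. (cmod (coord u n))\<^sup>2)"
    unfolding norm_ell2_power2 by (rule infsum_cong_neutral) (use assms in auto)
  then show ?thesis using assms by (simp add: energy_def)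
qed

lemma norm_mono_coord:
  assumes "\<And>n. cmod (coord u n) \<le> cmod (coord v n)"
  shows "norm u \<le> norm v"
proof (rule power2_le_imp_le)
  show "(norm u)\<^sup>2 \<le> (norm v)\<^sup>2" unfolding norm_ell2_power2
    by (intro infsum_mono coord_summable) (auto intro!: power_mono assms)
qed simp

text \<open>Half of the mass in a finite window is enough for sums over cells to stay finite; the
  lost factor 2 is absorbed into the constant 80 of
  \<open>localized_approx_eigenvector\<close>.\<close>

lemma energy_exhaustion:
  assumes "u \<noteq> 0"
  obtains R :: int where "R \<ge> 0" "\<And>A. finite A \<Longrightarrow> {-R..R} \<subseteq> A \<Longrightarrow> energy u A \<ge> (norm u)\<^sup>2 / 2"
proof -
  define c where "c = norm u / sqrt 2"
  have c2: "c\<^sup>2 = (norm u)\<^sup>2 / 2" by (simp add: c_def power_divide)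
  have "norm u > 0" using assms by simp
  have c0: "c \<ge> 0" by (simp add: c_def)
  have "\<exists>F. finite F \<and> energy u F > c\<^sup>2"
  proof (rule ccontr)
    assume "\<not> (\<exists>F. finite F \<and> energy u F > c\<^sup>2)"
    then have "energy u F \<le> c\<^sup>2" if "finite F" for F using that by (meson not_le)
    then have "norm u \<le> c" using c0 by (rule norm_le_if_energy_le)
    then have "(norm u)\<^sup>2 \<le> c\<^sup>2" by (intro power_mono) auto
    then show False unfolding c2 using \<open>norm u > 0\<close> by simp
  qed
  then obtain F where F: "finite F" "energy u F > (norm u)\<^sup>2 / 2" unfolding c2 by blast
  define R where "R = Max (insert 0 (abs ` F))"
  have "\<bar>x\<bar> \<le> R" if "x \<in> F" for x using F(1) that by (simp add: R_def)
  then have FR: "F \<subseteq> {-R..R}" by (simp add: subset_iff abs_le_iff minus_le_iff)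
  have R0: "R \<ge> 0" using F(1) by (simp add: R_def)
  show ?thesis
  proof (rule that[of R, OF R0])
    fix A assume A: "finite A" "{-R..R} \<subseteq> A"
    then have "energy u F \<le> energy u A" using FR by (intro energy_mono) auto
    then show "(norm u)\<^sup>2 / 2 \<le> energy u A" using F(2) by linarith
  qed
qed

instance ell2 :: complete_space
proof
  fix X :: "nat \<Rightarrow> ell2"
  assume C: "Cauchy X"
  have "Cauchy (\<lambda>k. coord (X k) n)" for n
  proof (rule metric_CauchyI)
    fix e :: real assume "e > 0"
    then obtain N where N: "\<forall>j\<ge>N. \<forall>k\<ge>N. dist (X j) (X k) < e" using metric_CauchyD[OF C] by blast
    have "dist (coord (X j) n) (coord (X k) n) < e" if "j \<ge> N" "k \<ge> N" for j k
    proof -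
      have "dist (coord (X j) n) (coord (X k) n) \<le> dist (X j) (X k)"
        using cmod_coord_le[of "X j - X k" n] unfolding dist_norm coord_diff .
      also have "\<dots> < e" using N that by blast
      finally show ?thesis .
    qed
    then show "\<exists>N. \<forall>j\<ge>N. \<forall>k\<ge>N. dist (coord (X j) n) (coord (X k) n) < e" by blast
  qed
  then have "\<exists>l. (\<lambda>k. coord (X k) n) \<longlonglongrightarrow> l" for n
    unfolding Cauchy_convergent_iff convergent_def by blast
  then obtain L where L: "\<And>n. (\<lambda>k. coord (X k) n) \<longlonglongrightarrow> L n" by metis
  have bound: "(\<Sum>n\<in>F. (cmod (L n - coord (X k) n))\<^sup>2) \<le> e\<^sup>2"
    if F: "finite F" and k: "\<And>j. j \<ge> N \<Longrightarrow> dist (X j) (X k) < e" for F N k e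
  proof (rule LIMSEQ_le_const2)
    show "(\<lambda>j. energy (X j - X k) F) \<longlonglongrightarrow> (\<Sum>n\<in>F. (cmod (L n - coord (X k) n))\<^sup>2)"
      unfolding energy_def coord_diff by (intro tendsto_intros L)
    have "energy (X j - X k) F \<le> e\<^sup>2" if "j \<ge> N" for j
    proof -
      have "energy (X j - X k) F \<le> (norm (X j - X k))\<^sup>2" by (rule energy_le_norm[OF F])
      also have "\<dots> \<le> e\<^sup>2" using k[OF that] by (intro power_mono) (auto simp: dist_norm)
      finally show ?thesis .
    qed
    then show "\<exists>N. \<forall>j\<ge>N. energy (X j - X k) F \<le> e\<^sup>2" by blast
  qed
  have "L \<in> l2"
  proof -
    obtain N where "\<forall>j\<ge>N. \<forall>k\<ge>N. dist (X j) (X k) < 1" using metric_CauchyD[OF C zero_less_one] by blast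
    then have "(\<lambda>n. L n - coord (X N) n) \<in> l2" using bound[of _ N N 1] by (intro l2I_finite[of _ "1\<^sup>2"]) auto
    from l2_add[OF this coord[of "X N"]] show ?thesis by simp
  qed
  have "X \<longlonglongrightarrow> Ell2 L"
  proof (rule metric_LIMSEQ_I)
    fix e :: real assume e: "e > 0"
    then obtain N where N: "\<forall>j\<ge>N. \<forall>k\<ge>N. dist (X j) (X k) < e / 2" using metric_CauchyD[OF C half_gt_zero[OF e]] by blast
    have "dist (X k) (Ell2 L) < e" if "k \<ge> N" for k
    proof -
      have "norm (Ell2 L - X k) \<le> e / 2"
        using e N that bound[of _ N k "e/2"]
        by (intro norm_le_if_energy_le) (auto simp: energy_def coord_diff coord_Ell2 \<open>L \<in> l2\<close>)
      then show ?thesis using e by (simp add: dist_norm norm_minus_commute)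
    qed
    then show "\<exists>N. \<forall>k\<ge>N. dist (X k) (Ell2 L) < e" by blast
  qed
  then show "convergent X" by (auto simp: convergent_def)
qed

section \<open>Shifts, multiplication operators and Jacobi operators on \<open>ell2\<close>\<close>

definition shift :: "int \<Rightarrow> ell2 \<Rightarrow> ell2" where
  "shift k u = Ell2 (\<lambda>n. coord u (n + k))"

lemma coord_shift: "coord (shift k u) n = coord u (n + k)"
  by (simp add: shift_def coord_Ell2 l2_shift coord)

lemma inner_shift: "inner (shift k u) v = inner u (shift (-k) v)"
  unfolding inner_ell2_def coord_shift
  using infsum_reindex_bij_betw[OF bij_shift, of "\<lambda>n. inner (coord u n) (coord v (n - k))" k] by simp

lemma norm_shift: "norm (shift k u) = norm u"
proof -
  have "shift (-k) (shift k u) = u" by (rule ell2_eqI) (simp add: coord_shift)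
  then show ?thesis by (simp add: norm_eq_sqrt_inner inner_shift)
qed

definition restrict :: "int set \<Rightarrow> ell2 \<Rightarrow> ell2" where
  "restrict A u = Ell2 (\<lambda>n. if n \<in> A then coord u n else 0)"

lemma coord_restrict: "coord (restrict A u) n = (if n \<in> A then coord u n else 0)"
proof -
  have "(\<lambda>n. (if n \<in> A then 1 else 0) * coord u n) \<in> l2"
    by (rule l2_mult[where K = 1]) (auto simp: coord)
  also have "(\<lambda>n. (if n \<in> A then 1 else 0) * coord u n) = (\<lambda>n. if n \<in> A then coord u n else 0)"
    by auto
  finally show ?thesis by (simp add: restrict_def coord_Ell2)
qed

lemma jac_op_l2:
  assumes "bounded (range a)" "bounded (range b)" "u \<in> l2"
  shows "jac_op a b u \<in> l2"
proof -
  obtain K L where "\<And>n. \<bar>a n\<bar> \<le> K" "\<And>n. \<bar>b n\<bar> \<le> L"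
    using assms(1,2) by (metis bounded_iff rangeI real_norm_def)
  then show ?thesis unfolding jac_op_def
    using assms(3) l2_shift[OF assms(3), of "-1"] l2_shift[OF assms(3), of 1]
    by (intro l2_add l2_mult[where K = K] l2_mult[where K = L]) auto
qed

definition jop :: "(int \<Rightarrow> real) \<Rightarrow> (int \<Rightarrow> real) \<Rightarrow> ell2 \<Rightarrow> ell2" where
  "jop a b u = Ell2 (jac_op a b (coord u))"

lemma coord_jop:
  assumes "bounded (range a)" "bounded (range b)"
  shows "coord (jop a b u) = jac_op a b (coord u)"
  by (simp add: jop_def coord_Ell2 jac_op_l2 assms coord)

definition mulop :: "(int \<Rightarrow> real) \<Rightarrow> ell2 \<Rightarrow> ell2" where
  "mulop c u = Ell2 (\<lambda>n. of_real (c n) * coord u n)"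

lemma coord_mulop:
  assumes "bounded (range c)"
  shows "coord (mulop c u) n = of_real (c n) * coord u n"
proof -
  obtain K where "\<And>n. \<bar>c n\<bar> \<le> K" using assms unfolding bounded_iff by auto
  then have "(\<lambda>n. of_real (c n) * coord u n) \<in> l2"
    by (intro l2_mult[where K = K] coord) auto
  then show ?thesis by (simp add: mulop_def coord_Ell2)
qed

lemma inner_mulop: "bounded (range c) \<Longrightarrow> inner (mulop c u) v = inner u (mulop c v)"
  unfolding inner_ell2_def coord_mulop by (simp flip: scaleR_conv_of_real)

lemma bounded_rangeI_real: "(\<And>n. \<bar>c n :: real\<bar> \<le> K) \<Longrightarrow> bounded (range c)"
  unfolding bounded_iff by auto

lemma norm_mulop_le:
  assumes "\<And>n. \<bar>c n\<bar> \<le> K"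
  shows "norm (mulop c u) \<le> K * norm u"
proof -
  have K: "K \<ge> 0" using assms[of 0] by simp
  have "norm (mulop c u) \<le> norm (K *\<^sub>R u)"
    using assms K bounded_rangeI_real[of c K, OF assms]
    by (intro norm_mono_coord) (auto simp: coord_scaleR coord_mulop norm_mult intro!: mult_right_mono)
  then show ?thesis using K by simp
qed

lemma jop_eq:
  assumes "bounded (range a)" "bounded (range b)"
  shows "jop a b u = shift (-1) (mulop a u) + mulop b u + mulop a (shift 1 u)"
  by (rule ell2_eqI) (simp add: coord_add coord_jop assms jac_op_def coord_shift coord_mulop)

lemma norm_jop_diff_le:
  assumes bd: "bounded (range a)" "bounded (range b)" "bounded (range a')" "bounded (range b')"
    and K: "\<And>n. \<bar>a n - a' n\<bar> \<le> K" and L: "\<And>n. \<bar>b n - b' n\<bar> \<le> L"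
  shows "norm (jop a b u - jop a' b' u) \<le> (2 * K + L) * norm u"
proof -
  have bdi: "bounded (range (\<lambda>n. a n - a' n))" "bounded (range (\<lambda>n. b n - b' n))"
    by (rule bounded_rangeI_real, rule K, rule bounded_rangeI_real, rule L)
  have "jop a b u - jop a' b' u = jop (\<lambda>n. a n - a' n) (\<lambda>n. b n - b' n) u"
    by (rule ell2_eqI) (simp add: coord_diff coord_jop bd bdi jac_op_def algebra_simps)
  also have "\<dots> = shift (-1) (mulop (\<lambda>n. a n - a' n) u)
      + mulop (\<lambda>n. b n - b' n) u + mulop (\<lambda>n. a n - a' n) (shift 1 u)"
    by (rule jop_eq[OF bdi])
  also have "norm \<dots> \<le> norm (shift (-1) (mulop (\<lambda>n. a n - a' n) u))
      + norm (mulop (\<lambda>n. b n - b' n) u) + norm (mulop (\<lambda>n. a n - a' n) (shift 1 u))"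
    by (intro norm_triangle_mono order_refl)
  also have "\<dots> \<le> K * norm u + L * norm u + K * norm u"
    using norm_mulop_le[where c = "\<lambda>n. a n - a' n", OF K] norm_mulop_le[where c = "\<lambda>n. b n - b' n", OF L]
    unfolding norm_shift by (intro add_mono) (metis norm_shift)+
  finally show ?thesis by (simp add: algebra_simps)
qed

lemma symmetric_operator_jop:
  assumes "bounded (range a)" "bounded (range b)"
  shows "symmetric_operator (jop a b)"
proof -
  obtain K L where KL: "\<And>n. \<bar>a n\<bar> \<le> K" "\<And>n. \<bar>b n\<bar> \<le> L"
    using assms by (metis bounded_iff rangeI real_norm_def)
  have z: "jop (\<lambda>_. 0) (\<lambda>_. 0) u = 0" for u
    by (rule ell2_eqI) (simp add: coord_jop jac_op_def coord_zero)
  have "bounded_linear (jop a b)"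
  proof (rule bounded_linear_intro)
    show "norm (jop a b u) \<le> norm u * (2 * K + L)" for u
      using norm_jop_diff_le[OF assms, of "\<lambda>_. 0" "\<lambda>_. 0" K L u] KL by (simp add: z mult.commute)
  qed (auto intro!: ell2_eqI simp: coord_add coord_scaleR coord_jop assms jac_op_def algebra_simps)
  moreover have "inner (jop a b u) v = inner u (jop a b v)" for u v
    by (simp add: jop_eq assms inner_add_left inner_add_right inner_shift inner_mulop)
  ultimately show ?thesis
    by (simp add: symmetric_operator_def symmetric_operator_axioms_def)
qed

lemma jac_spectrum_eq:
  assumes "bounded (range a)" "bounded (range b)"
  shows "jac_spectrum a b = {E. \<not> bij (\<lambda>u. jop a b u - E *\<^sub>R u)}"
proof -
  have c: "bij_betw coord UNIV l2"
    by (rule bij_betw_byWitness[of _ Ell2]) (auto simp: coord_inverse coord_Ell2 coord)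
  have "bij_betw (\<lambda>u n. jac_op a b u n - of_real E * u n) l2 l2 \<longleftrightarrow> bij (\<lambda>u. jop a b u - E *\<^sub>R u)" for E
  proof -
    have "(\<lambda>u n. jac_op a b u n - of_real E * u n) \<circ> coord = coord \<circ> (\<lambda>u. jop a b u - E *\<^sub>R u)"
      by (auto simp: fun_eq_iff coord_diff coord_scaleR coord_jop assms)
    moreover have "(\<lambda>u n. jac_op a b u n - of_real E * u n) ` l2 \<subseteq> l2"
    proof (safe)
      fix u assume "u \<in> l2"
      then have "(\<lambda>n. jac_op a b u n + (- of_real E) * u n) \<in> l2"
        by (intro l2_add jac_op_l2 assms l2_mult[where K = "\<bar>E\<bar>"]) auto
      then show "(\<lambda>n. jac_op a b u n - of_real E * u n) \<in> l2" by simp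
    qed
    ultimately show ?thesis
      using bij_betw_comp_iff[OF c, of "\<lambda>u n. jac_op a b u n - of_real E * u n" l2]
        bij_betw_comp_iff2[OF c, of "\<lambda>u. jop a b u - E *\<^sub>R u" UNIV] by simp
  qed
  then show ?thesis by (simp add: jac_spectrum_def)
qed

lemma jac_spectrum_iff:
  assumes "bounded (range a)" "bounded (range b)"
  shows "E \<in> jac_spectrum a b \<longleftrightarrow> \<not> bounded_below (\<lambda>u. jop a b u - E *\<^sub>R u)"
  using symmetric_operator.bij_iff_bounded_below[OF symmetric_operator.symmetric_operator_shift
      [OF symmetric_operator_jop[OF assms]], of E] by (simp add: jac_spectrum_eq assms)

lemma jac_dist_le:
  assumes bd: "bounded (range a)" "bounded (range b)" "bounded (range a')" "bounded (range b')"
    and K: "\<And>n. \<bar>a n - a' n\<bar> \<le> K" and L: "\<And>n. \<bar>b n - b' n\<bar> \<le> L"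
  shows "jac_dist (a, b) (a', b') \<le> 2 * K + L"
  unfolding jac_dist_def
proof (rule cSup_least)
  have KL: "K \<ge> 0" "L \<ge> 0" using K[of 0] L[of 0] by auto
  fix x assume "x \<in> {l2norm (\<lambda>n. jac_op (fst (a, b)) (snd (a, b)) u n - jac_op (fst (a', b')) (snd (a', b')) u n) | u.
                          u \<in> l2 \<and> l2norm u \<le> 1}"
  then obtain u where u: "u \<in> l2" "l2norm u \<le> 1" "x = l2norm (\<lambda>n. jac_op a b u n - jac_op a' b' u n)"
    by auto
  obtain w where w: "u = coord w" using u(1) by (metis coord_Ell2)
  have "x = l2norm (coord (jop a b w - jop a' b' w))"
    unfolding u(3) w by (rule arg_cong[of _ _ l2norm]) (simp add: fun_eq_iff coord_diff coord_jop bd)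
  also have "\<dots> \<le> (2 * K + L) * norm w"
    unfolding l2norm_coord by (rule norm_jop_diff_le[OF bd K L])
  also have "\<dots> \<le> 2 * K + L" using u(2) KL unfolding w l2norm_coord by (simp add: mult_left_le)
  finally show "x \<le> 2 * K + L" .
qed (auto intro!: exI[of _ "\<lambda>_. 0"] simp: l2_def l2norm_def)

definition unit_vec :: "int \<Rightarrow> complex \<Rightarrow> ell2" where
  "unit_vec k z = Ell2 (\<lambda>n. if n = k then z else 0)"

lemma coord_unit_vec: "coord (unit_vec k z) n = (if n = k then z else 0)"
proof -
  have "(\<lambda>n. if n = k then z else 0) \<in> l2" by (rule l2_finite_support[of "{k}"]) auto
  then show ?thesis by (simp add: unit_vec_def coord_Ell2)
qed

text \<open>The image of the unit vector at \<open>n\<close> has the entries \<open>b n\<close> at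
  \<open>n\<close> and \<open>a n\<close> at \<open>n + 1\<close>. Together with
  \<open>jac_dist_le\<close> this makes the operator distance equivalent to the sup distance of the
  coefficients, so the construction works with pointwise bounds.\<close>

lemma coeff_diff_le_jac_dist:
  assumes bd: "bounded (range a)" "bounded (range b)" "bounded (range a')" "bounded (range b')"
  shows "\<bar>a n - a' n\<bar> \<le> jac_dist (a, b) (a', b')" "\<bar>b n - b' n\<bar> \<le> jac_dist (a, b) (a', b')"
proof -
  define e where "e = unit_vec n 1"
  define S where "S = {l2norm (\<lambda>n. jac_op (fst (a, b)) (snd (a, b)) u n - jac_op (fst (a', b')) (snd (a', b')) u n) | u.
                          u \<in> l2 \<and> l2norm u \<le> 1}"
  have bdi: "bounded (range (\<lambda>n. a n - a' n))" "bounded (range (\<lambda>n. b n - b' n))"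
    using bd by (auto intro: bounded_minus_comp)
  obtain K L where KL: "\<And>n. \<bar>a n - a' n\<bar> \<le> K" "\<And>n. \<bar>b n - b' n\<bar> \<le> L"
    using bdi unfolding bounded_iff by auto
  have diff: "(\<lambda>n. jac_op a b (coord w) n - jac_op a' b' (coord w) n) = coord (jop a b w - jop a' b' w)" for w
    by (simp add: fun_eq_iff coord_diff coord_jop bd)
  have bdd: "bdd_above S"
  proof (rule bdd_aboveI)
    fix x assume "x \<in> S"
    then obtain u where u: "u \<in> l2" "l2norm u \<le> 1" "x = l2norm (\<lambda>n. jac_op a b u n - jac_op a' b' u n)"
      by (auto simp: S_def)
    obtain w where w: "u = coord w" using u(1) by (metis coord_Ell2)
    have "x \<le> (2 * K + L) * norm w"
      unfolding u(3) w diff l2norm_coord by (rule norm_jop_diff_le[OF bd KL])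
    also have "\<dots> \<le> (2 * K + L) * 1"
      using u(2) KL(1)[of 0] KL(2)[of 0] unfolding w l2norm_coord by (intro mult_left_mono) auto
    finally show "x \<le> (2 * K + L) * 1" .
  qed
  have e: "norm e = 1"
  proof -
    have "(norm e)\<^sup>2 = 1\<^sup>2" using norm_finite_support[of "{n}" e] by (simp add: e_def coord_unit_vec energy_def)
    then show ?thesis using power2_eq_imp_eq norm_ge_zero zero_le_one by blast
  qed
  have "norm (jop a b e - jop a' b' e) \<in> S"
    using e coord[of e] diff[of e] by (force simp: S_def l2norm_coord intro!: exI[of _ "coord e"])
  then have le: "norm (jop a b e - jop a' b' e) \<le> jac_dist (a, b) (a', b')"
    unfolding jac_dist_def S_def[symmetric] by (rule cSup_upper[OF _ bdd])
  have "\<bar>a n - a' n\<bar> = cmod (coord (jop a b e - jop a' b' e) (n + 1))"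
    "\<bar>b n - b' n\<bar> = cmod (coord (jop a b e - jop a' b' e) n)"
    by (simp_all add: coord_diff coord_jop bd jac_op_def e_def coord_unit_vec flip: of_real_diff)
  then show "\<bar>a n - a' n\<bar> \<le> jac_dist (a, b) (a', b')" "\<bar>b n - b' n\<bar> \<le> jac_dist (a, b) (a', b')"
    using cmod_coord_le le by (metis order_trans)+
qed

section \<open>Transfer matrices and gap opening\<close>

text \<open>Listed row by row. As plain products, matrices inherit the product metric and the
  compactness of boxes.\<close>

type_synonym mat2 = "real \<times> real \<times> real \<times> real"

fun mat2_mult :: "mat2 \<Rightarrow> mat2 \<Rightarrow> mat2" (infixl "\<odot>" 70) where
  "mat2_mult (a, b, c, d) (a', b', c', d') = (a * a' + b * c', a * b' + b * d', c * a' + d * c', c * b' + d * d')"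

fun mat2_apply :: "mat2 \<Rightarrow> complex \<times> complex \<Rightarrow> complex \<times> complex" where
  "mat2_apply (a, b, c, d) (x, y) = (of_real a * x + of_real b * y, of_real c * x + of_real d * y)"

fun mat2_trace :: "mat2 \<Rightarrow> real" where "mat2_trace (a, b, c, d) = a + d"

fun mat2_det :: "mat2 \<Rightarrow> real" where "mat2_det (a, b, c, d) = a * d - b * c"

fun mat2_adj :: "mat2 \<Rightarrow> mat2" where "mat2_adj (a, b, c, d) = (d, - b, - c, a)"

fun mat2_norm :: "mat2 \<Rightarrow> real" where "mat2_norm (a, b, c, d) = \<bar>a\<bar> + \<bar>b\<bar> + \<bar>c\<bar> + \<bar>d\<bar>"

fun vec2_norm :: "complex \<times> complex \<Rightarrow> real" where "vec2_norm (x, y) = cmod x + cmod y"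

section \<open>Algebra and norms of 2 x 2 matrices\<close>

lemma mat2_mult_assoc: "(A \<odot> B) \<odot> C = A \<odot> (B \<odot> C)"
  by (cases A; cases B; cases C) (simp add: algebra_simps)

lemma mat2_mult_id: "A \<odot> (1, 0, 0, 1) = A" "(1, 0, 0, 1) \<odot> A = A"
  by (cases A; simp)+

lemma mat2_apply_mult: "mat2_apply (A \<odot> B) v = mat2_apply A (mat2_apply B v)"
  by (cases A; cases B; cases v) (simp add: algebra_simps)

lemma mat2_apply_add: "mat2_apply A (v + w) = mat2_apply A v + mat2_apply A w"
  by (cases A; cases v; cases w) (simp add: algebra_simps)

lemma mat2_trace_commute: "mat2_trace (A \<odot> B) = mat2_trace (B \<odot> A)"
  by (cases A; cases B) (simp add: algebra_simps)

lemma mat2_det_mult: "mat2_det (A \<odot> B) = mat2_det A * mat2_det B"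
  by (cases A; cases B) (simp add: algebra_simps)

lemma mat2_adj_mult:
  assumes "mat2_det A = 1"
  shows "mat2_adj A \<odot> A = (1, 0, 0, 1)" "A \<odot> mat2_adj A = (1, 0, 0, 1)"
  using assms by (cases A; simp add: algebra_simps)+

lemma mat2_add_adj: "mat2_apply A v + mat2_apply (mat2_adj A) v = mat2_trace A *\<^sub>R v"
  by (cases A; cases v) (simp add: scaleR_conv_of_real algebra_simps)

lemma mat2_norm_adj: "mat2_norm (mat2_adj A) = mat2_norm A"
  by (cases A) simp

lemma mat2_norm_nonneg: "mat2_norm A \<ge> 0"
  by (cases A) simp

lemma vec2_norm_nonneg: "vec2_norm v \<ge> 0"
  by (cases v) simp

lemma vec2_norm_add: "vec2_norm (v + w) \<le> vec2_norm v + vec2_norm w"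
  by (cases v; cases w) (simp add: algebra_simps, smt (verit) norm_triangle_ineq)

lemma vec2_norm_diff: "vec2_norm (v - w) \<le> vec2_norm v + vec2_norm w"
  by (cases v; cases w) (simp add: algebra_simps, smt (verit) norm_triangle_ineq4)

lemma vec2_norm_apply: "vec2_norm (mat2_apply A v) \<le> mat2_norm A * vec2_norm v"
proof (cases A; cases v)
  fix a b c d x y assume A: "A = (a, b, c, d)" and v: "v = (x, y)"
  have "cmod (of_real p * x + of_real q * y) \<le> \<bar>p\<bar> * cmod x + \<bar>q\<bar> * cmod y" for p q
    using norm_triangle_ineq[of "of_real p * x" "of_real q * y"] by (simp add: norm_mult)
  from this[of a b] this[of c d]
  have "vec2_norm (mat2_apply A v) \<le> \<bar>a\<bar> * cmod x + \<bar>b\<bar> * cmod y + (\<bar>c\<bar> * cmod x + \<bar>d\<bar> * cmod y)"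
    by (simp add: A v)
  also have "\<dots> \<le> mat2_norm A * vec2_norm v" by (simp add: A v algebra_simps)
  finally show ?thesis .
qed

lemma mat2_norm_mult: "mat2_norm (A \<odot> B) \<le> mat2_norm A * mat2_norm B"
proof (cases A; cases B)
  fix a b c d a' b' c' d' assume A: "A = (a, b, c, d)" and B: "B = (a', b', c', d')"
  have t: "\<bar>p * q + r * s\<bar> \<le> \<bar>p\<bar> * \<bar>q\<bar> + \<bar>r\<bar> * \<bar>s\<bar>" for p q r s :: real
    using abs_triangle_ineq[of "p * q" "r * s"] by (simp add: abs_mult)
  have "mat2_norm (A \<odot> B) \<le> (\<bar>a\<bar> * \<bar>a'\<bar> + \<bar>b\<bar> * \<bar>c'\<bar>) + (\<bar>a\<bar> * \<bar>b'\<bar> + \<bar>b\<bar> * \<bar>d'\<bar>)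
      + (\<bar>c\<bar> * \<bar>a'\<bar> + \<bar>d\<bar> * \<bar>c'\<bar>) + (\<bar>c\<bar> * \<bar>b'\<bar> + \<bar>d\<bar> * \<bar>d'\<bar>)"
    unfolding A B mat2_mult.simps mat2_norm.simps by (intro add_mono t)
  also have "\<dots> \<le> mat2_norm A * mat2_norm B" by (simp add: A B algebra_simps)
  finally show ?thesis .
qed

text \<open>Acting on \<open>(u\<^sub>n, a\<^sub>n\<^sub>-\<^sub>1 u\<^sub>n\<^sub>-\<^sub>1)\<close> rather than on \<open>(u\<^sub>n, u\<^sub>n\<^sub>-\<^sub>1)\<close>, transfer matrices have determinant 1.\<close>
definition transfer :: "(int \<Rightarrow> real) \<Rightarrow> (int \<Rightarrow> real) \<Rightarrow> real \<Rightarrow> int \<Rightarrow> mat2" where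
  "transfer a b E n = ((E - b n) / a n, - 1 / a n, a n, 0)"

primrec transfer_prod :: "(int \<Rightarrow> real) \<Rightarrow> (int \<Rightarrow> real) \<Rightarrow> real \<Rightarrow> int \<Rightarrow> nat \<Rightarrow> mat2" where
  "transfer_prod a b E n 0 = (1, 0, 0, 1)"
| "transfer_prod a b E n (Suc j) = transfer a b E (n + int j) \<odot> transfer_prod a b E n j"

definition phase :: "(int \<Rightarrow> real) \<Rightarrow> (int \<Rightarrow> complex) \<Rightarrow> int \<Rightarrow> complex \<times> complex" where
  "phase a u n = (u n, of_real (a (n - 1)) * u (n - 1))"

definition residual :: "(int \<Rightarrow> real) \<Rightarrow> (int \<Rightarrow> real) \<Rightarrow> real \<Rightarrow> (int \<Rightarrow> complex) \<Rightarrow> int \<Rightarrow> complex" where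
  "residual a b E u n = jac_op a b u n - of_real E * u n"

text \<open>The variation-of-constants term. It lets \<open>phase_add\<close> hold for every
  sequence \<open>u\<close>, with the failure of the eigenvalue equation carried along.\<close>

primrec source :: "(int \<Rightarrow> real) \<Rightarrow> (int \<Rightarrow> real) \<Rightarrow> real \<Rightarrow> (int \<Rightarrow> complex) \<Rightarrow> int \<Rightarrow> nat \<Rightarrow> complex \<times> complex" where
  "source a b E u n 0 = (0, 0)"
| "source a b E u n (Suc j) = mat2_apply (transfer a b E (n + int j)) (source a b E u n j)
      + (residual a b E u (n + int j) / of_real (a (n + int j)), 0)"

lemma phase_step:
  assumes "a n \<noteq> 0"
  shows "phase a u (n + 1) = mat2_apply (transfer a b E n) (phase a u n) + (residual a b E u n / of_real (a n), 0)"
  using assms by (simp add: phase_def transfer_def residual_def jac_op_def field_simps)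

lemma phase_add:
  assumes "\<And>n. a n \<noteq> 0"
  shows "phase a u (n + int j) = mat2_apply (transfer_prod a b E n j) (phase a u n) + source a b E u n j"
proof (induction j)
  case 0
  then show ?case by (cases "phase a u n") simp
next
  case (Suc j)
  have "phase a u (n + int (Suc j)) = phase a u (n + int j + 1)" by (simp add: algebra_simps)
  then show ?case
    by (simp add: phase_step[of a "n + int j" u b E] assms Suc mat2_apply_mult mat2_apply_add)
qed

lemma det_transfer: "a n \<noteq> 0 \<Longrightarrow> mat2_det (transfer a b E n) = 1"
  by (simp add: transfer_def)

lemma det_transfer_prod: "(\<And>n. a n \<noteq> 0) \<Longrightarrow> mat2_det (transfer_prod a b E n j) = 1"
  by (induction j) (simp_all add: mat2_det_mult det_transfer)

lemma transfer_prod_add: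
  "transfer_prod a b E n (i + j) = transfer_prod a b E (n + int i) j \<odot> transfer_prod a b E n i"
  by (induction j) (simp_all add: mat2_mult_id mat2_mult_assoc algebra_simps)

lemma periodic_mult:
  fixes f :: "int \<Rightarrow> 'a"
  assumes "\<And>n. f (n + p) = f n"
  shows "f (n + k * p) = f n"
proof (induction k rule: int_induct[of _ 0])
  case (step1 i)
  then show ?case using assms[of "n + i * p"] by (simp add: algebra_simps)
next
  case (step2 i)
  then show ?case using assms[of "n + (i - 1) * p"] by (simp add: algebra_simps)
qed simp

lemma transfer_prod_periodic:
  assumes "\<And>n. a (n + p) = a n" "\<And>n. b (n + p) = b n"
  shows "transfer_prod a b E (n + k * p) j = transfer_prod a b E n j"
proof (induction j)
  case (Suc j)
  have "transfer a b E (n + k * p + int j) = transfer a b E (n + int j)"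
    using periodic_mult[of a p "n + int j" k] periodic_mult[of b p "n + int j" k] assms
    by (simp add: transfer_def algebra_simps)
  with Suc show ?case by simp
qed simp

text \<open>By periodicity, the monodromy matrices based at \<open>n\<close> and at
  \<open>n + 1\<close> are conjugate through the transfer matrix at \<open>n\<close>.\<close>

lemma trace_monodromy_const:
  assumes nz: "\<And>n. a n \<noteq> 0" and per: "\<And>n. a (n + int P) = a n" "\<And>n. b (n + int P) = b n"
  shows "mat2_trace (transfer_prod a b E n P) = mat2_trace (transfer_prod a b E 0 P)"
proof -
  have step: "mat2_trace (transfer_prod a b E (n + 1) P) = mat2_trace (transfer_prod a b E n P)" for n
  proof -
    let ?T = "transfer a b E n" and ?M = "transfer_prod a b E n P"
    have T: "mat2_adj ?T \<odot> ?T = (1,0,0,1)" "?T \<odot> mat2_adj ?T = (1,0,0,1)"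
      by (rule mat2_adj_mult, rule det_transfer, rule nz)+
    have "transfer_prod a b E (n + 1) P \<odot> ?T = transfer_prod a b E n (1 + P)"
      by (subst transfer_prod_add) (simp add: mat2_mult_id)
    also have "\<dots> = transfer a b E (n + int P) \<odot> ?M" by simp
    also have "transfer a b E (n + int P) = ?T" by (simp add: transfer_def per)
    finally have "transfer_prod a b E (n + 1) P \<odot> ?T \<odot> mat2_adj ?T = ?T \<odot> ?M \<odot> mat2_adj ?T" by simp
    then have "transfer_prod a b E (n + 1) P = ?T \<odot> ?M \<odot> mat2_adj ?T"
      by (simp add: mat2_mult_assoc T mat2_mult_id)
    also have "mat2_trace \<dots> = mat2_trace (mat2_adj ?T \<odot> (?T \<odot> ?M))" by (rule mat2_trace_commute)
    also have "mat2_adj ?T \<odot> (?T \<odot> ?M) = ?M" by (simp add: mat2_mult_id T flip: mat2_mult_assoc)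
    finally show ?thesis .
  qed
  show ?thesis
  proof (induction n rule: int_induct[of _ 0])
    case (step1 i) then show ?case using step[of i] by simp
  next
    case (step2 i) then show ?case using step[of "i - 1"] by simp
  qed simp
qed

lemma source_bound:
  assumes K: "\<And>n. mat2_norm (transfer a b E n) \<le> K" "K \<ge> 1" and \<alpha>: "\<alpha> > 0" "\<And>n. a n \<ge> \<alpha>"
  shows "vec2_norm (source a b E u n j) \<le> K ^ j / \<alpha> * (\<Sum>i<j. cmod (residual a b E u (n + int i)))"
proof (induction j)
  case (Suc j)
  let ?r = "\<lambda>i. cmod (residual a b E u (n + int i))"
  have "vec2_norm (source a b E u n (Suc j)) \<le> vec2_norm (mat2_apply (transfer a b E (n + int j)) (source a b E u n j))
      + vec2_norm (residual a b E u (n + int j) / of_real (a (n + int j)), 0)"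
    unfolding source.simps by (rule vec2_norm_add)
  also have "vec2_norm (mat2_apply (transfer a b E (n + int j)) (source a b E u n j))
      \<le> K * (K ^ j / \<alpha> * (\<Sum>i<j. ?r i))"
    by (rule order_trans[OF vec2_norm_apply], rule mult_mono)
       (use K Suc in \<open>auto simp: vec2_norm_nonneg\<close>)
  also have "vec2_norm (residual a b E u (n + int j) / of_real (a (n + int j)), 0) \<le> ?r j / \<alpha>"
    using \<alpha>(1) \<alpha>(2)[of "n + int j"] by (simp add: norm_divide divide_left_mono)
  also have "\<dots> \<le> K ^ Suc j / \<alpha> * ?r j"
    using mult_right_mono[OF one_le_power[OF K(2), of "Suc j"], of "?r j / \<alpha>"] \<alpha>(1) by simp
  finally show ?case by (simp add: algebra_simps)
qed simp

lemma transfer_prod_bound: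
  assumes K: "\<And>n. mat2_norm (transfer a b E n) \<le> K"
  shows "mat2_norm (transfer_prod a b E n j) \<le> 2 * K ^ j"
proof (induction j)
  case (Suc j)
  have "mat2_norm (transfer_prod a b E n (Suc j)) \<le> mat2_norm (transfer a b E (n + int j)) * mat2_norm (transfer_prod a b E n j)"
    by (simp add: mat2_norm_mult)
  also have "\<dots> \<le> K * (2 * K ^ j)"
    using K Suc by (intro mult_mono) (auto intro: mat2_norm_nonneg order_trans[OF mat2_norm_nonneg])
  finally show ?case by simp
qed simp

text \<open>The Cayley--Hamilton identity \<open>B + B\<^sup>-\<^sup>1 = tr B\<close> for the monodromy matrix, which has
  determinant 1.\<close>
lemma monodromy_recurrence:
  fixes a b :: "int \<Rightarrow> real"
  assumes \<alpha>: "\<alpha> > 0" "\<And>n. a n \<ge> \<alpha>" and bd: "bounded (range a)" "bounded (range b)"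
    and per: "\<And>n. a (n + int P) = a n" "\<And>n. b (n + int P) = b n"
  shows "\<exists>C\<ge>0. \<forall>E u n. \<bar>E\<bar> \<le> R \<longrightarrow>
    cmod (u (n + int P) - of_real (mat2_trace (transfer_prod a b E 0 P)) * u n + u (n - int P))
      \<le> C * ((\<Sum>i<P. cmod (residual a b E u (n + int i)))
            + (\<Sum>i<P. cmod (residual a b E u (n - int P + int i))))"
proof -
  obtain Ka where Ka: "\<And>n. \<bar>a n\<bar> \<le> Ka" using bd(1) unfolding bounded_iff by auto
  obtain Kb where Kb: "\<And>n. \<bar>b n\<bar> \<le> Kb" using bd(2) unfolding bounded_iff by auto
  have nz: "a n \<noteq> 0" for n using \<alpha>(1) \<alpha>(2)[of n] by auto
  define K where "K = 1 + (\<bar>R\<bar> + Kb) / \<alpha> + 1 / \<alpha> + Ka"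
  have Kpos: "Ka \<ge> 0" "Kb \<ge> 0" using Ka[of 0] Kb[of 0] by auto
  then have K1: "K \<ge> 1" using \<alpha>(1) by (simp add: K_def)
  have T: "mat2_norm (transfer a b E n) \<le> K" if "\<bar>E\<bar> \<le> R" for E n
  proof -
    have "\<bar>(E - b n) / a n\<bar> \<le> (\<bar>R\<bar> + Kb) / \<alpha>"
      unfolding abs_divide using that Kb[of n] \<alpha>(1) \<alpha>(2)[of n] Kpos by (intro frac_le) auto
    moreover have "\<bar>- 1 / a n\<bar> \<le> 1 / \<alpha>"
      unfolding abs_divide using \<alpha>(1) \<alpha>(2)[of n] by (intro frac_le) auto
    ultimately show ?thesis using Ka[of n] by (simp add: transfer_def K_def)
  qed
  \<comment> \<open>Norm bound for the inverse monodromy matrix times the constant of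
    \<open>source_bound\<close>; it also dominates the forward source term.\<close>
  define C where "C = 2 * K ^ P * (K ^ P / \<alpha>)"
  have C0: "C \<ge> 0" using K1 \<alpha>(1) by (simp add: C_def)
  have "K ^ P \<ge> 1" using K1 by (rule one_le_power)
  then have C1: "K ^ P / \<alpha> \<le> C" using \<alpha>(1) unfolding C_def by (simp add: field_simps mult_left_mono)
  have "cmod (u (n + int P) - of_real (mat2_trace (transfer_prod a b E 0 P)) * u n + u (n - int P))
      \<le> C * ((\<Sum>i<P. cmod (residual a b E u (n + int i)))
            + (\<Sum>i<P. cmod (residual a b E u (n - int P + int i))))" if E: "\<bar>E\<bar> \<le> R" for E u n
  proof -
    let ?B = "transfer_prod a b E n P" and ?F = "source a b E u n P"
      and ?F' = "source a b E u (n - int P) P"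
    let ?v = "phase a u" and ?D = "mat2_trace (transfer_prod a b E 0 P)"
    have B': "transfer_prod a b E (n - int P) P = ?B"
      using transfer_prod_periodic[of a "int P" b E n "-1" P, OF per] by simp
    have v1: "?v (n + int P) = mat2_apply ?B (?v n) + ?F" by (rule phase_add[OF nz])
    have v2: "?v n = mat2_apply ?B (?v (n - int P)) + ?F'"
      using phase_add[of a u "n - int P" P b E, OF nz] by (simp add: B')
    have D: "mat2_apply ?B (?v n) = ?D *\<^sub>R ?v n - mat2_apply (mat2_adj ?B) (?v n)"
      using mat2_add_adj[of ?B "?v n"] trace_monodromy_const[of a P b E n, OF nz per] by (simp add: algebra_simps)
    \<comment> \<open>The adjugate inverts the monodromy matrix, so it steps back by one period, up
      to the transported source of the preceding period.\<close>
    have adj: "mat2_apply (mat2_adj ?B) (?v n) = ?v (n - int P) + mat2_apply (mat2_adj ?B) ?F'"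
    proof -
      have "mat2_apply (mat2_adj ?B) (?v n) = mat2_apply (mat2_adj ?B \<odot> ?B) (?v (n - int P)) + mat2_apply (mat2_adj ?B) ?F'"
        by (subst v2) (simp add: mat2_apply_add mat2_apply_mult)
      also have "mat2_adj ?B \<odot> ?B = (1,0,0,1)" by (rule mat2_adj_mult, rule det_transfer_prod, rule nz)
      also have "mat2_apply (1,0,0,1) (?v (n - int P)) = ?v (n - int P)"
        by (cases "?v (n - int P)") simp
      finally show ?thesis .
    qed
    have *: "?v (n + int P) - ?D *\<^sub>R ?v n + ?v (n - int P) = ?F - mat2_apply (mat2_adj ?B) ?F'"
      unfolding v1 D adj by (simp add: algebra_simps)
    have "cmod (u (n + int P) - of_real ?D * u n + u (n - int P))
        \<le> vec2_norm (?v (n + int P) - ?D *\<^sub>R ?v n + ?v (n - int P))"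
      by (simp add: phase_def scaleR_conv_of_real)
    also have "\<dots> \<le> vec2_norm ?F + mat2_norm ?B * vec2_norm ?F'"
      unfolding * using vec2_norm_diff vec2_norm_apply[of "mat2_adj ?B" ?F'] mat2_norm_adj
      by (smt (verit, best))
    also have "vec2_norm ?F \<le> K ^ P / \<alpha> * (\<Sum>i<P. cmod (residual a b E u (n + int i)))"
      by (rule source_bound[OF T[OF E] K1 \<alpha>])
    also have "\<dots> \<le> C * (\<Sum>i<P. cmod (residual a b E u (n + int i)))"
      by (rule mult_right_mono[OF C1]) (simp add: sum_nonneg)
    also have "mat2_norm ?B * vec2_norm ?F' \<le> (2 * K ^ P) *
        (K ^ P / \<alpha> * (\<Sum>i<P. cmod (residual a b E u (n - int P + int i))))"
      by (intro mult_mono source_bound[OF T[OF E] K1 \<alpha>] transfer_prod_bound[OF T[OF E]])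
         (use K1 in \<open>auto simp: vec2_norm_nonneg\<close>)
    finally show ?thesis by (simp add: C_def algebra_simps)
  qed
  with C0 show ?thesis by blast
qed

section \<open>Hyperbolic energies of periodic operators\<close>

lemma coord_sum: "coord (sum f A) n = (\<Sum>i\<in>A. coord (f i) n)"
  by (induction A rule: infinite_finite_induct) (simp_all add: coord_zero coord_add)

text \<open>Turns pointwise absolute values into vectors, so that a pointwise inequality passes to
  norms by \<open>norm_mono_coord\<close>.\<close>

definition modulus :: "ell2 \<Rightarrow> ell2" where
  "modulus u = Ell2 (\<lambda>n. of_real (cmod (coord u n)))"

lemma coord_modulus: "coord (modulus u) n = of_real (cmod (coord u n))"
proof -
  have "(\<lambda>n. complex_of_real (cmod (coord u n))) \<in> l2" using coord[of u] by (simp add: l2_def)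
  then show ?thesis by (simp add: modulus_def coord_Ell2)
qed

lemma norm_modulus: "norm (modulus u) = norm u"
  by (intro order_antisym norm_mono_coord) (simp_all add: coord_modulus)

lemma coord_residual:
  assumes "bounded (range a)" "bounded (range b)"
  shows "coord (jop a b u - E *\<^sub>R u) n = residual a b E (coord u) n"
  by (simp add: coord_diff coord_scaleR coord_jop assms residual_def)

text \<open>Taking norms in the three-term recurrence over periods gives |D| \<open>norm u\<close>
  <= 2 \<open>norm u\<close> + C' \<open>norm (J u - E u)\<close>, where D is the trace. For |D| > 2
  the middle term is absorbed; expanding and contracting directions never appear.\<close>

lemma bounded_below_if_hyperbolic:
  fixes a b :: "int \<Rightarrow> real"
  assumes \<alpha>: "\<alpha> > 0" "\<And>n. a n \<ge> \<alpha>" and bd: "bounded (range a)" "bounded (range b)"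
    and per: "\<And>n. a (n + int P) = a n" "\<And>n. b (n + int P) = b n"
    and hyp: "\<bar>mat2_trace (transfer_prod a b E 0 P)\<bar> > 2"
  shows "bounded_below (\<lambda>u. jop a b u - E *\<^sub>R u)"
proof -
  obtain C where C: "C \<ge> 0" "\<And>u n.
    cmod (u (n + int P) - of_real (mat2_trace (transfer_prod a b E 0 P)) * u n + u (n - int P))
      \<le> C * ((\<Sum>i<P. cmod (residual a b E u (n + int i)))
            + (\<Sum>i<P. cmod (residual a b E u (n - int P + int i))))"
    using monodromy_recurrence[OF \<alpha> bd per, of "\<bar>E\<bar>"] by blast
  define D where "D = \<bar>mat2_trace (transfer_prod a b E 0 P)\<bar>"
  define C' where "C' = 2 * C * real P"
  have C': "C' \<ge> 0" using C(1) by (simp add: C'_def)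
  have est: "(D - 2) * norm u \<le> C' * norm (jop a b u - E *\<^sub>R u)" for u
  proof -
    define f where "f = jop a b u - E *\<^sub>R u"
    have f: "coord f n = residual a b E (coord u) n" for n unfolding f_def by (rule coord_residual[OF bd])
    define S where "S k = (\<Sum>i<P. modulus (shift (k + int i) f))" for k
    have S: "coord (S k) n = of_real (\<Sum>i<P. cmod (coord f (n + k + int i)))" for k n
      by (simp add: S_def coord_sum coord_modulus coord_shift algebra_simps)
    have Sn: "norm (S k) \<le> real P * norm f" for k
    proof -
      have "norm (S k) \<le> (\<Sum>i<P. norm f)"
        unfolding S_def by (rule order_trans[OF norm_sum]) (simp add: norm_modulus norm_shift)
      then show ?thesis by simp
    qed
    define w where "w = modulus (shift (int P) u) + modulus (shift (- int P) u) + C *\<^sub>R (S 0 + S (- int P))"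
    have "norm (D *\<^sub>R u) \<le> norm w"
    proof (rule norm_mono_coord)
      fix n
      have "D * cmod (coord u n) = cmod (of_real (mat2_trace (transfer_prod a b E 0 P)) * coord u n)"
        by (simp add: D_def norm_mult)
      also have "\<dots> \<le> cmod (coord u (n + int P)) + cmod (coord u (n - int P))
          + cmod (coord u (n + int P) - of_real (mat2_trace (transfer_prod a b E 0 P)) * coord u n + coord u (n - int P))"
        by (smt (verit, ccfv_SIG) add_diff_eq diff_add_eq norm_triangle_ineq norm_triangle_ineq4 add.commute diff_add_cancel norm_minus_commute)
      also have "\<dots> \<le> cmod (coord u (n + int P)) + cmod (coord u (n - int P))
          + C * ((\<Sum>i<P. cmod (coord f (n + int i))) + (\<Sum>i<P. cmod (coord f (n - int P + int i))))"
        unfolding f using C(2) by (intro add_left_mono)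
      also have "\<dots> = Re (coord w n)" by (simp add: w_def coord_add coord_scaleR coord_modulus coord_shift S)
      also have "\<dots> \<le> cmod (coord w n)" by (rule complex_Re_le_cmod)
      finally show "cmod (coord (D *\<^sub>R u) n) \<le> cmod (coord w n)"
        by (simp add: coord_scaleR norm_mult D_def)
    qed
    also have "norm w \<le> norm u + norm u + C * (real P * norm f + real P * norm f)"
    proof -
      have "norm w \<le> norm (modulus (shift (int P) u)) + norm (modulus (shift (- int P) u)) + norm (C *\<^sub>R (S 0 + S (- int P)))"
        unfolding w_def by (intro norm_triangle_mono order_refl)
      moreover have "norm (C *\<^sub>R (S 0 + S (- int P))) \<le> C * (real P * norm f + real P * norm f)"
        using C(1) norm_triangle_mono[OF Sn Sn] by (simp add: mult_left_mono)
      ultimately show ?thesis by (simp add: norm_modulus norm_shift)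
    qed
    finally show ?thesis by (simp add: f_def[symmetric] C'_def D_def algebra_simps)
  qed
  show ?thesis
  proof (rule bounded_belowI)
    show pos: "(D - 2) / (C' + 1) > 0" using hyp C' by (simp add: D_def)
    fix u
    have "(D - 2) * norm u \<le> (C' + 1) * norm (jop a b u - E *\<^sub>R u)"
      using est[of u] norm_ge_zero[of "jop a b u - E *\<^sub>R u"] unfolding distrib_right by linarith
    then show "(D - 2) / (C' + 1) * norm u \<le> norm (jop a b u - E *\<^sub>R u)"
      using C' by (simp add: field_simps)
  qed
qed


text \<open>Changing two neighbouring values of \<open>b\<close> in each period multiplies the monodromy matrix by a
  shear on either side.\<close>
definition kicked :: "(int \<Rightarrow> real) \<Rightarrow> (int \<Rightarrow> real) \<Rightarrow> nat \<Rightarrow> real \<Rightarrow> real \<Rightarrow> int \<Rightarrow> real" where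
  "kicked a b P s t x = b x + (if x mod int P = 0 then t else 0)
     - (if x mod int P = int P - 1 then s * (a x)\<^sup>2 else 0)"

text \<open>Adding \<open>t\<close> to \<open>b\<close> changes the first entry of a transfer matrix
  by -t / a, which is the shear on the right; subtracting \<open>s * a^2\<close> changes it by s a,
  the shear on the left. Kicking the first and the last site places the shears at the two ends of
  the product, and \<open>P \<ge> 2\<close> keeps these sites distinct.\<close>

lemma perturbed_monodromy:
  fixes a b :: "int \<Rightarrow> real"
  assumes nz: "\<And>n. a n \<noteq> 0" and P: "P \<ge> 2"
  shows "transfer_prod a (kicked a b P s t) E 0 P = (1, s, 0, 1) \<odot> transfer_prod a b E 0 P \<odot> (1, 0, t, 1)"
proof -
  have start: "transfer_prod a (kicked a b P s t) E 0 (Suc j) = transfer_prod a b E 0 (Suc j) \<odot> (1, 0, t, 1)" if "Suc j < P" for j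
    using that
  proof (induction j)
    case 0
    have "transfer a (kicked a b P s t) E 0 = transfer a b E 0 \<odot> (1, 0, t, 1)"
      using P nz[of 0] by (simp add: transfer_def kicked_def field_simps)
    then show ?case by (simp add: mat2_mult_id)
  next
    case (Suc j)
    then have "int (Suc j) mod int P = int (Suc j)" by (intro mod_pos_pos_trivial) auto
    then have "transfer a (kicked a b P s t) E (int (Suc j)) = transfer a b E (int (Suc j))"
      using Suc.prems by (simp add: transfer_def kicked_def)
    with Suc show ?case by (simp add: mat2_mult_assoc)
  qed
  obtain j where j: "P = Suc (Suc j)" using P by (metis Suc_1 Suc_le_D add_2_eq_Suc le_Suc_ex)
  have m: "(1 + int j) mod int P = 1 + int j" by (intro mod_pos_pos_trivial) (auto simp: j)
  have last: "transfer a (kicked a b P s t) E (int (Suc j)) = (1, s, 0, 1) \<odot> transfer a b E (int (Suc j))"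
    using nz[of "1 + int j"] m by (simp add: transfer_def kicked_def j field_simps power2_eq_square)
  have split: "transfer_prod a c E 0 P = transfer a c E (int (Suc j)) \<odot> transfer_prod a c E 0 (Suc j)" for c
    unfolding j by simp
  show ?thesis
    unfolding split last using start[of j] j by (simp add: mat2_mult_assoc del: transfer_prod.simps)
qed

lemma mat2_trace_sheared:
  "mat2_trace ((1, s, 0, 1) \<odot> (x, y, z, w) \<odot> (1, 0, t, 1)) = x + s * z + t * y + s * t * w + w"
  by (simp add: algebra_simps)

text \<open>If no power of \<open>X 1\<close> sheared on both sides were hyperbolic then the powers would be bounded,
  so some power would be close to the identity, and a product of two shears of the same sign is
  hyperbolic.\<close>
lemma sheared_power_hyperbolic:
  fixes X :: "nat \<Rightarrow> mat2"
  assumes add: "\<And>m n. X (m + n) = X n \<odot> X m" and det: "\<And>n. mat2_det (X n) = 1" and \<tau>: "\<tau> > 0"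
  shows "\<exists>n\<ge>1. \<exists>s\<in>{0, \<tau>}. \<exists>t\<in>{0, \<tau>}. \<bar>mat2_trace ((1, s, 0, 1) \<odot> X n \<odot> (1, 0, t, 1))\<bar> > 2"
proof (rule ccontr)
  assume "\<not> ?thesis"
  then have le: "\<bar>mat2_trace ((1, s, 0, 1) \<odot> X n \<odot> (1, 0, t, 1))\<bar> \<le> 2"
    if "n \<ge> 1" "s \<in> {0, \<tau>}" "t \<in> {0, \<tau>}" for n s t
    using that by (meson not_le)
  \<comment> \<open>Four traces determine a matrix. Comparison with the unsheared trace bounds the
    off-diagonal entries by 4 / \<open>\<tau>\<close>, the doubly sheared trace then bounds
    \<open>w\<close> by 12 / \<open>\<tau>\<^sup>2\<close>, and the trace itself bounds
    \<open>x\<close>.\<close>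
  define C where "C = 4 / \<tau> + 12 / \<tau>\<^sup>2 + 2"
  have C: "C > 0" using \<tau> by (simp add: C_def add_pos_pos)
  have entries: "\<bar>x\<bar> \<le> C \<and> \<bar>y\<bar> \<le> C \<and> \<bar>z\<bar> \<le> C \<and> \<bar>w\<bar> \<le> C" if "n \<ge> 1" "X n = (x, y, z, w)" for n x y z w
  proof -
    have t0: "\<bar>x + w\<bar> \<le> 2" using le[OF that(1), of 0 0] by (simp add: that(2))
    have t1: "\<bar>x + \<tau> * y + w\<bar> \<le> 2"
      using le[OF that(1), of 0 \<tau>] unfolding that(2) mat2_trace_sheared by simp
    have t2: "\<bar>x + \<tau> * z + w\<bar> \<le> 2"
      using le[OF that(1), of \<tau> 0] unfolding that(2) mat2_trace_sheared by simp
    have t3: "\<bar>x + \<tau> * z + \<tau> * y + \<tau> * \<tau> * w + w\<bar> \<le> 2"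
      using le[OF that(1), of \<tau> \<tau>] unfolding that(2) mat2_trace_sheared by simp
    have y: "\<bar>\<tau> * y\<bar> \<le> 4" and z: "\<bar>\<tau> * z\<bar> \<le> 4" using t0 t1 t2 by linarith+
    have w: "\<bar>\<tau>\<^sup>2 * w\<bar> \<le> 12" unfolding power2_eq_square using t0 t3 y z by linarith
    have y': "\<bar>y\<bar> \<le> 4 / \<tau>" and z': "\<bar>z\<bar> \<le> 4 / \<tau>" and w': "\<bar>w\<bar> \<le> 12 / \<tau>\<^sup>2"
      using y z w \<tau> by (simp_all add: abs_mult field_simps)
    have "4 / \<tau> \<ge> 0" "12 / \<tau>\<^sup>2 \<ge> 0" using \<tau> by auto
    then show ?thesis unfolding C_def using y' z' w' t0 by linarith
  qed
  define S where "S = {-C..C} \<times> {-C..C} \<times> {-C..C} \<times> {-C..C}"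
  have "compact S" unfolding S_def by (intro compact_Times compact_Icc)
  moreover have "X (Suc n) \<in> S" for n
    using entries[of "Suc n"] by (cases "X (Suc n)") (auto simp: S_def abs_le_iff minus_le_iff)
  ultimately obtain l r where r: "strict_mono r" "((\<lambda>n. X (Suc n)) \<circ> r) \<longlonglongrightarrow> l"
    unfolding compact_def by (metis (no_types, lifting))
  define M where "M = (1 + \<tau>) * (1 + \<tau>)"
  have M: "M > 0" using \<tau> by (simp add: M_def)
  define e where "e = \<tau>\<^sup>2 / (8 * M * C)"
  have e: "e > 0" using M C \<tau> by (simp add: e_def)
  have "Cauchy ((\<lambda>n. X (Suc n)) \<circ> r)" using r(2) LIMSEQ_imp_Cauchy by blast
  then obtain N where N: "dist (X (Suc (r (Suc N)))) (X (Suc (r N))) < e"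
    using metric_CauchyD[OF _ e] by (metis (no_types, lifting) comp_apply le_SucI order_refl)
  \<comment> \<open>\<open>X k\<close> is \<open>X (i + k)\<close> times the inverse of
    \<open>X i\<close>. The two powers are close and the inverse is bounded, so \<open>X k\<close>
    is near the identity, for which the doubly sheared trace would be 2 +
    \<open>\<tau>\<^sup>2\<close>.\<close>
  define i k where "i = Suc (r N)" and "k = r (Suc N) - r N"
  have k: "k \<ge> 1" "Suc (r (Suc N)) = i + k"
    using strict_monoD[OF r(1), of N "Suc N"] by (auto simp: i_def k_def)
  obtain x y z w where Xi: "X i = (x, y, z, w)" by (cases "X i")
  obtain x' y' z' w' where Xj: "X (i + k) = (x', y', z', w')" by (cases "X (i + k)")
  obtain p q p' q' where Xk: "X k = (p, q, p', q')" by (cases "X k")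
  have close: "\<bar>x' - x\<bar> < e" "\<bar>y' - y\<bar> < e" "\<bar>z' - z\<bar> < e" "\<bar>w' - w\<bar> < e"
  proof -
    have d: "dist (X (i + k)) (X i) < e" using N by (simp add: k(2) i_def)
    have f: "dist (fst u) (fst v) \<le> dist u v" "dist (snd u) (snd v) \<le> dist u v" for u v :: "'c::metric_space \<times> 'd::metric_space"
      by (rule dist_fst_le, rule dist_snd_le)
    show "\<bar>x' - x\<bar> < e" using order_le_less_trans[OF dist_fst_le d] by (simp add: Xi Xj dist_real_def)
    have d1: "dist (y', z', w') (y, z, w) < e" using order_le_less_trans[OF dist_snd_le d] by (simp add: Xi Xj)
    show "\<bar>y' - y\<bar> < e" using order_le_less_trans[OF dist_fst_le d1] by (simp add: dist_real_def)
    have d2: "dist (z', w') (z, w) < e" using order_le_less_trans[OF dist_snd_le d1] by simp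
    show "\<bar>z' - z\<bar> < e" using order_le_less_trans[OF dist_fst_le d2] by (simp add: dist_real_def)
    show "\<bar>w' - w\<bar> < e" using order_le_less_trans[OF dist_snd_le d2] by (simp add: dist_real_def)
  qed
  have ent: "\<bar>x\<bar> \<le> C" "\<bar>y\<bar> \<le> C" "\<bar>z\<bar> \<le> C" "\<bar>w\<bar> \<le> C" using entries[OF _ Xi] by (auto simp: i_def)
  have dt: "x * w - y * z = 1" using det[of i] by (simp add: Xi)
  have "X k \<odot> X i \<odot> mat2_adj (X i) = X k"
    by (simp add: mat2_mult_assoc mat2_adj_mult det mat2_mult_id)
  then have "X k = X (i + k) \<odot> mat2_adj (X i)" by (simp add: add)
  then have pq: "p = x' * w - y' * z" "q = y' * x - x' * y" "p' = z' * w - w' * z" "q' = w' * x - z' * y"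
    by (simp_all add: Xi Xj Xk)
  have prod: "\<bar>u * v\<bar> \<le> e * C" if "\<bar>u\<bar> < e" "\<bar>v\<bar> \<le> C" for u v
    unfolding abs_mult using that e by (intro mult_mono) auto
  have near: "\<bar>p - 1\<bar> \<le> 2 * e * C" "\<bar>q\<bar> \<le> 2 * e * C" "\<bar>p'\<bar> \<le> 2 * e * C" "\<bar>q' - 1\<bar> \<le> 2 * e * C"
  proof -
    have "p - 1 = (x' - x) * w - (y' - y) * z" using dt unfolding pq by (simp add: algebra_simps)
    then show "\<bar>p - 1\<bar> \<le> 2 * e * C"
      using prod[OF close(1) ent(4)] prod[OF close(2) ent(3)] by linarith
    have "q = (y' - y) * x - (x' - x) * y" unfolding pq by (simp add: algebra_simps)
    then show "\<bar>q\<bar> \<le> 2 * e * C"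
      using prod[OF close(2) ent(1)] prod[OF close(1) ent(2)] by linarith
    have "p' = (z' - z) * w - (w' - w) * z" unfolding pq by (simp add: algebra_simps)
    then show "\<bar>p'\<bar> \<le> 2 * e * C"
      using prod[OF close(3) ent(4)] prod[OF close(4) ent(3)] by linarith
    have "q' - 1 = (w' - w) * x - (z' - z) * y" using dt unfolding pq by (simp add: algebra_simps)
    then show "\<bar>q' - 1\<bar> \<le> 2 * e * C"
      using prod[OF close(4) ent(1)] prod[OF close(3) ent(2)] by linarith
  qed
  have "mat2_trace ((1, \<tau>, 0, 1) \<odot> X k \<odot> (1, 0, \<tau>, 1))
      = 2 + \<tau>\<^sup>2 + ((p - 1) + \<tau> * p' + \<tau> * q + (1 + \<tau>\<^sup>2) * (q' - 1))"
    unfolding Xk mat2_trace_sheared by (simp add: algebra_simps power2_eq_square)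
  moreover have "\<bar>(p - 1) + \<tau> * p' + \<tau> * q + (1 + \<tau>\<^sup>2) * (q' - 1)\<bar> < \<tau>\<^sup>2"
  proof -
    have "\<bar>(p - 1) + \<tau> * p' + \<tau> * q + (1 + \<tau>\<^sup>2) * (q' - 1)\<bar>
        \<le> \<bar>p - 1\<bar> + \<tau> * \<bar>p'\<bar> + \<tau> * \<bar>q\<bar> + (1 + \<tau>\<^sup>2) * \<bar>q' - 1\<bar>"
    proof -
      have "\<bar>\<tau> * p'\<bar> = \<tau> * \<bar>p'\<bar>" "\<bar>\<tau> * q\<bar> = \<tau> * \<bar>q\<bar>" "\<bar>(1 + \<tau>\<^sup>2) * (q' - 1)\<bar> = (1 + \<tau>\<^sup>2) * \<bar>q' - 1\<bar>"
        using \<tau> by (simp_all add: abs_mult)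
      then show ?thesis by linarith
    qed
    also have "\<dots> \<le> 2 * e * C + \<tau> * (2 * e * C) + \<tau> * (2 * e * C) + (1 + \<tau>\<^sup>2) * (2 * e * C)"
      using near \<tau> by (intro add_mono mult_left_mono) auto
    also have "\<dots> = (2 + 2 * \<tau> + \<tau>\<^sup>2) * (2 * e * C)" by (simp add: algebra_simps)
    also have "\<dots> \<le> (2 * M) * (2 * e * C)"
      using \<tau> e C by (intro mult_right_mono) (auto simp: M_def algebra_simps power2_eq_square)
    also have "\<dots> = \<tau>\<^sup>2 / 2" using M C by (simp add: e_def)
    also have "\<dots> < \<tau>\<^sup>2" using \<tau> by simp
    finally show ?thesis .
  qed
  ultimately have "\<bar>mat2_trace ((1, \<tau>, 0, 1) \<odot> X k \<odot> (1, 0, \<tau>, 1))\<bar> > 2" by linarith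
  with le[OF k(1), of \<tau> \<tau>] show False by simp
qed

lemma bounded_range_close:
  assumes "bounded (range b)" "\<And>n. \<bar>b' n - b n :: real\<bar> \<le> \<epsilon>"
  shows "bounded (range b')"
proof -
  obtain K where K: "\<And>n. \<bar>b n\<bar> \<le> K" using assms(1) unfolding bounded_iff by auto
  have "\<bar>b' n\<bar> \<le> K + \<epsilon>" for n using K[of n] assms(2)[of n] by linarith
  then show ?thesis by (rule bounded_rangeI_real)
qed

text \<open>\<open>sheared_power_hyperbolic\<close> is applied to the powers of the monodromy
  matrix. The new period depends on \<open>E\<close> and on \<open>\<epsilon>\<close>, since the
  number of repetitions comes from a compactness argument.\<close>

lemma gap_opening:
  fixes a b :: "int \<Rightarrow> real"
  assumes \<alpha>: "\<alpha> > 0" "\<And>n. a n \<ge> \<alpha>" and bd: "bounded (range a)" "bounded (range b)"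
    and p: "p > 0" and per: "\<And>n. a (n + int p) = a n" "\<And>n. b (n + int p) = b n" and \<epsilon>: "\<epsilon> > 0"
  shows "\<exists>b' P. P > 0 \<and> (\<forall>n. a (n + int P) = a n) \<and> (\<forall>n. b' (n + int P) = b' n) \<and>
    (\<forall>n. \<bar>b' n - b n\<bar> \<le> \<epsilon>) \<and> bounded_below (\<lambda>u. jop a b' u - E *\<^sub>R u)"
proof -
  obtain Ka where Ka: "\<And>n. \<bar>a n\<bar> \<le> Ka" using bd(1) unfolding bounded_iff by auto
  have nz: "a n \<noteq> 0" for n using \<alpha>(1) \<alpha>(2)[of n] by auto
  \<comment> \<open>With this size the kicks \<open>t\<close> and \<open>s * a^2\<close> together
    still amount to at most \<open>\<epsilon>\<close>.\<close>
  define \<tau> where "\<tau> = \<epsilon> / (1 + Ka\<^sup>2)"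
  have pos: "1 + Ka\<^sup>2 > 0" by (simp add: add_pos_nonneg)
  have \<tau>: "\<tau> > 0" using \<epsilon> pos by (simp add: \<tau>_def)
  \<comment> \<open>Doubling the period secures \<open>P \<ge> 2\<close> when
    \<open>p = 1\<close>.\<close>
  define q where "q = 2 * p"
  have perq: "a (n + k * int q) = a n" "b (n + k * int q) = b n" for n k
    using periodic_mult[of a "int p" n "2 * k", OF per(1)] periodic_mult[of b "int p" n "2 * k", OF per(2)]
    by (simp_all add: q_def algebra_simps)
  define X where "X n = transfer_prod a b E 0 (n * q)" for n
  have "X (m + n) = X n \<odot> X m" for m n
    using transfer_prod_add[of a b E 0 "m * q" "n * q"]
      transfer_prod_periodic[of a "int q" b E 0 "int m" "n * q"] perq[of _ 1]
    by (simp add: X_def distrib_right)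
  moreover have "mat2_det (X n) = 1" for n unfolding X_def by (rule det_transfer_prod) (rule nz)
  ultimately obtain n s t where n: "n \<ge> 1" and s: "s \<in> {0, \<tau>}" and t: "t \<in> {0, \<tau>}"
    and hyp: "\<bar>mat2_trace ((1, s, 0, 1) \<odot> X n \<odot> (1, 0, t, 1))\<bar> > 2"
    using sheared_power_hyperbolic[of X \<tau>] \<tau> by blast
  define P where "P = n * q"
  have P: "P \<ge> 2" using n p by (simp add: P_def q_def)
  define b' where "b' = kicked a b P s t"
  have perP: "a (x + int P) = a x" "b (x + int P) = b x" for x
    using perq[of x "int n"] by (simp_all add: P_def)
  then have perb': "b' (x + int P) = b' x" for x by (simp add: b'_def kicked_def)
  have close: "\<bar>b' x - b x\<bar> \<le> \<epsilon>" for x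
  proof -
    have "(a x)\<^sup>2 \<le> Ka\<^sup>2" using Ka[of x] by (metis abs_ge_zero power2_abs power_mono)
    then have "s * (a x)\<^sup>2 \<le> \<tau> * Ka\<^sup>2" "s * (a x)\<^sup>2 \<ge> 0"
      using s \<tau> by (auto intro!: mult_mono)
    moreover have "0 \<le> t" "t \<le> \<tau>" "\<tau> * Ka\<^sup>2 \<ge> 0" using t \<tau> by auto
    moreover have "\<epsilon> = \<tau> * (1 + Ka\<^sup>2)" using pos by (simp add: \<tau>_def)
    then have "\<epsilon> = \<tau> + \<tau> * Ka\<^sup>2" by (simp add: algebra_simps)
    ultimately show ?thesis using P by (simp add: b'_def kicked_def)
  qed
  have "bounded (range b')" by (rule bounded_range_close[OF bd(2) close])
  moreover have "\<bar>mat2_trace (transfer_prod a b' E 0 P)\<bar> > 2"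
    unfolding b'_def using perturbed_monodromy[of a P b s t E, OF nz P] hyp by (simp add: X_def P_def)
  ultimately have "bounded_below (\<lambda>u. jop a b' u - E *\<^sub>R u)"
    using bounded_below_if_hyperbolic[of \<alpha> a b' P E] \<alpha> bd(1) perP perb' by blast
  then show ?thesis using P perP perb' close by (intro exI[of _ b'] exI[of _ P]) auto
qed

section \<open>Localization of approximate eigenvectors\<close>

lemma sum5_power2_le:
  "(x1 + x2 + x3 + x4 + x5)\<^sup>2 \<le> 5 * (x1\<^sup>2 + x2\<^sup>2 + x3\<^sup>2 + x4\<^sup>2 + (x5 :: real)\<^sup>2)"
proof -
  have "5 * (x1\<^sup>2 + x2\<^sup>2 + x3\<^sup>2 + x4\<^sup>2 + x5\<^sup>2) - (x1 + x2 + x3 + x4 + x5)\<^sup>2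
    = (x1 - x2)\<^sup>2 + (x1 - x3)\<^sup>2 + (x1 - x4)\<^sup>2 + (x1 - x5)\<^sup>2 + (x2 - x3)\<^sup>2
      + (x2 - x4)\<^sup>2 + (x2 - x5)\<^sup>2 + (x3 - x4)\<^sup>2 + (x3 - x5)\<^sup>2 + (x4 - x5)\<^sup>2"
    by (simp add: power2_eq_square algebra_simps)
  also have "\<dots> \<ge> 0" by (intro add_nonneg_nonneg zero_le_power2)
  finally show ?thesis by simp
qed

lemma norm_unit_vec: "norm (unit_vec k z) = cmod z"
proof -
  have "(norm (unit_vec k z))\<^sup>2 = (cmod z)\<^sup>2"
    using norm_finite_support[of "{k}" "unit_vec k z"] by (simp add: coord_unit_vec energy_def)
  then show ?thesis by (rule power2_eq_imp_eq) auto
qed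

lemma norm_restrict: "finite A \<Longrightarrow> (norm (restrict A u))\<^sup>2 = energy u A"
  by (subst norm_finite_support[of A]) (auto simp: coord_restrict energy_def)

lemma energy_Un_disjoint:
  "finite A \<Longrightarrow> finite B \<Longrightarrow> A \<inter> B = {} \<Longrightarrow> energy u (A \<union> B) = energy u A + energy u B"
  unfolding energy_def by (rule sum.union_disjoint)

lemma energy_Un_le: "finite A \<Longrightarrow> finite B \<Longrightarrow> energy u (A \<union> B) \<le> energy u A + energy u B"
  unfolding energy_def by (simp add: sum_Un sum_nonneg)

text \<open>A real basis of the sequences supported on the cell \<open>x + 1..x + P\<close>; over
  the reals each site contributes both 1 and \<open>\<i>\<close>.\<close>

definition span_basis :: "int \<Rightarrow> nat \<Rightarrow> ell2 set" where
  "span_basis x P = (\<lambda>n. unit_vec n 1) ` {x + 1..x + int P} \<union> (\<lambda>n. unit_vec n \<i>) ` {x + 1..x + int P}"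

lemma card_span_basis: "finite (span_basis x P)" "card (span_basis x P) \<le> 2 * P"
proof -
  show "finite (span_basis x P)" by (simp add: span_basis_def)
  have "card (span_basis x P) \<le> card ((\<lambda>n. unit_vec n 1) ` {x + 1..x + int P})
      + card ((\<lambda>n. unit_vec n \<i>) ` {x + 1..x + int P})"
    unfolding span_basis_def by (rule card_Un_le)
  also have "\<dots> \<le> card {x + 1..x + int P} + card {x + 1..x + int P}"
    by (intro add_mono card_image_le) auto
  finally show "card (span_basis x P) \<le> 2 * P" by simp
qed

lemma in_span_basis:
  assumes "\<And>n. n \<notin> {x + 1..x + int P} \<Longrightarrow> coord v n = 0"
  shows "v \<in> span (span_basis x P)"
proof -
  let ?A = "{x + 1..x + int P}"
  have "v = (\<Sum>n\<in>?A. Re (coord v n) *\<^sub>R unit_vec n 1 + Im (coord v n) *\<^sub>R unit_vec n \<i>)"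
  proof (rule ell2_eqI)
    fix m
    have "coord (\<Sum>n\<in>?A. Re (coord v n) *\<^sub>R unit_vec n 1 + Im (coord v n) *\<^sub>R unit_vec n \<i>) m
        = (\<Sum>n\<in>?A. if m = n then coord v n else 0)"
      unfolding coord_sum
      by (intro sum.cong) (auto simp: coord_add coord_scaleR coord_unit_vec complex_eq_iff)
    also have "\<dots> = coord v m" using assms[of m] by (auto simp: sum.delta)
    finally show "coord v m = coord (\<Sum>n\<in>?A. Re (coord v n) *\<^sub>R unit_vec n 1 + Im (coord v n) *\<^sub>R unit_vec n \<i>) m" ..
  qed
  also have "\<dots> \<in> span (span_basis x P)"
    by (intro span_sum span_add span_scale span_base) (auto simp: span_basis_def)
  finally show ?thesis .
qed

locale offdiagonal =
  fixes a :: "int \<Rightarrow> real" and \<alpha> Ka :: real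
  assumes \<alpha>: "\<alpha> > 0" "\<And>n. a n \<ge> \<alpha>" and Ka: "\<And>n. a n \<le> Ka"
begin

lemma abs_a_le: "\<bar>a n\<bar> \<le> Ka"
  using \<alpha>(1) \<alpha>(2)[of n] Ka[of n] by simp

lemma bounded_a: "bounded (range a)"
  using abs_a_le by (rule bounded_rangeI_real)

lemma Ka_pos: "Ka > 0"
  using \<alpha>(1) \<alpha>(2)[of 0] Ka[of 0] by simp

text \<open>Cutting off commutes with the operator except at the two sites on either side of each
  cut; these are \<open>e1\<close> to \<open>e4\<close>. Replacing \<open>b\<close> by
  \<open>b'\<close> is harmless because the truncated vector lives where they agree.\<close>

lemma truncation_estimate:
  assumes bd: "bounded (range b)" "bounded (range b')" and lr: "l \<le> r"
    and eq: "\<And>n. l \<le> n \<Longrightarrow> n \<le> r \<Longrightarrow> b' n = b n"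
  shows "(norm (jop a b' (restrict {l..r} u) - E *\<^sub>R restrict {l..r} u))\<^sup>2
    \<le> 5 * energy (jop a b u - E *\<^sub>R u) {l..r} + 5 * Ka\<^sup>2 * ((cmod (coord u (l - 1)))\<^sup>2
      + (cmod (coord u l))\<^sup>2 + (cmod (coord u r))\<^sup>2 + (cmod (coord u (r + 1)))\<^sup>2)"
proof -
  define f where "f = jop a b u - E *\<^sub>R u"
  define w where "w = restrict {l..r} u"
  define e1 where "e1 = unit_vec l (- of_real (a (l - 1)) * coord u (l - 1))"
  define e2 where "e2 = unit_vec (l - 1) (of_real (a (l - 1)) * coord u l)"
  define e3 where "e3 = unit_vec (r + 1) (of_real (a r) * coord u r)"
  define e4 where "e4 = unit_vec r (- of_real (a r) * coord u (r + 1))"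
  have split: "jop a b' w - E *\<^sub>R w = restrict {l..r} f + e1 + e2 + e3 + e4"
  proof (rule ell2_eqI)
    fix n
    consider "n < l - 1 \<or> n > r + 1" | "n = l - 1" | "n = r + 1" | "n \<in> {l..r}" by force
    then show "coord (jop a b' w - E *\<^sub>R w) n = coord (restrict {l..r} f + e1 + e2 + e3 + e4) n"
    proof cases
      case 4
      then have "b' n = b n" using eq by auto
      with 4 show ?thesis
        unfolding w_def f_def e1_def e2_def e3_def e4_def coord_add coord_diff coord_scaleR coord_restrict
          coord_unit_vec coord_jop[OF bounded_a bd(1)] coord_jop[OF bounded_a bd(2)] jac_op_def
        by (cases "n = l"; cases "n = r") (auto simp: algebra_simps)
    qed (use lr in \<open>auto simp: w_def f_def e1_def e2_def e3_def e4_def coord_add coord_diff coord_scaleR coord_restrict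
          coord_unit_vec coord_jop[OF bounded_a bd(1)] coord_jop[OF bounded_a bd(2)] jac_op_def\<close>)
  qed
  have "norm (jop a b' w - E *\<^sub>R w) \<le> norm (restrict {l..r} f) + norm e1 + norm e2 + norm e3 + norm e4"
    unfolding split by (intro norm_triangle_mono order_refl)
  then have "(norm (jop a b' w - E *\<^sub>R w))\<^sup>2 \<le> (norm (restrict {l..r} f) + norm e1 + norm e2 + norm e3 + norm e4)\<^sup>2"
    by (intro power_mono) auto
  also have "\<dots> \<le> 5 * ((norm (restrict {l..r} f))\<^sup>2 + (norm e1)\<^sup>2 + (norm e2)\<^sup>2 + (norm e3)\<^sup>2 + (norm e4)\<^sup>2)"
    by (rule sum5_power2_le)
  also have "\<dots> \<le> 5 * (energy f {l..r} + Ka\<^sup>2 * (cmod (coord u (l - 1)))\<^sup>2 + Ka\<^sup>2 * (cmod (coord u l))\<^sup>2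
      + Ka\<^sup>2 * (cmod (coord u r))\<^sup>2 + Ka\<^sup>2 * (cmod (coord u (r + 1)))\<^sup>2)"
  proof -
    have "\<bar>a n\<bar>\<^sup>2 * y\<^sup>2 \<le> Ka\<^sup>2 * y\<^sup>2" for n y
      using abs_a_le[of n] by (intro mult_right_mono power_mono) auto
    then show ?thesis
      by (intro mult_left_mono add_mono)
         (simp_all add: norm_restrict e1_def e2_def e3_def e4_def norm_unit_vec norm_mult power_mult_distrib)
  qed
  finally show ?thesis by (simp add: f_def w_def algebra_simps)
qed

text \<open>Hole filling: the gap of \<open>b'\<close> bounds the mass on a window by the residual
  plus a constant \<open>c\<close> times the mass on the surrounding annulus. Adding
  \<open>c\<close> times the window mass to both sides gives contraction by c / (1 + c) whenever the
  window grows by 2. Decay is obtained for the operator with \<open>b\<close>, which need not have a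
  gap at \<open>E\<close>.\<close>

lemma decay_in_gap:
  assumes bd: "bounded (range b)" "bounded (range b')" and \<kappa>: "\<kappa> > 0"
    and gap: "\<And>w. norm (jop a b' w - E *\<^sub>R w) \<ge> \<kappa> * norm w"
    and eq: "\<And>n. \<bar>n - x\<bar> \<le> int (2 * m + 2) \<Longrightarrow> b' n = b n"
    and c: "c = 5 * Ka\<^sup>2 / \<kappa>\<^sup>2"
  shows "energy u {x - 2..x + 2} \<le> (c / (1 + c)) ^ m * energy u {x - int (2 * m + 2)..x + int (2 * m + 2)}
    + 5 / \<kappa>\<^sup>2 * (1 + c) * energy (jop a b u - E *\<^sub>R u) {x - int (2 * m + 2)..x + int (2 * m + 2)}"
proof -
  define f where "f = jop a b u - E *\<^sub>R u"
  define S where "S r = energy u {x - int r..x + int r}" for r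
  define \<phi> where "\<phi> = energy f {x - int (2 * m + 2)..x + int (2 * m + 2)}"
  define \<theta> where "\<theta> = c / (1 + c)"
  have c0: "c > 0" using Ka_pos \<kappa> by (simp add: c)
  have \<theta>: "0 < \<theta>" "\<theta> < 1" using c0 by (auto simp: \<theta>_def)
  have step: "S r \<le> \<theta> * S (r + 2) + 5 / \<kappa>\<^sup>2 * \<phi>" if r: "r + 1 \<le> 2 * m + 2" for r
  proof -
    \<comment> \<open>Cutting at radius \<open>r + 1\<close> puts the four boundary sites of
      \<open>truncation_estimate\<close> exactly between the windows of radius \<open>r\<close> and
      \<open>r + 2\<close>.\<close>
    let ?l = "x - int (r + 1)" and ?r = "x + int (r + 1)"
    have bdry: "S (r + 2) = S r + ((cmod (coord u (?l - 1)))\<^sup>2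
      + (cmod (coord u ?l))\<^sup>2 + (cmod (coord u ?r))\<^sup>2 + (cmod (coord u (?r + 1)))\<^sup>2)"
    proof -
      have "{x - int (r + 2)..x + int (r + 2)} = {x - int r..x + int r} \<union> {?l - 1, ?l, ?r, ?r + 1}" by auto
      then have "S (r + 2) = S r + energy u {?l - 1, ?l, ?r, ?r + 1}"
        unfolding S_def by (simp only:) (rule energy_Un_disjoint, auto)
      then show ?thesis by (simp add: energy_def)
    qed
    have "\<kappa>\<^sup>2 * S r \<le> \<kappa>\<^sup>2 * S (r + 1)" unfolding S_def by (intro mult_left_mono energy_mono) auto
    also have "\<dots> = (\<kappa> * norm (restrict {?l..?r} u))\<^sup>2"
      by (simp add: S_def power_mult_distrib norm_restrict)
    also have "\<dots> \<le> (norm (jop a b' (restrict {?l..?r} u) - E *\<^sub>R restrict {?l..?r} u))\<^sup>2"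
      using \<kappa> by (intro power_mono gap) auto
    also have "\<dots> \<le> 5 * energy f {?l..?r} + 5 * Ka\<^sup>2 * (S (r + 2) - S r)"
      unfolding bdry f_def using r
      by (intro order_trans[OF truncation_estimate[OF bd]]) (auto intro!: eq)
    also have "energy f {?l..?r} \<le> \<phi>" unfolding \<phi>_def using r by (intro energy_mono) auto
    finally have "\<kappa>\<^sup>2 * S r \<le> 5 * \<phi> + 5 * Ka\<^sup>2 * (S (r + 2) - S r)" by simp
    then have "S r \<le> 5 / \<kappa>\<^sup>2 * \<phi> + c * (S (r + 2) - S r)"
      using \<kappa> by (simp add: c field_simps)
    moreover define A where "A = 5 / \<kappa>\<^sup>2 * \<phi>"
    ultimately have "(1 + c) * S r \<le> A + c * S (r + 2)" by (simp add: algebra_simps)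
    then have "S r \<le> (A + c * S (r + 2)) / (1 + c)" using c0 by (simp add: pos_le_divide_eq mult.commute)
    also have "\<dots> = A / (1 + c) + \<theta> * S (r + 2)" by (simp add: \<theta>_def add_divide_distrib)
    also have "A / (1 + c) \<le> A / 1"
      using c0 energy_nonneg[of f] \<kappa> by (intro divide_left_mono) (auto simp: A_def \<phi>_def)
    finally have "S r \<le> \<theta> * S (r + 2) + A" by simp
    then show ?thesis by (simp add: A_def)
  qed
  define A where "A = 5 / \<kappa>\<^sup>2 * \<phi>"
  have A: "A \<ge> 0" using energy_nonneg[of f] by (simp add: A_def \<phi>_def)
  have iter: "S 2 \<le> \<theta> ^ j * S (2 * j + 2) + A * (\<Sum>i<j. \<theta> ^ i)" if "j \<le> m" for j
    using that
  proof (induction j)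
    case (Suc j)
    have "\<theta> ^ j * S (2 * j + 2) \<le> \<theta> ^ j * (\<theta> * S (2 * j + 2 + 2) + A)"
      unfolding A_def using Suc.prems \<theta> by (intro mult_left_mono step) auto
    then have "S 2 \<le> \<theta> ^ j * (\<theta> * S (2 * j + 2 + 2) + A) + A * (\<Sum>i<j. \<theta> ^ i)"
      using Suc by simp
    then show ?case by (simp add: algebra_simps)
  qed (simp add: numeral_2_eq_2)
  have "(\<Sum>i<m. \<theta> ^ i) \<le> 1 + c"
  proof -
    have "(\<Sum>i<m. \<theta> ^ i) = (1 - \<theta> ^ m) / (1 - \<theta>)" using \<theta> by (simp add: sum_gp_strict)
    also have "\<dots> \<le> 1 / (1 - \<theta>)" using \<theta> by (intro divide_right_mono) auto
    also have "\<dots> = 1 + c" using c0 by (simp add: \<theta>_def field_simps)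
    finally show ?thesis .
  qed
  then have "A * (\<Sum>i<m. \<theta> ^ i) \<le> A * (1 + c)" using A by (intro mult_left_mono)
  with iter[of m] have "S 2 \<le> \<theta> ^ m * S (2 * m + 2) + A * (1 + c)" by simp
  also have "A * (1 + c) = 5 / \<kappa>\<^sup>2 * (1 + c) * \<phi>" by (simp only: A_def mult_ac)
  also have "S 2 = energy u {x - 2..x + 2}" by (simp add: S_def)
  finally show ?thesis unfolding S_def \<theta>_def \<phi>_def f_def .
qed

lemma sum_energy_cells:
  fixes x :: int and P :: nat
  shows "(\<Sum>k<n. energy u {x + int k * int P + 1..x + (int k + 1) * int P}) = energy u {x + 1..x + int n * int P}"
proof (induction n)
  case (Suc n)
  define y where "y = int n * int P"
  have "y \<ge> 0" by (simp add: y_def)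
  then have "{x + 1..x + (y + int P)} = {x + 1..x + y} \<union> {x + y + 1..x + (y + int P)}" by auto
  moreover have "int (Suc n) * int P = y + int P" "(int n + 1) * int P = y + int P"
    by (simp_all add: y_def algebra_simps)
  ultimately have "{x + 1..x + int (Suc n) * int P} = {x + 1..x + int n * int P} \<union> {x + int n * int P + 1..x + (int n + 1) * int P}"
    unfolding y_def by simp
  then have "energy u {x + 1..x + int (Suc n) * int P}
      = energy u {x + 1..x + int n * int P} + energy u {x + int n * int P + 1..x + (int n + 1) * int P}"
    by (simp only:) (rule energy_Un_disjoint, auto)
  with Suc show ?case by simp
qed (simp add: energy_def)

lemma jop_shift:
  assumes "bounded (range b)" "\<And>n. a (n + k) = a n" "\<And>n. b (n + k) = b n"
  shows "jop a b (shift k u) = shift k (jop a b u)"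
proof (rule ell2_eqI)
  fix n
  have "a (n + k - 1) = a (n - 1)" using assms(2)[of "n - 1"] by (simp add: algebra_simps)
  then show "coord (jop a b (shift k u)) n = coord (shift k (jop a b u)) n"
    using assms(2)[of n] assms(3)[of n]
    by (simp add: coord_shift coord_jop bounded_a assms jac_op_def algebra_simps)
qed

text \<open>If every restriction to a cell were a bad approximate eigenvector, then summing over all
  cells would bound \<open>u\<close> by \<open>(J - E) u\<close>: the cuts between the cells lie in the middle of
  regions where \<open>u\<close> decays.\<close>
lemma localized_approx_eigenvector:
  assumes bd: "bounded (range b)" "bounded (range b')" and \<kappa>: "\<kappa> > 0"
    and per: "\<And>n. a (n + int P) = a n" "\<And>n. b (n + int P) = b n" "\<And>n. b' (n + int P) = b' n"
    and gap: "\<And>w. norm (jop a b' w - E *\<^sub>R w) \<ge> \<kappa> * norm w"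
    and eq: "\<And>n. \<bar>n - x\<bar> \<le> int (2 * m + 2) \<Longrightarrow> b' n = b n"
    and mP: "2 * m + 2 < P"
    and c: "c = 5 * Ka\<^sup>2 / \<kappa>\<^sup>2"
    and \<rho>: "\<rho> > 0" "\<rho>\<^sup>2 = 80 * Ka\<^sup>2 * (c / (1 + c)) ^ m"
    and nb: "\<not> bounded_below (\<lambda>u. jop a b u - E *\<^sub>R u)"
  shows "\<exists>v\<in>span (span_basis x P). norm v = 1 \<and> norm (jop a b v - E *\<^sub>R v) \<le> \<rho>"
proof (rule ccontr)
  assume no: "\<not> ?thesis"
  define T where "T = (c / (1 + c)) ^ m"
  define C where "C = 5 / \<kappa>\<^sup>2 * (1 + c)"
  have \<rho>2: "\<rho>\<^sup>2 = 80 * Ka\<^sup>2 * T" by (simp add: \<rho>(2) T_def)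
  have c0: "c > 0" using Ka_pos \<kappa> by (simp add: c)
  have T: "T > 0" using c0 by (simp add: T_def)
  have C: "C \<ge> 0" using c0 by (simp add: C_def)
  define cell where "cell k = {x + k * int P + 1..x + (k + 1) * int P}" for k
  \<comment> \<open>By periodicity the normalized restriction can be moved to the cell spanned by
    \<open>span_basis x P\<close>, where the negated claim applies.\<close>
  have cells: "\<rho>\<^sup>2 * energy u (cell k) \<le> (norm (jop a b (restrict (cell k) u) - E *\<^sub>R restrict (cell k) u))\<^sup>2" for u k
  proof (cases "restrict (cell k) u = 0")
    case False
    define w where "w = restrict (cell k) u"
    define v where "v = shift (k * int P) ((1 / norm w) *\<^sub>R w)"
    have "v \<in> span (span_basis x P)"
      by (rule in_span_basis)
         (auto simp: v_def w_def coord_shift coord_scaleR coord_restrict cell_def algebra_simps)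
    moreover have "norm v = 1" using False by (simp add: v_def norm_shift w_def)
    ultimately have "norm (jop a b v - E *\<^sub>R v) > \<rho>" using no by (auto simp: not_le)
    also have "jop a b v - E *\<^sub>R v = (1 / norm w) *\<^sub>R shift (k * int P) (jop a b w - E *\<^sub>R w)"
    proof -
      interpret J: symmetric_operator "jop a b" by (rule symmetric_operator_jop[OF bounded_a bd(1)])
      have "jop a b v = shift (k * int P) (jop a b ((1 / norm w) *\<^sub>R w))" unfolding v_def
        by (rule jop_shift[OF bd(1)])
           (use periodic_mult[of a, OF per(1)] periodic_mult[of b, OF per(2)] in auto)
      then show ?thesis
        by (auto intro!: ell2_eqI simp: v_def J.scaleR coord_diff coord_add coord_scaleR coord_shift algebra_simps)
    qed
    finally have "\<rho> * norm w < norm (jop a b w - E *\<^sub>R w)"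
      using False by (simp add: norm_shift w_def field_simps)
    then have "(\<rho> * norm w)\<^sup>2 \<le> (norm (jop a b w - E *\<^sub>R w))\<^sup>2" using \<rho>(1) by (intro power_mono) auto
    then show ?thesis by (simp add: w_def power_mult_distrib norm_restrict cell_def)
  next
    case True
    then have "energy u (cell k) = 0" using norm_restrict[of "cell k" u] by (simp add: cell_def)
    then show ?thesis by simp
  qed
  \<comment> \<open>The window around the cut between the cells \<open>k - 1\<close> and
    \<open>k\<close>; \<open>2 * m + 2 < P\<close> confines it to these two cells.\<close>
  define W where "W k = {x + k * int P - int (2 * m + 2)..x + k * int P + int (2 * m + 2)}" for k
  have fin: "finite (cell k)" "finite (W k)" for k by (auto simp: cell_def W_def)
  have Wsub: "W k \<subseteq> cell (k - 1) \<union> cell k" for k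
    using mP by (auto simp: W_def cell_def algebra_simps)
  have Wle: "energy u (W k) \<le> energy u (cell (k - 1)) + energy u (cell k)" for u k
    by (rule order_trans[OF energy_mono[OF _ Wsub] energy_Un_le]) (auto simp: fin)
  have local: "\<rho>\<^sup>2 * energy u (cell k) \<le> 5 * energy (jop a b u - E *\<^sub>R u) (cell k)
      + 5 * Ka\<^sup>2 * (T * (energy u (cell (k - 1)) + 2 * energy u (cell k) + energy u (cell (k + 1)))
        + C * (energy (jop a b u - E *\<^sub>R u) (cell (k - 1)) + 2 * energy (jop a b u - E *\<^sub>R u) (cell k)
              + energy (jop a b u - E *\<^sub>R u) (cell (k + 1))))" for u k
  proof -
    define f where "f = jop a b u - E *\<^sub>R u"
    have dec: "energy u {x + j * int P - 2..x + j * int P + 2} \<le> T * (energy u (cell (j - 1)) + energy u (cell j))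
        + C * (energy f (cell (j - 1)) + energy f (cell j))" for j
    proof -
      have "energy u {x + j * int P - 2..x + j * int P + 2} \<le> T * energy u (W j) + C * energy f (W j)"
        unfolding T_def C_def W_def f_def
      proof (rule decay_in_gap[where x = "x + j * int P" and b' = b' and c = c and \<kappa> = \<kappa> and u = u
            and E = E and b = b and m = m, OF bd \<kappa> gap _ c])
        fix n assume "\<bar>n - (x + j * int P)\<bar> \<le> int (2 * m + 2)"
        moreover have "n + (- j) * int P - x = n - (x + j * int P)" by (simp add: algebra_simps)
        ultimately have "b' (n + (- j) * int P) = b (n + (- j) * int P)" by (intro eq) (simp only:)
        also have "b (n + (- j) * int P) = b n" by (rule periodic_mult) (rule per)
        also have "b' (n + (- j) * int P) = b' n" by (rule periodic_mult) (rule per)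
        finally show "b' n = b n" .
      qed
      also have "\<dots> \<le> T * (energy u (cell (j - 1)) + energy u (cell j)) + C * (energy f (cell (j - 1)) + energy f (cell j))"
        using T C by (intro add_mono mult_left_mono Wle) auto
      finally show ?thesis .
    qed
    have two: "(cmod (coord u (y)))\<^sup>2 + (cmod (coord u (y + 1)))\<^sup>2 \<le> energy u {y - 2..y + 2}" for y
      using energy_mono[of "{y - 2..y + 2}" "{y, y + 1}" u] by (simp add: energy_def)
    have "\<rho>\<^sup>2 * energy u (cell k) \<le> (norm (jop a b (restrict (cell k) u) - E *\<^sub>R restrict (cell k) u))\<^sup>2"
      by (rule cells)
    also have "\<dots> \<le> 5 * energy f (cell k) + 5 * Ka\<^sup>2 * ((cmod (coord u (x + k * int P + 1 - 1)))\<^sup>2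
      + (cmod (coord u (x + k * int P + 1)))\<^sup>2 + (cmod (coord u (x + (k + 1) * int P)))\<^sup>2 + (cmod (coord u (x + (k + 1) * int P + 1)))\<^sup>2)"
      unfolding cell_def f_def using mP by (intro truncation_estimate bd) (auto simp: algebra_simps)
    also have "\<dots> \<le> 5 * energy f (cell k) + 5 * Ka\<^sup>2 * (energy u {x + k * int P - 2..x + k * int P + 2}
        + energy u {x + (k + 1) * int P - 2..x + (k + 1) * int P + 2})"
      using two[of "x + k * int P"] two[of "x + (k + 1) * int P"]
      by (intro add_left_mono mult_left_mono) (simp_all add: add.assoc)
    also have "\<dots> \<le> 5 * energy f (cell k) + 5 * Ka\<^sup>2 * ((T * (energy u (cell (k - 1)) + energy u (cell k))
        + C * (energy f (cell (k - 1)) + energy f (cell k)))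
        + (T * (energy u (cell (k + 1 - 1)) + energy u (cell (k + 1))) + C * (energy f (cell (k + 1 - 1)) + energy f (cell (k + 1)))))"
      by (intro add_left_mono mult_left_mono add_mono dec) auto
    finally show ?thesis by (simp add: f_def algebra_simps)
  qed
  have total: "(\<Sum>k<n. energy u (cell (int k + j))) \<le> (norm u)\<^sup>2" for u n j
  proof -
    have "(\<Sum>k<n. energy u (cell (int k + j))) = energy u {x + j * int P + 1..x + j * int P + int n * int P}"
      using sum_energy_cells[of u "x + j * int P" P n] by (simp add: cell_def algebra_simps)
    then show ?thesis by (simp add: energy_le_norm)
  qed
  define K where "K = 5 + 20 * Ka\<^sup>2 * C"
  have K: "K > 0" using C by (simp add: K_def add_pos_nonneg)
  \<comment> \<open>Summed over cells, the two cuts of a cell charge four cell masses, hence 20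
    \<open>Ka\<^sup>2 * T\<close>. Half of \<open>\<rho>\<^sup>2\<close> is 40
    \<open>Ka\<^sup>2 * T\<close>, so 20 of it remain: this is the origin of the constant
    80.\<close>
  have main: "20 * Ka\<^sup>2 * T * (norm u)\<^sup>2 \<le> K * (norm (jop a b u - E *\<^sub>R u))\<^sup>2" for u
  proof (cases "u = 0")
    case False
    define f where "f = jop a b u - E *\<^sub>R u"
    obtain R where R: "R \<ge> 0" "\<And>A. finite A \<Longrightarrow> {-R..R} \<subseteq> A \<Longrightarrow> energy u A \<ge> (norm u)\<^sup>2 / 2"
      using energy_exhaustion[OF False] by blast
    \<comment> \<open>The cells from \<open>-N\<close> to \<open>N - 1\<close> then cover
      \<open>{-R..R}\<close>, since \<open>P\<close> is at least 1.\<close>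
    define N where "N = R + \<bar>x\<bar> + 1"
    define n where "n = nat (2 * N)"
    define s where "s v j = (\<Sum>k<n. energy v (cell (int k + j)))" for v j
    have N: "N > 0" using R(1) by (simp add: N_def)
    have P1: "int P \<ge> 1" using mP by simp
    have e1: "(\<Sum>k<n. energy v (cell (int k + (- N)))) = energy v {x - N * int P + 1..x + N * int P}" for v
    proof -
      have "(\<Sum>k<n. energy v (cell (int k + (- N)))) = energy v {x - N * int P + 1..x - N * int P + int n * int P}"
        using sum_energy_cells[of v "x - N * int P" P n] by (simp add: cell_def algebra_simps)
      moreover have "x - N * int P + int n * int P = x + N * int P" using N by (simp add: n_def algebra_simps)
      ultimately show ?thesis by simp
    qed
    have "N * int P \<ge> N * 1" using N P1 by (intro mult_left_mono) auto
    then have "x - N * int P + 1 \<le> - R" "R \<le> x + N * int P" using N_def by linarith+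
    then have "(norm u)\<^sup>2 / 2 \<le> (\<Sum>k<n. energy u (cell (int k + (- N))))"
      unfolding e1 by (intro R(2)) auto
    then have "\<rho>\<^sup>2 * ((norm u)\<^sup>2 / 2) \<le> \<rho>\<^sup>2 * (\<Sum>k<n. energy u (cell (int k + (- N))))"
      by (intro mult_left_mono) auto
    also have "\<dots> = (\<Sum>k<n. \<rho>\<^sup>2 * energy u (cell (int k + (- N))))" by (rule sum_distrib_left)
    also have "\<dots> \<le> (\<Sum>k<n. 5 * energy f (cell (int k + (- N)))
      + 5 * Ka\<^sup>2 * (T * (energy u (cell (int k + (- N - 1))) + 2 * energy u (cell (int k + (- N))) + energy u (cell (int k + (- N + 1))))
        + C * (energy f (cell (int k + (- N - 1))) + 2 * energy f (cell (int k + (- N))) + energy f (cell (int k + (- N + 1))))))"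
    proof (rule sum_mono)
      fix k
      have e: "int k + (- N) - 1 = int k + (- N - 1)" "int k + (- N) + 1 = int k + (- N + 1)" by simp_all
      show "\<rho>\<^sup>2 * energy u (cell (int k + (- N))) \<le> 5 * energy f (cell (int k + (- N)))
      + 5 * Ka\<^sup>2 * (T * (energy u (cell (int k + (- N - 1))) + 2 * energy u (cell (int k + (- N))) + energy u (cell (int k + (- N + 1))))
        + C * (energy f (cell (int k + (- N - 1))) + 2 * energy f (cell (int k + (- N))) + energy f (cell (int k + (- N + 1)))))"
        using local[of u "int k + (- N)"] unfolding f_def e .
    qed
    also have "\<dots> = 5 * s f (- N) + 5 * Ka\<^sup>2 * (T * (s u (- N - 1) + 2 * s u (- N) + s u (- N + 1))
        + C * (s f (- N - 1) + 2 * s f (- N) + s f (- N + 1)))"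
      by (simp only: s_def sum.distrib sum_distrib_left[symmetric])
    also have "\<dots> \<le> 5 * (norm f)\<^sup>2 + 5 * Ka\<^sup>2 * (T * (4 * (norm u)\<^sup>2) + C * (4 * (norm f)\<^sup>2))"
    proof -
      have s: "s v j \<le> (norm v)\<^sup>2" for v j unfolding s_def by (rule total)
      have four: "s v (- N - 1) + 2 * s v (- N) + s v (- N + 1) \<le> 4 * (norm v)\<^sup>2" for v
        using s[of v "- N - 1"] s[of v "- N"] s[of v "- N + 1"] by linarith
      have "T * (s u (- N - 1) + 2 * s u (- N) + s u (- N + 1)) \<le> T * (4 * (norm u)\<^sup>2)"
        using T four by (intro mult_left_mono) auto
      moreover have "C * (s f (- N - 1) + 2 * s f (- N) + s f (- N + 1)) \<le> C * (4 * (norm f)\<^sup>2)"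
        using C four by (intro mult_left_mono) auto
      ultimately have "5 * Ka\<^sup>2 * (T * (s u (- N - 1) + 2 * s u (- N) + s u (- N + 1))
          + C * (s f (- N - 1) + 2 * s f (- N) + s f (- N + 1)))
          \<le> 5 * Ka\<^sup>2 * (T * (4 * (norm u)\<^sup>2) + C * (4 * (norm f)\<^sup>2))"
        by (rule mult_left_mono[OF add_mono]) auto
      then show ?thesis using s[of f "- N"] by linarith
    qed
    finally have "40 * Ka\<^sup>2 * T * (norm u)\<^sup>2 \<le> K * (norm f)\<^sup>2 + 20 * Ka\<^sup>2 * T * (norm u)\<^sup>2"
      unfolding \<rho>2 K_def by (simp add: algebra_simps)
    then show ?thesis unfolding f_def by linarith
  qed (use K in simp)
  define d where "d = 20 * Ka\<^sup>2 * T / K"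
  have d: "d > 0" unfolding d_def using Ka_pos T K by (intro divide_pos_pos mult_pos_pos) auto
  have "bounded_below (\<lambda>u. jop a b u - E *\<^sub>R u)"
  proof (rule bounded_belowI)
    show "sqrt d > 0" using d by simp
    show "sqrt d * norm u \<le> norm (jop a b u - E *\<^sub>R u)" for u
    proof (rule power2_le_imp_le)
      have "(sqrt d * norm u)\<^sup>2 = 20 * Ka\<^sup>2 * T * (norm u)\<^sup>2 / K"
        using d by (simp add: power_mult_distrib) (simp add: d_def)
      also have "\<dots> \<le> (norm (jop a b u - E *\<^sub>R u))\<^sup>2"
        using main[of u] K by (simp add: pos_divide_le_eq mult.commute)
      finally show "(sqrt d * norm u)\<^sup>2 \<le> (norm (jop a b u - E *\<^sub>R u))\<^sup>2" .
    qed simp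
  qed
  with nb show False by simp
qed

end

section \<open>Periodic operators with thin spectrum\<close>

definition has_period :: "nat \<Rightarrow> (int \<Rightarrow> 'a) \<Rightarrow> bool" where
  "has_period p f \<longleftrightarrow> (\<forall>n. f (n + int p) = f n)"

lemma has_periodD: "has_period p f \<Longrightarrow> f (n + int p) = f n"
  by (simp add: has_period_def)

lemma has_period_mult: "has_period p f \<Longrightarrow> f (n + k * int p) = f n"
  by (rule periodic_mult) (rule has_periodD)

lemma has_period_dvd:
  assumes "has_period p f" "p dvd q"
  shows "has_period q f"
proof -
  obtain k where "q = p * k" using assms(2) by blast
  then show ?thesis
    using has_period_mult[OF assms(1), of _ "int k"] by (simp add: has_period_def mult.commute)
qed

lemma has_period_bounded:
  fixes f :: "int \<Rightarrow> real"
  assumes p: "p > 0" and per: "has_period p f"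
  shows "bounded (range f)"
proof -
  have "f n \<in> f ` {0..<int p}" for n
  proof -
    have "f n = f (n mod int p + (n div int p) * int p)" by simp
    also have "\<dots> = f (n mod int p)" by (rule has_period_mult[OF per])
    finally show ?thesis using p by auto
  qed
  then have "range f \<subseteq> f ` {0..<int p}" by blast
  then show ?thesis by (rule bounded_subset[rotated]) (simp add: finite_imp_bounded)
qed

text \<open>Used to choose the block length \<open>j\<close>: the number of covering intervals is
  linear in \<open>j\<close> and their radius of order j exp(-s j), so the radius beats every fixed
  power of the number.\<close>

lemma tendsto_power_times_geometric:
  fixes A B s :: real
  assumes "A > 0" "B > 0" "s > 0"
  shows "(\<lambda>j::nat. (A * (real j + 2)) ^ k * (B * (real j + 2) * exp (- s * real j))) \<longlonglongrightarrow> 0"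
proof -
  have "(\<lambda>j::nat. (A * (real j + 2)) powr real k * (B * (real j + 2) * exp (- s * real j))) \<longlonglongrightarrow> 0"
    using assms by real_asymp
  moreover have "(A * (real j + 2)) powr real k = (A * (real j + 2)) ^ k" for j
    using assms by (intro powr_realpow) (auto intro: mult_pos_pos)
  ultimately show ?thesis by simp
qed

text \<open>The logarithmic inequality bounds the box-counting quotient at scale \<open>r\<close> by \<open>1 / (k + 1)\<close>.\<close>
definition covered :: "(int \<Rightarrow> real) \<Rightarrow> (int \<Rightarrow> real) \<Rightarrow> nat \<Rightarrow> bool" where
  "covered a b k \<longleftrightarrow> (\<exists>F r. finite F \<and> F \<noteq> {} \<and> 0 < r \<and> r \<le> 1 / (real k + 2) \<and>
     (real k + 1) * ln (real (card F)) \<le> ln (1 / r) \<and>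
     (\<forall>E. (\<forall>c\<in>F. \<bar>E - c\<bar> > r) \<longrightarrow> bounded_below (\<lambda>u. jop a b u - E *\<^sub>R u)))"

text \<open>A form of Gordon's three-block estimate that is stable under small perturbations of \<open>b\<close>. Coordinates
  of a vector in \<open>\<ell>\<^sup>2\<close> tend to 0, so the estimate for all \<open>k\<close> excludes eigenvectors.\<close>
definition gordon :: "(int \<Rightarrow> real) \<Rightarrow> (int \<Rightarrow> real) \<Rightarrow> nat \<Rightarrow> bool" where
  "gordon a b k \<longleftrightarrow> (\<exists>P::int. P \<ge> int k \<and> (\<forall>E u n. \<bar>E\<bar> \<le> real k \<longrightarrow> norm u \<le> 1 \<longrightarrow> jop a b u = E *\<^sub>R u \<longrightarrow>
     cmod (coord u n) \<le> cmod (coord u (n + P)) + cmod (coord u (n - P)) + cmod (coord u (n + 2 * P))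
       + 1 / (real k + 1)))"

context offdiagonal
begin

section \<open>Lower bounds and their stability\<close>

lemma bounded_below_outside:
  assumes Kb: "\<And>n. \<bar>b n\<bar> \<le> Kb" and E: "\<bar>E\<bar> > 2 * Ka + Kb"
  shows "bounded_below (\<lambda>u. jop a b u - E *\<^sub>R u)"
proof (rule bounded_belowI)
  show "\<bar>E\<bar> - (2 * Ka + Kb) > 0" using E by simp
  fix u
  have z: "jop (\<lambda>_. 0) (\<lambda>_. 0) u = 0"
    by (rule ell2_eqI) (simp add: coord_jop jac_op_def coord_zero)
  have "norm (jop a b u) \<le> (2 * Ka + Kb) * norm u"
    using norm_jop_diff_le[of a b "\<lambda>_. 0" "\<lambda>_. 0" Ka Kb u] bounded_a bounded_rangeI_real[of b Kb, OF Kb]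
      abs_a_le Kb by (simp add: z)
  moreover have "norm (E *\<^sub>R u) - norm (jop a b u) \<le> norm (jop a b u - E *\<^sub>R u)"
    by (metis norm_minus_commute norm_triangle_ineq2)
  ultimately show "(\<bar>E\<bar> - (2 * Ka + Kb)) * norm u \<le> norm (jop a b u - E *\<^sub>R u)"
    by (simp add: algebra_simps)
qed

lemma norm_jop_perturb:
  assumes "bounded (range b)" "\<And>n. \<bar>b' n - b n\<bar> \<le> \<delta>"
  shows "norm (jop a b' u - jop a b u) \<le> \<delta> * norm u"
  using norm_jop_diff_le[of a b' a b 0 \<delta> u] bounded_a assms bounded_range_close[OF assms] by simp

lemma gap_perturb:
  assumes "bounded (range b)" "\<And>n. \<bar>b' n - b n\<bar> \<le> \<delta>"
    and gap: "norm (jop a b u - E *\<^sub>R u) \<ge> \<kappa> * norm u"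
  shows "norm (jop a b' u - E' *\<^sub>R u) \<ge> (\<kappa> - \<delta> - \<bar>E' - E\<bar>) * norm u"
proof -
  have "jop a b u - E *\<^sub>R u = (jop a b' u - E' *\<^sub>R u) - (jop a b' u - jop a b u) + (E' - E) *\<^sub>R u"
    by (simp add: algebra_simps)
  then have "norm (jop a b u - E *\<^sub>R u) \<le> norm (jop a b' u - E' *\<^sub>R u) + norm (jop a b' u - jop a b u)
      + norm ((E' - E) *\<^sub>R u)"
    by (metis (no_types, lifting) norm_triangle_mono norm_triangle_ineq4 order_refl)
  then have "\<kappa> * norm u \<le> norm (jop a b' u - E' *\<^sub>R u) + \<delta> * norm u + \<bar>E' - E\<bar> * norm u"
    using norm_jop_perturb[OF assms(1,2), of u] gap unfolding norm_scaleR by linarith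
  then show ?thesis by (simp add: left_diff_distrib)
qed

text \<open>A lower bound \<open>\<kappa> E\<close> at \<open>E\<close> leaves half of itself on the
  ball of radius \<open>\<kappa> E / 2\<close>. A finite subcover then yields a uniform constant,
  and the product of the periods is a common period.\<close>

lemma gap_family:
  assumes p: "p > 0" and per: "has_period p a" "has_period p b" and \<epsilon>: "\<epsilon> > 0" and R: "R \<ge> 0"
  shows "\<exists>m bs q \<kappa>. m > 0 \<and> q > 0 \<and> \<kappa> > 0 \<and> has_period q a \<and>
    (\<forall>i<m. has_period q (bs i) \<and> (\<forall>n. \<bar>bs i n - b n\<bar> \<le> \<epsilon>)) \<and>
    (\<forall>E. \<bar>E\<bar> \<le> R \<longrightarrow> (\<exists>i<(m::nat). \<forall>w. norm (jop a (bs i) w - E *\<^sub>R w) \<ge> \<kappa> * norm w))"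
proof -
  have bb: "bounded (range b)" using has_period_bounded[OF p per(2)] .
  have "\<exists>b' P \<kappa>. P > 0 \<and> has_period P a \<and> has_period P b' \<and>
    (\<forall>n. \<bar>b' n - b n\<bar> \<le> \<epsilon>) \<and> \<kappa> > 0 \<and> (\<forall>u. norm (jop a b' u - E *\<^sub>R u) \<ge> \<kappa> * norm u)" for E
    using gap_opening[of \<alpha> a b p \<epsilon> E, OF \<alpha> bounded_a bb p has_periodD[OF per(1)] has_periodD[OF per(2)] \<epsilon>]
    unfolding bounded_below_def has_period_def by blast
  then obtain b' P \<kappa> where h: "\<And>E. P E > 0" "\<And>E. has_period (P E) a"
    "\<And>E. has_period (P E) (b' E)" "\<And>E n. \<bar>b' E n - b n\<bar> \<le> \<epsilon>" "\<And>E. \<kappa> E > 0"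
    "\<And>E u. norm (jop a (b' E) u - E *\<^sub>R u) \<ge> \<kappa> E * norm u" by metis
  have "\<exists>D \<subseteq> {-R..R}. finite D \<and> {-R..R} \<subseteq> (\<Union>E\<in>D. ball E (\<kappa> E / 2))"
  proof (rule compactE_image[of "{-R..R}" "{-R..R}" "\<lambda>E. ball E (\<kappa> E / 2)"])
    show "{-R..R} \<subseteq> (\<Union>E\<in>{-R..R}. ball E (\<kappa> E / 2))" using h(5) by force
  qed auto
  then obtain D where D: "finite D" "{-R..R} \<subseteq> (\<Union>E\<in>D. ball E (\<kappa> E / 2))" by blast
  have Dne: "D \<noteq> {}" using D(2) R by force
  obtain g where g: "bij_betw g {0..<card D} D" using ex_bij_betw_nat_finite[OF D(1)] by blast
  define q where "q = (\<Prod>E\<in>D. P E)"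
  define \<kappa>0 where "\<kappa>0 = Min ((\<lambda>E. \<kappa> E / 2) ` D)"
  have gD: "g i \<in> D" if "i < card D" for i using g that by (auto simp: bij_betw_def)
  have dvd: "P E dvd q" if "E \<in> D" for E unfolding q_def using D(1) that by (rule dvd_prodI)
  have k0: "\<kappa>0 > 0" unfolding \<kappa>0_def using D(1) Dne h(5) by (subst Min_gr_iff) auto
  have k0le: "\<kappa>0 \<le> \<kappa> E / 2" if "E \<in> D" for E unfolding \<kappa>0_def using D(1) that by (intro Min_le) auto
  have q0: "q > 0" unfolding q_def using h(1) by (intro prod_pos) auto
  have gap: "\<exists>i<card D. \<forall>w. norm (jop a (b' (g i)) w - E *\<^sub>R w) \<ge> \<kappa>0 * norm w" if E: "\<bar>E\<bar> \<le> R" for E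
  proof -
    have "E \<in> {-R..R}" using E by auto
    then obtain E0 where E0: "E0 \<in> D" "dist E0 E < \<kappa> E0 / 2" using D(2) by fastforce
    obtain i where i: "i < card D" "g i = E0" using g E0(1) by (force simp: bij_betw_def)
    have bE: "bounded (range (b' E0))" using has_period_bounded[OF h(1) h(3)] .
    have "norm (jop a (b' E0) w - E *\<^sub>R w) \<ge> \<kappa>0 * norm w" for w
    proof -
      have "(\<kappa> E0 - 0 - \<bar>E - E0\<bar>) * norm w \<le> norm (jop a (b' E0) w - E *\<^sub>R w)"
        by (rule gap_perturb[OF bE _ h(6)]) simp
      moreover have "\<kappa>0 * norm w \<le> (\<kappa> E0 - 0 - \<bar>E - E0\<bar>) * norm w"
        using k0le[OF E0(1)] E0(2) by (intro mult_right_mono) (auto simp: dist_real_def abs_minus_commute)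
      ultimately show ?thesis by linarith
    qed
    with i show ?thesis by blast
  qed
  obtain E1 where E1: "E1 \<in> D" using Dne by blast
  show ?thesis
  proof (rule exI[of _ "card D"], rule exI[of _ "\<lambda>i. b' (g i)"], rule exI[of _ q], rule exI[of _ \<kappa>0],
      intro conjI allI impI)
    show "has_period q a" by (rule has_period_dvd[OF h(2) dvd[OF E1]])
    show "has_period q (b' (g i))" if "i < card D" for i
      by (rule has_period_dvd[OF h(3) dvd[OF gD[OF that]]])
  qed (use D Dne q0 k0 h gap in \<open>auto simp: card_gt_0_iff\<close>)
qed

text \<open>Each energy lies in a spectral gap of one of the blocks; cutting in the middle of that block
  localizes approximate eigenvectors to a single period, up to an exponentially small error.\<close>
lemma concatenation_cover:
  assumes m: "m > 0" and q: "q > 0" and \<kappa>: "\<kappa> > 0" and pera: "has_period q a"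
    and pers: "\<And>i. i < m \<Longrightarrow> has_period q (bs i)"
    and gap: "\<And>E. \<bar>E\<bar> \<le> R \<Longrightarrow> \<exists>i<(m::nat). \<forall>w. norm (jop a (bs i) w - E *\<^sub>R w) \<ge> \<kappa> * norm w"
    and c: "c = 5 * Ka\<^sup>2 / \<kappa>\<^sup>2"
  shows "\<exists>b' P. P = m * ((4 * j + 8) * q) \<and> has_period P a \<and> has_period P b' \<and>
    (\<forall>n. \<exists>i<m. b' n = bs i n) \<and>
    (\<exists>F. finite F \<and> F \<noteq> {} \<and> card F \<le> 3 * m * P \<and> (\<forall>E. \<bar>E\<bar> \<le> R \<longrightarrow> \<not> bounded_below (\<lambda>u. jop a b' u - E *\<^sub>R u) \<longrightarrow>
      (\<exists>x\<in>F. \<bar>E - x\<bar> \<le> 16 * sqrt (80 * Ka\<^sup>2 * (c / (1 + c)) ^ j) * real P)))"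
proof -
  define L where "L = (4 * j + 8) * q"
  define P where "P = m * L"
  have L: "L \<ge> 4 * j + 8" "L > 0" using q by (auto simp: L_def)
  have P: "P \<ge> L" "P > 0" using m L by (auto simp: P_def)
  define idx where "idx n = nat ((n mod int P) div int L)" for n
  \<comment> \<open>Each \<open>bs i\<close> is read at the absolute position \<open>n\<close>, not
    restarted in its block; this keeps \<open>b'\<close> as close to \<open>b\<close> as the
    \<open>bs i\<close> are, and \<open>q dvd P\<close> makes it periodic.\<close>
  define b' where "b' n = bs (idx n) n" for n
  have idx_lt: "idx n < m" for n
  proof -
    have "n mod int P < int P" using P(2) by simp
    also have "int P = int m * int L" by (simp add: P_def)
    finally have "n mod int P < int m * int L" .
    moreover have "(n mod int P) div int L * int L \<le> n mod int P"
      using pos_mod_sign[of "int L" "n mod int P"] L(2) by (simp add: minus_mod_eq_div_mult[symmetric])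
    ultimately have "(n mod int P) div int L * int L < int m * int L" by linarith
    then have "(n mod int P) div int L < int m" by (simp add: mult_less_cancel_right)
    then show ?thesis using m by (simp add: idx_def nat_less_iff)
  qed
  have "q dvd P" by (simp add: P_def L_def)
  then have perP: "has_period P a" "i < m \<Longrightarrow> has_period P (bs i)" for i
    using has_period_dvd pera pers by blast+
  have perb': "has_period P b'"
    using has_periodD[OF perP(2)[OF idx_lt]] by (simp add: has_period_def b'_def idx_def)
  have bb': "bounded (range b')" by (rule has_period_bounded[OF P(2) perb'])
  \<comment> \<open>The window of radius \<open>2 * j + 2\<close> about \<open>ce i\<close> occupies
    the sites \<open>i * L + 1\<close> to \<open>i * L + 4 * j + 5\<close>, inside block
    \<open>i\<close> because \<open>L \<ge> 4 * j + 8\<close>.\<close>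
  define ce where "ce i = int i * int L + int (2 * j + 3)" for i
  have block: "bs i n = b' n" if i: "i < m" and n: "\<bar>n - ce i\<bar> \<le> int (2 * j + 2)" for i n
  proof -
    have lo: "int i * int L \<le> n" using n by (simp add: ce_def)
    have hi: "n < (int i + 1) * int L" using n L(1) by (simp add: ce_def algebra_simps)
    have "(int i + 1) * int L \<le> int m * int L" using i by (intro mult_right_mono) auto
    with hi have "n < int P" by (simp add: P_def)
    moreover have "0 \<le> n" using lo by (meson of_nat_0_le_iff mult_nonneg_nonneg order_trans)
    ultimately have nm: "n mod int P = n" by (intro mod_pos_pos_trivial)
    have "n div int L = int i"
      by (rule int_div_pos_eq[of n "int L" "int i" "n - int i * int L"])
         (use lo hi in \<open>auto simp: algebra_simps\<close>)
    then show ?thesis by (simp add: b'_def idx_def nm)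
  qed
  have c0: "c > 0" using Ka_pos \<kappa> by (simp add: c)
  define \<rho> where "\<rho> = sqrt (80 * Ka\<^sup>2 * (c / (1 + c)) ^ j)"
  have arg: "80 * Ka\<^sup>2 * (c / (1 + c)) ^ j > 0" using Ka_pos c0 by (intro mult_pos_pos zero_less_power) auto
  have \<rho>: "\<rho> > 0" "\<rho>\<^sup>2 = 80 * Ka\<^sup>2 * (c / (1 + c)) ^ j" using arg by (auto simp: \<rho>_def)
  define X where "X i = {E. (\<forall>w. norm (jop a (bs i) w - E *\<^sub>R w) \<ge> \<kappa> * norm w) \<and>
      \<not> bounded_below (\<lambda>u. jop a b' u - E *\<^sub>R u)}" for i
  have "\<exists>F. finite F \<and> card F \<le> 2 * P \<and> (\<forall>E\<in>X i. \<exists>x\<in>F. \<bar>E - x\<bar> \<le> 16 * \<rho> * real P)" if i: "i < m" for i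
  proof -
    let ?B = "span_basis (ce i) P"
    interpret J: symmetric_operator "jop a b'" by (rule symmetric_operator_jop[OF bounded_a bb'])
    have bbi: "bounded (range (bs i))" using has_period_bounded[OF q pers[OF i]] .
    have "?B \<noteq> {}" using P(2) by (auto simp: span_basis_def)
    then have N: "card ?B > 0" using card_span_basis(1) by (simp add: card_gt_0_iff)
    have "\<exists>F. finite F \<and> card F \<le> card ?B \<and> (\<forall>E\<in>X i. \<exists>x\<in>F. \<bar>E - x\<bar> \<le> 8 * \<rho> * real (card ?B))"
    proof (rule J.cover_approx_eigenvalues[OF card_span_basis(1) refl N \<rho>(1)])
      fix E assume "E \<in> X i"
      then have E: "\<And>w. norm (jop a (bs i) w - E *\<^sub>R w) \<ge> \<kappa> * norm w"
        "\<not> bounded_below (\<lambda>u. jop a b' u - E *\<^sub>R u)" by (auto simp: X_def)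
      have "2 * j + 2 < P" using P L by linarith
      then show "\<exists>v\<in>span ?B. norm v = 1 \<and> norm (jop a b' v - E *\<^sub>R v) \<le> \<rho>"
        by (intro localized_approx_eigenvector[of b' "bs i" \<kappa> P E "ce i" j c \<rho>] bb' bbi \<kappa> E block c \<rho>
            has_periodD[OF perP(1)] has_periodD[OF perb'] has_periodD[OF perP(2)[OF i]] i)
    qed
    then obtain F where F: "finite F" "card F \<le> card ?B" "\<And>E. E \<in> X i \<Longrightarrow> \<exists>x\<in>F. \<bar>E - x\<bar> \<le> 8 * \<rho> * real (card ?B)"
      by blast
    have "card ?B \<le> 2 * P" by (rule card_span_basis)
    then have "8 * \<rho> * real (card ?B) \<le> 8 * \<rho> * real (2 * P)" using \<rho>(1) by (intro mult_left_mono) auto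
    with F \<open>card ?B \<le> 2 * P\<close> show ?thesis by (intro exI[of _ F]) force
  qed
  then obtain G where G: "\<And>i. i < m \<Longrightarrow> finite (G i)" "\<And>i. i < m \<Longrightarrow> card (G i) \<le> 2 * P"
    "\<And>i E. i < m \<Longrightarrow> E \<in> X i \<Longrightarrow> \<exists>x\<in>G i. \<bar>E - x\<bar> \<le> 16 * \<rho> * real P" by metis
  \<comment> \<open>Inserting 0 makes \<open>F\<close> nonempty; the extra point is paid for by
    passing from \<open>2 * m * P\<close> to \<open>3 * m * P\<close>.\<close>
  define F where "F = insert 0 (\<Union>i<m. G i)"
  have finF: "finite F" using G(1) by (auto simp: F_def)
  have "card (\<Union>i<m. G i) \<le> (\<Sum>i<m. card (G i))" by (rule card_UN_le) simp
  also have "\<dots> \<le> (\<Sum>i<m. 2 * P)" using G(2) by (intro sum_mono) auto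
  finally have "card (\<Union>i<m. G i) \<le> 2 * m * P" by simp
  then have "card F \<le> 1 + 2 * m * P"
    unfolding F_def using G(1) by (simp add: card_insert_if)
  moreover have "m * P \<ge> 1" using m P by simp
  moreover have "3 * m * P = 2 * m * P + m * P" by (simp add: algebra_simps)
  ultimately have cardF: "card F \<le> 3 * m * P" by linarith
  have cov: "\<exists>x\<in>F. \<bar>E - x\<bar> \<le> 16 * \<rho> * real P"
    if E: "\<bar>E\<bar> \<le> R" and nb: "\<not> bounded_below (\<lambda>u. jop a b' u - E *\<^sub>R u)" for E
  proof -
    obtain i where "i < m" "E \<in> X i" using gap[OF E] nb by (auto simp: X_def)
    then show ?thesis using G(3) by (fastforce simp: F_def)
  qed
  show ?thesis
    using perP(1) perb' idx_lt finF cardF cov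
    by (intro exI[of _ b'] exI[of _ P] conjI exI[of _ F]) (auto simp: P_def L_def b'_def F_def \<rho>_def)
qed

text \<open>An eigenvector for \<open>b'\<close> solves the equation for \<open>b\<close> up to
  residuals of size \<open>\<delta>\<close>, so the recurrence over periods holds with a small
  error. If the trace has modulus at least 1, the recurrence centred at \<open>n\<close> is solved
  for the coordinate at \<open>n\<close>; otherwise the one centred at \<open>n + Q\<close>
  is.\<close>

lemma gordon_near_periodic:
  assumes P: "P > 0" and per: "has_period P a" "has_period P b"
  shows "\<exists>\<delta>>0. \<forall>b'. (\<forall>n. \<bar>b' n - b n\<bar> \<le> \<delta>) \<longrightarrow> gordon a b' k"
proof -
  \<comment> \<open>A multiple of the period that is at least \<open>k\<close>, so that the compared
    coordinates move off to infinity with \<open>k\<close>.\<close>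
  define Q where "Q = P * (k + 1)"
  have "P dvd Q" by (simp add: Q_def)
  then have perQ: "has_period Q a" "has_period Q b" using has_period_dvd per by blast+
  have Qk: "int Q \<ge> int k"
  proof -
    have "k \<le> 1 * (k + 1)" by simp
    also have "\<dots> \<le> P * (k + 1)" using P by (intro mult_right_mono) auto
    finally have "k \<le> Q" by (simp add: Q_def)
    then show ?thesis by simp
  qed
  have bb: "bounded (range b)" by (rule has_period_bounded[OF P per(2)])
  obtain C where C: "C \<ge> 0" "\<And>E u n. \<bar>E\<bar> \<le> real k \<Longrightarrow>
    cmod (u (n + int Q) - of_real (mat2_trace (transfer_prod a b E 0 Q)) * u n + u (n - int Q))
      \<le> C * ((\<Sum>i<Q. cmod (residual a b E u (n + int i)))
            + (\<Sum>i<Q. cmod (residual a b E u (n - int Q + int i))))"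
    using monodromy_recurrence[of \<alpha> a b Q "real k", OF \<alpha> bounded_a bb has_periodD[OF perQ(1)] has_periodD[OF perQ(2)]]
    by blast
  \<comment> \<open>There are 2 Q residuals of size at most \<open>\<delta>\<close>, weighted by
    \<open>C\<close>; this choice keeps their total below 1 / (k + 1), also when
    \<open>C = 0\<close>.\<close>
  define \<delta> where "\<delta> = 1 / ((real k + 1) * (2 * C * real Q + 1))"
  have pos: "2 * C * real Q + 1 > 0" using C(1) by (simp add: add_nonneg_pos)
  have \<delta>: "\<delta> > 0" using pos by (simp add: \<delta>_def)
  have small: "C * (real Q * \<delta> + real Q * \<delta>) \<le> 1 / (real k + 1)"
  proof -
    have "C * (real Q * \<delta> + real Q * \<delta>) = (2 * C * real Q) * \<delta>" by (simp add: algebra_simps)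
    also have "\<dots> \<le> (2 * C * real Q + 1) * \<delta>" using \<delta> by (intro mult_right_mono) auto
    also have "\<dots> = 1 / (real k + 1)" using pos by (simp add: \<delta>_def)
    finally show ?thesis .
  qed
  have "gordon a b' k" if b': "\<And>n. \<bar>b' n - b n\<bar> \<le> \<delta>" for b'
    unfolding gordon_def
  proof (intro exI[of _ "int Q"] conjI allI impI Qk)
    fix E u n
    assume E: "\<bar>E\<bar> \<le> real k" and u: "norm u \<le> 1" and ev: "jop a b' u = E *\<^sub>R u"
    have bb': "bounded (range b')" by (rule bounded_range_close[OF bb b'])
    have res: "cmod (residual a b E (coord u) i) \<le> \<delta>" for i
    proof -
      have "residual a b E (coord u) i = coord (jop a b u - jop a b' u) i"
        unfolding ev coord_residual[OF bounded_a bb, symmetric] ..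
      also have "\<dots> = of_real (b i - b' i) * coord u i"
        by (simp add: coord_diff coord_jop bounded_a bb bb' jac_op_def algebra_simps)
      also have "cmod \<dots> \<le> \<delta> * 1"
        unfolding norm_mult norm_of_real using b'[of i] \<delta> order_trans[OF cmod_coord_le u, of i]
        by (intro mult_mono) (auto simp: abs_minus_commute)
      finally show ?thesis by simp
    qed
    define D where "D = mat2_trace (transfer_prod a b E 0 Q)"
    have rec: "cmod (coord u (y + int Q) - of_real D * coord u y + coord u (y - int Q)) \<le> 1 / (real k + 1)" for y
    proof -
      have s: "(\<Sum>i<Q. cmod (residual a b E (coord u) (z + int i))) \<le> real Q * \<delta>" for z
        using sum_mono[of "{..<Q}" "\<lambda>i. cmod (residual a b E (coord u) (z + int i))" "\<lambda>_. \<delta>"] res by simp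
      show ?thesis unfolding D_def
        by (rule order_trans[OF C(2)[OF E] order_trans[OF mult_left_mono small]])
           (rule add_mono[OF s s], rule C(1))
    qed
    show "cmod (coord u n) \<le> cmod (coord u (n + int Q)) + cmod (coord u (n - int Q)) + cmod (coord u (n + 2 * int Q)) + 1 / (real k + 1)"
    proof (cases "\<bar>D\<bar> \<ge> 1")
      case True
      have "cmod (coord u n) \<le> \<bar>D\<bar> * cmod (coord u n)" using mult_right_mono[OF True, of "cmod (coord u n)"] by simp
      also have "\<dots> = cmod (of_real D * coord u n)" by (simp add: norm_mult)
      also have "of_real D * coord u n = coord u (n + int Q) + coord u (n - int Q)
          - (coord u (n + int Q) - of_real D * coord u n + coord u (n - int Q))" by simp
      also have "cmod \<dots> \<le> cmod (coord u (n + int Q)) + cmod (coord u (n - int Q))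
          + cmod (coord u (n + int Q) - of_real D * coord u n + coord u (n - int Q))"
        by (rule order_trans[OF norm_triangle_ineq4 add_right_mono[OF norm_triangle_ineq]])
      also have "\<dots> \<le> cmod (coord u (n + int Q)) + cmod (coord u (n - int Q)) + 1 / (real k + 1)"
        using rec by (rule add_left_mono)
      finally show ?thesis using norm_ge_zero[of "coord u (n + 2 * int Q)"] by linarith
    next
      case False
      define z where "z = coord u (n + int Q + int Q) - of_real D * coord u (n + int Q) + coord u (n + int Q - int Q)"
      have "coord u n = z + of_real D * coord u (n + int Q) - coord u (n + 2 * int Q)"
        by (simp add: z_def algebra_simps)
      then have "cmod (coord u n) \<le> cmod z + cmod (of_real D * coord u (n + int Q)) + cmod (coord u (n + 2 * int Q))"
        by (metis norm_triangle_ineq4 norm_triangle_ineq add_right_mono order_trans)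
      also have "cmod z \<le> 1 / (real k + 1)" unfolding z_def by (rule rec)
      also have "cmod (of_real D * coord u (n + int Q)) \<le> 1 * cmod (coord u (n + int Q))"
        unfolding norm_mult using False by (intro mult_right_mono) auto
      finally show ?thesis using norm_ge_zero[of "coord u (n - int Q)"] by linarith
    qed
  qed
  with \<delta> show ?thesis by blast
qed

text \<open>Stability is bought by doubling the radius: outside the intervals of radius 2 r every
  point has distance at least r from the spectrum for \<open>b'\<close>. By
  \<open>norm_ge_of_spectral_gap\<close> this is a lower bound r, and a change of \<open>b'\<close>
  by r / 2 leaves half of it.\<close>

lemma covered_near_concatenation:
  assumes p: "p > 0" and per: "has_period p a" "has_period p b" and \<epsilon>: "\<epsilon> > 0"
  shows "\<exists>b' P \<delta>. P > 0 \<and> has_period P a \<and> has_period P b' \<and> (\<forall>n. \<bar>b' n - b n\<bar> \<le> \<epsilon>) \<and>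
    \<delta> > 0 \<and> (\<forall>b''. (\<forall>n. \<bar>b'' n - b' n\<bar> \<le> \<delta>) \<longrightarrow> covered a b'' k)"
proof -
  obtain Kb where Kb: "\<And>n. \<bar>b n\<bar> \<le> Kb"
    using has_period_bounded[OF p per(2)] unfolding bounded_iff by auto
  \<comment> \<open>Beyond \<open>R\<close> no operator whose diagonal is within
    \<open>\<epsilon>\<close> of \<open>b\<close> has spectrum, so energies in
    \<open>{-R..R}\<close> suffice.\<close>
  define R where "R = 2 * Ka + (Kb + \<epsilon>)"
  have R0: "R \<ge> 0" using Ka_pos Kb[of 0] \<epsilon> by (simp add: R_def)
  obtain m bs q \<kappa> where fam: "m > 0" "q > 0" "\<kappa> > 0" "has_period q a"
    "\<And>i. i < m \<Longrightarrow> has_period q (bs i)" "\<And>i n. i < m \<Longrightarrow> \<bar>bs i n - b n\<bar> \<le> \<epsilon>"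
    "\<And>E. \<bar>E\<bar> \<le> R \<Longrightarrow> \<exists>i<(m::nat). \<forall>w. norm (jop a (bs i) w - E *\<^sub>R w) \<ge> \<kappa> * norm w"
    using gap_family[OF p per \<epsilon> R0] by (metis (no_types, lifting))
  define c where "c = 5 * Ka\<^sup>2 / \<kappa>\<^sup>2"
  define \<theta> where "\<theta> = c / (1 + c)"
  have c0: "c > 0" using Ka_pos fam(3) by (simp add: c_def)
  have \<theta>: "0 < \<theta>" "\<theta> < 1" using c0 by (auto simp: \<theta>_def)
  \<comment> \<open>Half the logarithm, because the radius contains the square root of
    \<open>\<theta> ^ j\<close>.\<close>
  define s where "s = - ln \<theta> / 2"
  have s: "s > 0" using \<theta> by (simp add: s_def)
  \<comment> \<open>\<open>A\<close> and \<open>B\<close> are chosen so that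
    \<open>3 * m * P = A * (j + 2)\<close> and
    \<open>2 * r = B * (j + 2) * exp (- s * j)\<close>.\<close>
  define A where "A = 3 * real m * real m * 4 * real q"
  define B where "B = 32 * (sqrt 80 * Ka) * real m * 4 * real q"
  have A: "A > 0" and B: "B > 0" using fam(1,2) Ka_pos by (auto simp: A_def B_def)
  have lim: "(\<lambda>j::nat. (A * (real j + 2)) ^ i * (B * (real j + 2) * exp (- s * real j))) \<longlonglongrightarrow> 0" for i
    by (rule tendsto_power_times_geometric[OF A B s])
  have "\<forall>\<^sub>F j in sequentially. (A * (real j + 2)) ^ (k + 1) * (B * (real j + 2) * exp (- s * real j)) < 1"
    using lim[of "k + 1"] by (rule order_tendstoD) simp
  moreover have "\<forall>\<^sub>F j in sequentially. (A * (real j + 2)) ^ 0 * (B * (real j + 2) * exp (- s * real j)) < 1 / (real k + 2)"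
    using lim[of 0] by (rule order_tendstoD) simp
  ultimately have "\<forall>\<^sub>F j in sequentially. (A * (real j + 2)) ^ (k + 1) * (B * (real j + 2) * exp (- s * real j)) < 1
      \<and> B * (real j + 2) * exp (- s * real j) < 1 / (real k + 2)"
    by eventually_elim simp
  then obtain j :: nat where j: "(A * (real j + 2)) ^ (k + 1) * (B * (real j + 2) * exp (- s * real j)) < 1"
      "B * (real j + 2) * exp (- s * real j) < 1 / (real k + 2)"
    by (auto simp: eventually_sequentially)
  obtain b' P where b': "P = m * ((4 * j + 8) * q)" "has_period P a" "has_period P b'"
    "\<And>n. \<exists>i<m. b' n = bs i n"
    and ex: "\<exists>F. finite F \<and> F \<noteq> {} \<and> card F \<le> 3 * m * P \<and> (\<forall>E. \<bar>E\<bar> \<le> R \<longrightarrow> \<not> bounded_below (\<lambda>u. jop a b' u - E *\<^sub>R u) \<longrightarrow>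
      (\<exists>x\<in>F. \<bar>E - x\<bar> \<le> 16 * sqrt (80 * Ka\<^sup>2 * \<theta> ^ j) * real P))"
    using concatenation_cover[where bs = bs and R = R and j = j, OF fam(1-5,7) c_def] unfolding \<theta>_def by blast
  then obtain F where F: "finite F" "F \<noteq> {}" "card F \<le> 3 * m * P"
    and cov: "\<And>E. \<bar>E\<bar> \<le> R \<Longrightarrow> \<not> bounded_below (\<lambda>u. jop a b' u - E *\<^sub>R u) \<Longrightarrow>
      \<exists>x\<in>F. \<bar>E - x\<bar> \<le> 16 * sqrt (80 * Ka\<^sup>2 * \<theta> ^ j) * real P" by blast
  define r where "r = 16 * sqrt (80 * Ka\<^sup>2 * \<theta> ^ j) * real P"
  have P: "P > 0" using b'(1) fam(1,2) by simp
  have close: "\<bar>b' n - b n\<bar> \<le> \<epsilon>" for n using b'(4)[of n] fam(6) by metis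
  have sq: "sqrt (80 * Ka\<^sup>2 * \<theta> ^ j) = sqrt 80 * Ka * exp (- s * real j)"
  proof -
    have "\<theta> ^ j = exp (ln \<theta> * real j)" using \<theta>(1) by (simp add: exp_of_nat2_mult)
    also have "\<dots> = (exp (- s * real j))\<^sup>2" by (simp add: s_def power2_eq_square flip: exp_add)
    finally show ?thesis using Ka_pos by (simp add: real_sqrt_mult)
  qed
  have rB: "2 * r = B * (real j + 2) * exp (- s * real j)"
    unfolding r_def sq b'(1) B_def by (simp add: algebra_simps)
  have r: "r > 0" unfolding r_def sq using P Ka_pos by simp
  have cA: "real (card F) \<le> A * (real j + 2)"
  proof -
    have "real (card F) \<le> real (3 * m * P)" using F(3) by (rule of_nat_mono)
    also have "\<dots> = A * (real j + 2)" unfolding b'(1) A_def by (simp add: algebra_simps)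
    finally show ?thesis .
  qed
  have cF: "real (card F) \<ge> 1" using F(1,2) by (simp add: Suc_leI card_gt_0_iff)
  have dim: "(real k + 1) * ln (real (card F)) \<le> ln (1 / (2 * r))"
  proof -
    have "real (card F) ^ (k + 1) * (2 * r) \<le> (A * (real j + 2)) ^ (k + 1) * (2 * r)"
      using cA r by (intro mult_right_mono power_mono) auto
    also have "\<dots> < 1" using j(1) unfolding rB .
    finally have "real (card F) ^ (k + 1) \<le> 1 / (2 * r)" using r by (simp add: field_simps)
    then have "ln (real (card F) ^ (k + 1)) \<le> ln (1 / (2 * r))" using cF r by (subst ln_le_cancel_iff) auto
    also have "ln (real (card F) ^ (k + 1)) = (real k + 1) * ln (real (card F))"
      using cF by (subst ln_realpow) auto
    finally show ?thesis .
  qed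
  have bb': "bounded (range b')" by (rule has_period_bounded[OF P b'(3)])
  have outside: "bounded_below (\<lambda>u. jop a b' u - E *\<^sub>R u)" if "\<forall>x\<in>F. \<bar>E - x\<bar> > r" for E
  proof (cases "\<bar>E\<bar> \<le> R")
    case True
    then show ?thesis using cov[of E] that unfolding r_def[symmetric] by force
  next
    case False
    have "\<bar>b' n\<bar> \<le> Kb + \<epsilon>" for n using close[of n] Kb[of n] by linarith
    then show ?thesis using False by (intro bounded_below_outside[of b' "Kb + \<epsilon>"]) (auto simp: R_def)
  qed
  interpret J: symmetric_operator "jop a b'" by (rule symmetric_operator_jop[OF bounded_a bb'])
  have gap: "norm (jop a b' u - E *\<^sub>R u) \<ge> r * norm u" if E: "\<forall>x\<in>F. \<bar>E - x\<bar> > 2 * r" for E u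
  proof -
    interpret S: symmetric_operator "\<lambda>u. jop a b' u - E *\<^sub>R u" by (rule J.symmetric_operator_shift)
    show ?thesis
    proof (rule S.norm_ge_of_spectral_gap)
      fix d assume d: "\<bar>d\<bar> < r"
      interpret S': symmetric_operator "\<lambda>u. jop a b' u - (E + d) *\<^sub>R u" by (rule J.symmetric_operator_shift)
      have "\<bar>E + d - x\<bar> > r" if "x \<in> F" for x using E that d by force
      then have "bij (\<lambda>u. jop a b' u - (E + d) *\<^sub>R u)" by (intro S'.bij_if_bounded_below outside) blast
      then show "bij (\<lambda>u. jop a b' u - E *\<^sub>R u - d *\<^sub>R u)" by (simp add: algebra_simps)
    qed
  qed
  have "covered a b'' k" if b'': "\<And>n. \<bar>b'' n - b' n\<bar> \<le> r / 2" for b''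
    unfolding covered_def
  proof (intro exI[of _ F] exI[of _ "2 * r"] conjI allI impI)
    show "2 * r \<le> 1 / (real k + 2)" using j(2) unfolding rB by simp
    fix E assume E: "\<forall>c\<in>F. \<bar>E - c\<bar> > 2 * r"
    show "bounded_below (\<lambda>u. jop a b'' u - E *\<^sub>R u)"
    proof (rule bounded_belowI)
      show "(r - r / 2 - \<bar>E - E\<bar>) * norm u \<le> norm (jop a b'' u - E *\<^sub>R u)" for u
        by (rule gap_perturb[OF bb' b'' gap[OF E]])
    qed (use r in simp)
  qed (use F r dim in auto)
  with P b'(2,3) close r show ?thesis by (intro exI[of _ b'] exI[of _ P] exI[of _ "r / 2"]) auto
qed

lemma generic_step:
  assumes p: "p > 0" and per: "has_period p a" "has_period p b" and \<epsilon>: "\<epsilon> > 0"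
  shows "\<exists>b' P \<delta>. P > 0 \<and> has_period P a \<and> has_period P b' \<and> (\<forall>n. \<bar>b' n - b n\<bar> \<le> \<epsilon>) \<and>
    \<delta> > 0 \<and> (\<forall>b''. (\<forall>n. \<bar>b'' n - b' n\<bar> \<le> \<delta>) \<longrightarrow> covered a b'' k \<and> gordon a b'' k)"
proof -
  obtain b' P \<delta> where 1: "P > 0" "has_period P a" "has_period P b'"
    "\<And>n. \<bar>b' n - b n\<bar> \<le> \<epsilon>" "\<delta> > 0" "\<And>b''. (\<And>n. \<bar>b'' n - b' n\<bar> \<le> \<delta>) \<Longrightarrow> covered a b'' k"
    using covered_near_concatenation[OF p per \<epsilon>, of k] by blast
  obtain \<eta> where 2: "\<eta> > 0" "\<And>b''. (\<And>n. \<bar>b'' n - b' n\<bar> \<le> \<eta>) \<Longrightarrow> gordon a b'' k"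
    using gordon_near_periodic[OF 1(1-3), of k] by blast
  show ?thesis
    by (intro exI[of _ b'] exI[of _ P] exI[of _ "min \<delta> \<eta>"]) (use 1 2 in auto)
qed

end

section \<open>Spectrum and spectral measures of the limit\<close>

lemma finite_large_coords:
  assumes "e > 0"
  shows "finite {n. cmod (coord u n) \<ge> e}"
proof (rule ccontr)
  assume inf: "infinite {n. cmod (coord u n) \<ge> e}"
  obtain m :: nat where m: "(norm u)\<^sup>2 / e\<^sup>2 < real m" using reals_Archimedean2 by blast
  obtain F where F: "F \<subseteq> {n. cmod (coord u n) \<ge> e}" "finite F" "card F = m"
    using infinite_arbitrarily_large[OF inf] by blast
  have "real m * e\<^sup>2 = (\<Sum>n\<in>F. e\<^sup>2)" using F(3) by simp
  also have "\<dots> \<le> energy u F" unfolding energy_def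
    using F(1) assms by (intro sum_mono power_mono) auto
  also have "\<dots> \<le> (norm u)\<^sup>2" by (rule energy_le_norm[OF F(2)])
  finally show False using m assms by (simp add: field_simps)
qed

lemma coord_decay:
  assumes "e > 0"
  obtains N where "\<And>n. \<bar>n\<bar> > N \<Longrightarrow> cmod (coord u n) < e"
proof -
  define N where "N = Max (insert 0 (abs ` {n. cmod (coord u n) \<ge> e}))"
  have "\<bar>n\<bar> \<le> N" if "cmod (coord u n) \<ge> e" for n
    unfolding N_def using finite_large_coords[OF assms, of u] that by (intro Max_ge) auto
  then show ?thesis using that[of N] by (meson leD not_le)
qed

lemma gordon_no_eigenvector:
  assumes bd: "bounded (range a)" "bounded (range b)" and G: "\<And>k. gordon a b k"
    and ev: "jop a b u = E *\<^sub>R u"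
  shows "u = 0"
proof (rule ccontr)
  assume "u \<noteq> 0"
  define w where "w = (1 / norm u) *\<^sub>R u"
  have w: "norm w = 1" using \<open>u \<noteq> 0\<close> by (simp add: w_def)
  interpret J: symmetric_operator "jop a b" by (rule symmetric_operator_jop[OF bd])
  have ew: "jop a b w = E *\<^sub>R w" by (simp add: w_def J.scaleR ev)
  have "coord w n = 0" for n
  proof -
    have le4: "cmod (coord w n) \<le> 4 * e" if e: "e > 0" for e
    proof -
      obtain N where N: "\<And>n. \<bar>n\<bar> > N \<Longrightarrow> cmod (coord w n) < e" using coord_decay[OF e] by blast
      obtain k1 :: nat where k1: "1 / e < real k1" using reals_Archimedean2 by blast
      obtain k2 :: nat where k2: "\<bar>E\<bar> < real k2" using reals_Archimedean2 by blast
      \<comment> \<open>Large enough for the error term and for \<open>E\<close>, and to place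
        \<open>n + P\<close>, \<open>n - P\<close> and \<open>n + 2 * P\<close> in the tail where
        \<open>w\<close> is small.\<close>
      define k where "k = k1 + k2 + nat (\<bar>N\<bar> + \<bar>n\<bar> + 1)"
      obtain P where P: "P \<ge> int k" and le: "\<And>E u n. \<bar>E\<bar> \<le> real k \<Longrightarrow> norm u \<le> 1 \<Longrightarrow> jop a b u = E *\<^sub>R u \<Longrightarrow>
          cmod (coord u n) \<le> cmod (coord u (n + P)) + cmod (coord u (n - P)) + cmod (coord u (n + 2 * P)) + 1 / (real k + 1)"
        using G[of k] unfolding gordon_def by blast
      have Pbig: "P \<ge> \<bar>N\<bar> + \<bar>n\<bar> + 1" using P by (simp add: k_def)
      have "1 / (real k + 1) \<le> e"
      proof -
        have "1 / e < real k + 1" using k1 by (simp add: k_def)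
        then show ?thesis using e by (simp add: field_simps)
      qed
      moreover have "\<bar>E\<bar> \<le> real k" using k2 by (simp add: k_def)
      then have "cmod (coord w n) \<le> cmod (coord w (n + P)) + cmod (coord w (n - P)) + cmod (coord w (n + 2 * P)) + 1 / (real k + 1)"
        using le[of E w n] w ew by simp
      moreover have "cmod (coord w (n + P)) < e" "cmod (coord w (n - P)) < e" "cmod (coord w (n + 2 * P)) < e"
        using Pbig by (intro N; linarith)+
      ultimately show ?thesis by linarith
    qed
    have "cmod (coord w n) \<le> 0 + e" if "e > 0" for e using le4[of "e / 4"] that by simp
    then have "cmod (coord w n) \<le> 0" by (rule field_le_epsilon)
    then show ?thesis by simp
  qed
  then have "w = 0" by (intro ell2_eqI) (simp add: coord_zero)
  with w show False by simp
qed

lemma covered_spectrum: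
  assumes bd: "bounded (range a)" "bounded (range b)" and "covered a b k"
  obtains F r where "finite F" "F \<noteq> {}" "0 < r" "r \<le> 1 / (real k + 2)"
    "(real k + 1) * ln (real (card F)) \<le> ln (1 / r)" "jac_spectrum a b \<subseteq> (\<Union>c\<in>F. cball c r)"
proof -
  obtain F r where F: "finite F" "F \<noteq> {}" "0 < r" "r \<le> 1 / (real k + 2)"
    "(real k + 1) * ln (real (card F)) \<le> ln (1 / r)"
    and out: "\<And>E. (\<forall>c\<in>F. \<bar>E - c\<bar> > r) \<Longrightarrow> bounded_below (\<lambda>u. jop a b u - E *\<^sub>R u)"
    using assms(3) unfolding covered_def by blast
  have "jac_spectrum a b \<subseteq> (\<Union>c\<in>F. cball c r)"
  proof
    fix E assume "E \<in> jac_spectrum a b"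
    then have "\<not> (\<forall>c\<in>F. \<bar>E - c\<bar> > r)" using out jac_spectrum_iff[OF bd] by blast
    then show "E \<in> (\<Union>c\<in>F. cball c r)" by (auto simp: dist_real_def abs_minus_commute not_less)
  qed
  with F that show ?thesis by blast
qed

text \<open>A limit inferior is controlled by a sequence of scales: those supplied tend to 0 by
  \<open>r \<le> 1 / (k + 2)\<close>, and their quotients are at most 1 / (k + 1).\<close>

lemma lower_box_dim_zero:
  assumes cov: "\<And>k::nat. \<exists>F r. finite F \<and> F \<noteq> {} \<and> 0 < r \<and> r \<le> 1 / (real k + 2) \<and>
    (real k + 1) * ln (real (card F)) \<le> ln (1 / r) \<and> K \<subseteq> (\<Union>c\<in>F. cball c r)"
  shows "lower_box_dim K = 0"
proof -
  define g where "g \<epsilon> = ereal (ln (real (cover_num K \<epsilon>)) / ln (1 / \<epsilon>))" for \<epsilon>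
  \<comment> \<open>Includes \<open>n = 0\<close> through \<open>ln 0 = 0\<close>;
    \<open>cover_num\<close> of an empty set is 0.\<close>
  have ln0: "ln (real n) \<ge> 0" for n :: nat by (cases n) auto
  have "Liminf (at_right 0) g \<ge> 0"
  proof (rule Liminf_bounded)
    have "\<forall>\<^sub>F \<epsilon> in at_right (0::real). \<epsilon> \<in> {0<..<1}" by (rule eventually_at_right_real) simp
    then show "\<forall>\<^sub>F \<epsilon> in at_right 0. 0 \<le> g \<epsilon>"
    proof eventually_elim
      case (elim \<epsilon>)
      then have "ln (1 / \<epsilon>) > 0" by simp
      then show ?case using ln0[of "cover_num K \<epsilon>"] by (simp add: g_def)
    qed
  qed
  moreover have "\<not> Liminf (at_right 0) g > 0"
  proof
    assume "Liminf (at_right 0) g > 0"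
    then obtain c where c: "0 < c" "c < Liminf (at_right 0) g" using dense by blast
    then have "\<forall>\<^sub>F \<epsilon> in at_right 0. c < g \<epsilon>" by (intro less_LiminfD)
    then obtain d where d: "d > 0" "\<And>\<epsilon>. 0 < \<epsilon> \<Longrightarrow> \<epsilon> < d \<Longrightarrow> c < g \<epsilon>"
      unfolding eventually_at_right_field by auto
    obtain c' :: real where c': "0 < c'" "ereal c' < c" using c(1) by (metis ereal_dense2 ereal_less(2) zero_ereal_def)
    obtain k1 :: nat where k1: "1 / c' < real k1" using reals_Archimedean2 by blast
    obtain k2 :: nat where k2: "1 / d < real k2" using reals_Archimedean2 by blast
    define k where "k = k1 + k2"
    obtain F r where F: "finite F" "F \<noteq> {}" "0 < r" "r \<le> 1 / (real k + 2)"
      "(real k + 1) * ln (real (card F)) \<le> ln (1 / r)" "K \<subseteq> (\<Union>c\<in>F. cball c r)" using cov[of k] by blast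
    have "1 / (real k + 2) < d"
    proof -
      have "1 / d < real k + 2" using k2 by (simp add: k_def)
      then show ?thesis using d(1) by (simp add: field_simps)
    qed
    then have "c < g r" using F d by (intro d(2)) auto
    have "1 / (real k + 2) < 1" by simp
    then have "r < 1" using F(4) by linarith
    then have lr: "ln (1 / r) > 0" using F(3) by simp
    have "cover_num K r \<le> card F"
      unfolding cover_num_def by (rule Least_le) (use F in blast)
    then have "ln (real (cover_num K r)) \<le> ln (real (card F))"
      using ln0[of "card F"] by (cases "cover_num K r = 0") auto
    also have "\<dots> \<le> ln (1 / r) / (real k + 1)" using F(5) by (simp add: field_simps)
    finally have "ln (real (cover_num K r)) / ln (1 / r) \<le> 1 / (real k + 1)"
      using lr by (simp add: field_simps)
    also have "\<dots> \<le> c'"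
    proof -
      have "1 / c' < real k + 1" using k1 by (simp add: k_def)
      then show ?thesis using c'(1) by (simp add: field_simps)
    qed
    finally have "g r \<le> ereal c'" by (simp add: g_def)
    with \<open>c < g r\<close> c'(2) show False by simp
  qed
  ultimately have "Liminf (at_right 0) g = 0" by (metis not_less order_antisym)
  then show ?thesis by (simp only: lower_box_dim_def g_def[abs_def])
qed

text \<open>From \<open>k = 1\<close> on, the logarithmic inequality gives (card F)^2 <= 1 / r. The
  total length 2 r card F therefore has square at most 4 r.\<close>

lemma covered_null:
  fixes K :: "real set"
  assumes cov: "\<And>k::nat. \<exists>F r. finite F \<and> F \<noteq> {} \<and> 0 < r \<and> r \<le> 1 / (real k + 2) \<and>
    (real k + 1) * ln (real (card F)) \<le> ln (1 / r) \<and> K \<subseteq> (\<Union>c\<in>F. cball c r)"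
    and K: "compact K"
  shows "emeasure lborel K = 0"
proof -
  have meas: "K \<in> sets lborel" using K by (simp add: compact_imp_closed borel_closed)
  have finK: "emeasure lborel K < \<infinity>" using K by (rule emeasure_compact_finite)
  have "(measure lborel K)\<^sup>2 \<le> 0 + e" if e: "e > 0" for e :: real
  proof -
    obtain k1 :: nat where k1: "4 / e < real k1" using reals_Archimedean2 by blast
    define k where "k = k1 + 1"
    obtain F r where F: "finite F" "F \<noteq> {}" "0 < r" "r \<le> 1 / (real k + 2)"
      "(real k + 1) * ln (real (card F)) \<le> ln (1 / r)" "K \<subseteq> (\<Union>c\<in>F. cball c r)" using cov[of k] by blast
    have cF: "real (card F) \<ge> 1" using F(1,2) by (simp add: Suc_leI card_gt_0_iff)
    have "2 * ln (real (card F)) \<le> (real k + 1) * ln (real (card F))"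
      using cF by (intro mult_right_mono) (auto simp: k_def)
    with F(5) have "ln (real (card F) ^ 2) \<le> ln (1 / r)" using cF by (subst ln_realpow) auto
    then have sq: "real (card F) ^ 2 \<le> 1 / r" using cF F(3) by (subst (asm) ln_le_cancel_iff) auto
    have "measure lborel K \<le> measure lborel (\<Union>c\<in>F. cball c r)"
    proof (rule measure_mono_fmeasurable[OF F(6) meas])
      have c: "compact (\<Union>c\<in>F. cball c r)" using F(1) by (intro compact_UN) auto
      show "(\<Union>c\<in>F. cball c r) \<in> fmeasurable lborel"
        using c emeasure_compact_finite[OF c]
        by (intro fmeasurableI) (auto simp: compact_imp_closed borel_closed)
    qed
    also have "\<dots> \<le> (\<Sum>c\<in>F. measure lborel (cball c r))"
      using F(1) by (intro measure_UNION_le) auto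
    also have "\<dots> = real (card F) * (2 * r)"
      using F(3) by (simp add: cball_eq_atLeastAtMost)
    finally have "measure lborel K \<le> real (card F) * (2 * r)" .
    then have "(measure lborel K)\<^sup>2 \<le> (real (card F) * (2 * r))\<^sup>2" by (intro power_mono) auto
    also have "\<dots> = real (card F) ^ 2 * (4 * r * r)" by (simp add: power2_eq_square)
    also have "\<dots> \<le> (1 / r) * (4 * r * r)" using sq F(3) by (intro mult_right_mono) auto
    also have "\<dots> = 4 * r" using F(3) by simp
    also have "\<dots> \<le> 4 * (1 / (real k + 2))" using F(4) by simp
    also have "\<dots> \<le> e"
    proof -
      have "4 / e < real k + 2" using k1 by (simp add: k_def)
      then show ?thesis using e by (simp add: field_simps)
    qed
    finally show ?thesis by simp
  qed
  then have "(measure lborel K)\<^sup>2 \<le> 0" by (rule field_le_epsilon)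
  then have "measure lborel K = 0" by simp
  then show ?thesis using finK emeasure_eq_ennreal_measure[of lborel K] by auto
qed

lemma interior_empty_if_null:
  fixes K :: "real set"
  assumes "emeasure lborel K = 0" "compact K"
  shows "interior K = {}"
proof (rule ccontr)
  assume "interior K \<noteq> {}"
  then obtain x where "x \<in> interior K" by blast
  then obtain e where e: "e > 0" "cball x e \<subseteq> K" unfolding mem_interior_cball by blast
  have "emeasure lborel (cball x e) \<le> emeasure lborel K"
    using e(2) assms(2) by (intro emeasure_mono) (auto simp: compact_imp_closed borel_closed)
  then show False using assms(1) e(1) by (simp add: cball_eq_atLeastAtMost)
qed

lemma (in offdiagonal) compact_jac_spectrum:
  assumes bd: "bounded (range b)"
  shows "compact (jac_spectrum a b)"
proof -
  obtain Kb where Kb: "\<And>n. \<bar>b n\<bar> \<le> Kb" using bd unfolding bounded_iff by auto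
  have "jac_spectrum a b \<subseteq> {- (2 * Ka + Kb)..2 * Ka + Kb}"
  proof
    fix E assume "E \<in> jac_spectrum a b"
    then have "\<not> \<bar>E\<bar> > 2 * Ka + Kb"
      using bounded_below_outside[of b Kb E] Kb jac_spectrum_iff[OF bounded_a bd] by blast
    then show "E \<in> {- (2 * Ka + Kb)..2 * Ka + Kb}" by auto
  qed
  then have "bounded (jac_spectrum a b)" using bounded_subset bounded_closed_interval by blast
  moreover have "open (- jac_spectrum a b)" unfolding open_contains_ball
  proof
    fix E assume "E \<in> - jac_spectrum a b"
    then obtain \<kappa> where \<kappa>: "\<kappa> > 0" "\<And>u. norm (jop a b u - E *\<^sub>R u) \<ge> \<kappa> * norm u"
      using jac_spectrum_iff[OF bounded_a bd] unfolding bounded_below_def by blast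
    have "E' \<in> - jac_spectrum a b" if "E' \<in> ball E \<kappa>" for E'
    proof -
      have "bounded_below (\<lambda>u. jop a b u - E' *\<^sub>R u)"
      proof (rule bounded_belowI)
        show "\<kappa> - 0 - \<bar>E' - E\<bar> > 0" using that by (simp add: dist_real_def abs_minus_commute)
        show "(\<kappa> - 0 - \<bar>E' - E\<bar>) * norm u \<le> norm (jop a b u - E' *\<^sub>R u)" for u
          by (rule gap_perturb[OF bd _ \<kappa>(2)]) simp
      qed
      then show ?thesis using jac_spectrum_iff[OF bounded_a bd] by blast
    qed
    with \<kappa>(1) show "\<exists>e>0. ball E e \<subseteq> - jac_spectrum a b" by blast
  qed
  ultimately show ?thesis by (simp add: compact_eq_bounded_closed closed_def)
qed

lemma jac_spectrum_no_isolated: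
  assumes bd: "bounded (range a)" "bounded (range b)" and G: "\<And>k. gordon a b k"
    and E: "E \<in> jac_spectrum a b"
  shows "E islimpt jac_spectrum a b"
proof (rule ccontr)
  assume "\<not> E islimpt jac_spectrum a b"
  then obtain r where r: "r > 0" "\<And>E'. E' \<in> jac_spectrum a b \<Longrightarrow> E' \<noteq> E \<Longrightarrow> dist E' E \<ge> r"
    unfolding islimpt_approachable by (auto simp: not_less)
  interpret J: symmetric_operator "jop a b" by (rule symmetric_operator_jop[OF bd])
  interpret S: symmetric_operator "\<lambda>u. jop a b u - E *\<^sub>R u" by (rule J.symmetric_operator_shift)
  have "bounded_below (\<lambda>u. jop a b u - E *\<^sub>R u)"
  proof (rule S.bounded_below_if_isolated[OF r(1)])
    fix d :: real assume d: "d \<noteq> 0" "\<bar>d\<bar> < r"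
    then have "E + d \<notin> jac_spectrum a b" using r(2)[of "E + d"] by (auto simp: dist_real_def)
    then show "bij (\<lambda>u. jop a b u - E *\<^sub>R u - d *\<^sub>R u)"
      by (simp add: jac_spectrum_eq[OF bd] algebra_simps)
  next
    fix u assume "jop a b u - E *\<^sub>R u = 0"
    then show "u = 0" using gordon_no_eigenvector[OF bd G, of u E] by simp
  qed
  with E show False using jac_spectrum_iff[OF bd] by blast
qed

text \<open>Represented pairs are closed under polynomials in the operator, which replaces the functional
  calculus.\<close>
definition represents :: "(ell2 \<Rightarrow> ell2) \<Rightarrow> ell2 \<Rightarrow> real measure \<Rightarrow> (real \<Rightarrow> real) \<Rightarrow> ell2 \<Rightarrow> bool" where
  "represents A w \<mu> g \<phi> \<longleftrightarrow> (\<forall>k. integrable \<mu> (\<lambda>x. x ^ k * g x) \<and> (\<integral>x. x ^ k * g x \<partial>\<mu>) = inner w ((A ^^ k) \<phi>))"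

lemma represents_times_x:
  assumes "represents A w \<mu> g \<phi>"
  shows "represents A w \<mu> (\<lambda>x. x * g x) (A \<phi>)"
  unfolding represents_def
proof
  fix k
  have "integrable \<mu> (\<lambda>x. x ^ Suc k * g x)" "(\<integral>x. x ^ Suc k * g x \<partial>\<mu>) = inner w ((A ^^ Suc k) \<phi>)"
    using assms unfolding represents_def by blast+
  moreover have "x ^ Suc k * g x = x ^ k * (x * g x)" for x by simp
  ultimately show "integrable \<mu> (\<lambda>x. x ^ k * (x * g x)) \<and> (\<integral>x. x ^ k * (x * g x) \<partial>\<mu>) = inner w ((A ^^ k) (A \<phi>))"
    by (simp only: funpow_Suc_right o_apply)
qed

lemma represents_add_scaled:
  assumes A: "linear A" and 1: "represents A w \<mu> g \<phi>" and 2: "represents A w \<mu> h \<eta>"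
  shows "represents A w \<mu> (\<lambda>x. g x + c * h x) (\<phi> + c *\<^sub>R \<eta>)"
  unfolding represents_def
proof
  fix k
  have lin: "(A ^^ k) (\<phi> + c *\<^sub>R \<eta>) = (A ^^ k) \<phi> + c *\<^sub>R (A ^^ k) \<eta>"
    by (induction k) (auto simp: linear_add[OF A] linear_scale[OF A])
  have i: "integrable \<mu> (\<lambda>x. x ^ k * g x)" "(\<integral>x. x ^ k * g x \<partial>\<mu>) = inner w ((A ^^ k) \<phi>)"
    "integrable \<mu> (\<lambda>x. x ^ k * h x)" "(\<integral>x. x ^ k * h x \<partial>\<mu>) = inner w ((A ^^ k) \<eta>)"
    using 1 2 unfolding represents_def by blast+
  have e: "x ^ k * (g x + c * h x) = x ^ k * g x + c * (x ^ k * h x)" for x by (simp add: algebra_simps)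
  show "integrable \<mu> (\<lambda>x. x ^ k * (g x + c * h x)) \<and>
      (\<integral>x. x ^ k * (g x + c * h x) \<partial>\<mu>) = inner w ((A ^^ k) (\<phi> + c *\<^sub>R \<eta>))"
    unfolding e lin using i by (simp add: inner_add_right)
qed

lemma spectral_measure_represents:
  assumes bd: "bounded (range a)" "bounded (range b)" and sm: "spectral_measure a b \<psi> \<mu>" and \<psi>: "\<psi> \<in> l2"
  shows "represents (jop a b) (Ell2 \<psi>) \<mu> (\<lambda>_. 1) (Ell2 \<psi>)"
proof -
  have c: "coord ((jop a b ^^ k) (Ell2 \<psi>)) = (jac_op a b ^^ k) \<psi>" for k
    by (induction k) (simp_all add: coord_Ell2 \<psi> coord_jop bd)
  have "complex_of_real (\<integral>x. x ^ k \<partial>\<mu>) = l2inner \<psi> ((jac_op a b ^^ k) \<psi>)" for k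
    using sm by (simp add: spectral_measure_def)
  then have "(\<integral>x. x ^ k \<partial>\<mu>) = Re (l2inner \<psi> ((jac_op a b ^^ k) \<psi>))" for k
    by (metis Re_complex_of_real)
  also have "Re (l2inner \<psi> ((jac_op a b ^^ k) \<psi>)) = inner (Ell2 \<psi>) ((jop a b ^^ k) (Ell2 \<psi>))" for k
    using Re_l2inner_coord[of "Ell2 \<psi>" "(jop a b ^^ k) (Ell2 \<psi>)"] by (simp add: c coord_Ell2 \<psi>)
  finally show ?thesis using sm by (simp add: represents_def spectral_measure_def)
qed

text \<open>\<open>Q\<close> corresponds to multiplication by \<open>1 - (x - E)^2 / S^2\<close>.
  The exponent \<open>2 * j\<close> makes the integrand nonnegative and lets symmetry split the
  inner product into a squared norm.\<close>

lemma represents_contraction_power: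
  fixes E S :: real
  assumes sym: "symmetric_operator A" and rep: "represents A w \<mu> (\<lambda>_. 1) w"
  defines "B \<equiv> \<lambda>u. A u - E *\<^sub>R u"
  defines "Q \<equiv> \<lambda>u. u - (1 / S\<^sup>2) *\<^sub>R B (B u)"
  shows "integrable \<mu> (\<lambda>x. (1 - (x - E)\<^sup>2 / S\<^sup>2) ^ (2 * j))"
    "(\<integral>x. (1 - (x - E)\<^sup>2 / S\<^sup>2) ^ (2 * j) \<partial>\<mu>) = (norm ((Q ^^ j) w))\<^sup>2"
proof -
  interpret A: symmetric_operator A by (rule sym)
  interpret B: symmetric_operator B unfolding B_def by (rule A.symmetric_operator_shift)
  have lin: "linear A" by (rule A.linear_axioms)
  define q where "q x = 1 - (x - E)\<^sup>2 / S\<^sup>2" for x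
  have stepB: "represents A w \<mu> (\<lambda>x. (x - E) * g x) (B \<phi>)" if "represents A w \<mu> g \<phi>" for g \<phi>
    using represents_add_scaled[OF lin represents_times_x[OF that] that, of "- E"]
    by (simp add: B_def algebra_simps)
  have stepQ: "represents A w \<mu> (\<lambda>x. q x * g x) (Q \<phi>)" if "represents A w \<mu> g \<phi>" for g \<phi>
  proof -
    have "(\<lambda>x. g x + - (1 / S\<^sup>2) * ((x - E) * ((x - E) * g x))) = (\<lambda>x. q x * g x)"
    proof
      fix x
      define y where "y = x - E"
      have "g x + - (1 / S\<^sup>2) * (y * (y * g x)) = (1 - y\<^sup>2 / S\<^sup>2) * g x"
        by (simp add: power2_eq_square[of y] algebra_simps)
      then show "g x + - (1 / S\<^sup>2) * ((x - E) * ((x - E) * g x)) = q x * g x" by (simp add: q_def y_def)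
    qed
    moreover have "\<phi> + - (1 / S\<^sup>2) *\<^sub>R B (B \<phi>) = Q \<phi>" by (simp add: Q_def)
    ultimately show ?thesis
      using represents_add_scaled[OF lin that stepB[OF stepB[OF that]], of "- (1 / S\<^sup>2)"] by simp
  qed
  have pow: "represents A w \<mu> (\<lambda>x. q x ^ n) ((Q ^^ n) w)" for n
  proof (induction n)
    case (Suc n)
    then show ?case using stepQ[OF Suc] by simp
  qed (simp add: rep)
  have int: "integrable \<mu> (\<lambda>x. q x ^ (2 * j))" "(\<integral>x. q x ^ (2 * j) \<partial>\<mu>) = inner w ((Q ^^ (2 * j)) w)"
    using spec[OF pow[of "2 * j", unfolded represents_def], of 0] by simp_all
  have Qsym: "inner (Q x) y = inner x (Q y)" for x y
    by (simp add: Q_def inner_diff_left inner_diff_right B.symmetric)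
  have Qpow: "inner ((Q ^^ n) x) y = inner x ((Q ^^ n) y)" for n x y
    by (induction n arbitrary: x y) (auto simp: Qsym funpow_swap1)
  have "inner w ((Q ^^ (2 * j)) w) = inner w ((Q ^^ j) ((Q ^^ j) w))"
    by (simp add: mult_2 funpow_add)
  also have "\<dots> = (norm ((Q ^^ j) w))\<^sup>2"
    by (simp add: power2_norm_eq_inner Qpow[of j w "(Q ^^ j) w"])
  finally show "integrable \<mu> (\<lambda>x. (1 - (x - E)\<^sup>2 / S\<^sup>2) ^ (2 * j))"
    "(\<integral>x. (1 - (x - E)\<^sup>2 / S\<^sup>2) ^ (2 * j) \<partial>\<mu>) = (norm ((Q ^^ j) w))\<^sup>2"
    using int unfolding q_def by simp_all
qed

text \<open>The polynomials \<open>(1 - (x - E)^2 / S^2) ^ (2 * j)\<close> are nonnegative and equal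
  to 1 at \<open>E\<close>, so their integrals dominate the mass of the atom. These integrals are
  squared norms of \<open>Q^j \<psi>\<close>, which tend to 0 as \<open>E\<close> is not an
  eigenvalue.\<close>

lemma spectral_measure_no_atoms:
  assumes bd: "bounded (range a)" "bounded (range b)" and sm: "spectral_measure a b \<psi> \<mu>" and \<psi>: "\<psi> \<in> l2"
    and inj: "\<And>u. jop a b u = E *\<^sub>R u \<Longrightarrow> u = 0"
  shows "emeasure \<mu> {E} = 0"
proof -
  interpret finite_measure \<mu> using sm by (simp add: spectral_measure_def)
  have sets: "sets \<mu> = sets borel" using sm by (simp add: spectral_measure_def)
  have J: "symmetric_operator (jop a b)" by (rule symmetric_operator_jop[OF bd])
  interpret B: symmetric_operator "\<lambda>u. jop a b u - E *\<^sub>R u" by (rule symmetric_operator.symmetric_operator_shift[OF J])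
  obtain S where S: "S > 0" "\<And>u. norm (jop a b u - E *\<^sub>R u) \<le> S * norm u" using B.pos_norm_bound by blast
  define Q where "Q = (\<lambda>u. u - (1 / S\<^sup>2) *\<^sub>R (jop a b (jop a b u - E *\<^sub>R u) - E *\<^sub>R (jop a b u - E *\<^sub>R u)))"
  have Q0: "(\<lambda>n. (Q ^^ n) (Ell2 \<psi>)) \<longlonglongrightarrow> 0"
    unfolding Q_def by (rule B.contraction_powers_tendsto_0[OF S]) (use inj in auto)
  note rep = represents_contraction_power[OF J spectral_measure_represents[OF bd sm \<psi>], of E S, folded Q_def]
  have le: "measure \<mu> {E} \<le> (norm ((Q ^^ j) (Ell2 \<psi>)))\<^sup>2" for j
  proof -
    have "measure \<mu> {E} = (\<integral>x. indicator {E} x \<partial>\<mu>)" by (simp add: sets)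
    also have "\<dots> \<le> (\<integral>x. (1 - (x - E)\<^sup>2 / S\<^sup>2) ^ (2 * j) \<partial>\<mu>)"
    proof (rule integral_mono)
      show "indicator {E} x \<le> (1 - (x - E)\<^sup>2 / S\<^sup>2) ^ (2 * j)" for x :: real
        by (cases "x = E") (auto simp: power_mult)
    qed (use rep(1) in \<open>auto simp: sets integrable_indicator_iff less_top[symmetric]\<close>)
    finally show ?thesis using rep(2) by simp
  qed
  have "(\<lambda>j. (norm ((Q ^^ j) (Ell2 \<psi>)))\<^sup>2) \<longlonglongrightarrow> (norm (0 :: ell2))\<^sup>2" by (intro tendsto_intros Q0)
  then have "measure \<mu> {E} \<le> (norm (0 :: ell2))\<^sup>2" by (rule LIMSEQ_le_const) (use le in blast)
  then have "measure \<mu> {E} = 0" by (simp add: measure_le_0_iff)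
  then show ?thesis by (simp add: emeasure_eq_measure)
qed

text \<open>With \<open>q x = 1 - (x - E)\<^sup>2 / S\<^sup>2\<close> and \<open>d = \<kappa>\<^sup>2 / S\<^sup>2\<close>, the integral of \<open>q\<^sup>2\<^sup>j\<close> is \<open>\<parallel>Q\<^sup>j \<psi>\<parallel>\<^sup>2 \<le> (1 - d)\<^sup>j \<parallel>\<psi>\<parallel>\<^sup>2\<close>,
  whereas \<open>q\<^sup>2 \<ge> 1 - d / 2\<close> on the ball of radius \<open>\<kappa> / 2\<close>.\<close>
lemma spectral_measure_null_near_resolvent:
  assumes bd: "bounded (range a)" "bounded (range b)" and sm: "spectral_measure a b \<psi> \<mu>" and \<psi>: "\<psi> \<in> l2"
    and E: "E \<notin> jac_spectrum a b"
  shows "\<exists>r>0. emeasure \<mu> (ball E r) = 0"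
proof -
  interpret finite_measure \<mu> using sm by (simp add: spectral_measure_def)
  have sets: "sets \<mu> = sets borel" using sm by (simp add: spectral_measure_def)
  have J: "symmetric_operator (jop a b)" by (rule symmetric_operator_jop[OF bd])
  interpret B: symmetric_operator "\<lambda>u. jop a b u - E *\<^sub>R u" by (rule symmetric_operator.symmetric_operator_shift[OF J])
  obtain S0 where S0: "S0 > 0" "\<And>u. norm (jop a b u - E *\<^sub>R u) \<le> S0 * norm u" using B.pos_norm_bound by blast
  obtain \<kappa> where \<kappa>: "\<kappa> > 0" "\<And>u. norm (jop a b u - E *\<^sub>R u) \<ge> \<kappa> * norm u"
    using E jac_spectrum_iff[OF bd] unfolding bounded_below_def by blast
  \<comment> \<open>Adding \<open>\<kappa>\<close> forces \<open>\<kappa> < S\<close>, hence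
    \<open>d < 1\<close>.\<close>
  define S where "S = S0 + \<kappa>"
  have S: "S > 0" "norm (jop a b u - E *\<^sub>R u) \<le> S * norm u" for u
    using S0 \<kappa>(1) order_trans[OF S0(2), of u "S * norm u"] by (auto simp: S_def algebra_simps)
  define d where "d = \<kappa>\<^sup>2 / S\<^sup>2"
  have "\<kappa>\<^sup>2 < S\<^sup>2" using \<kappa>(1) S0(1) by (intro power_strict_mono) (auto simp: S_def)
  then have d: "d > 0" "d < 1" using \<kappa>(1) S(1) by (auto simp: d_def)
  define B where "B = (\<lambda>u. jop a b u - E *\<^sub>R u)"
  define Q where "Q = (\<lambda>u. u - (1 / S\<^sup>2) *\<^sub>R B (B u))"
  define w where "w = Ell2 \<psi>"
  note rep = represents_contraction_power[OF J spectral_measure_represents[OF bd sm \<psi>], of E S,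
      folded B_def, folded Q_def w_def]
  have contr: "(norm (Q u))\<^sup>2 \<le> (1 - d) * (norm u)\<^sup>2" for u
  proof -
    have "(norm (Q u))\<^sup>2 \<le> (norm u)\<^sup>2 - (norm (B u))\<^sup>2 / S\<^sup>2"
      unfolding Q_def B_def by (rule B.contraction_norm_le[OF S])
    moreover have "(\<kappa> * norm u)\<^sup>2 \<le> (norm (B u))\<^sup>2"
      unfolding B_def using \<kappa> by (intro power_mono) auto
    then have "(\<kappa> * norm u)\<^sup>2 / S\<^sup>2 \<le> (norm (B u))\<^sup>2 / S\<^sup>2" by (rule divide_right_mono) simp
    moreover have "(\<kappa> * norm u)\<^sup>2 / S\<^sup>2 = d * (norm u)\<^sup>2" by (simp add: d_def power_mult_distrib)
    ultimately show ?thesis by (simp add: algebra_simps)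
  qed
  have pow: "(norm ((Q ^^ j) w))\<^sup>2 \<le> (1 - d) ^ j * (norm w)\<^sup>2" for j
  proof (induction j)
    case (Suc j)
    have "(norm ((Q ^^ Suc j) w))\<^sup>2 \<le> (1 - d) * (norm ((Q ^^ j) w))\<^sup>2" using contr by simp
    also have "\<dots> \<le> (1 - d) * ((1 - d) ^ j * (norm w)\<^sup>2)" using Suc d by (intro mult_left_mono) auto
    finally show ?case by simp
  qed simp
  define m where "m = measure \<mu> (ball E (\<kappa> / 2))"
  have le: "m * (1 - d / 2) ^ j \<le> (1 - d) ^ j * (norm w)\<^sup>2" for j
  proof -
    have "m * (1 - d / 2) ^ j = (\<integral>x. (1 - d / 2) ^ j * indicator (ball E (\<kappa> / 2)) x \<partial>\<mu>)"
      by (simp add: m_def sets)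
    also have "\<dots> \<le> (\<integral>x. (1 - (x - E)\<^sup>2 / S\<^sup>2) ^ (2 * j) \<partial>\<mu>)"
    proof (rule integral_mono)
      fix x :: real
      show "(1 - d / 2) ^ j * indicator (ball E (\<kappa> / 2)) x \<le> (1 - (x - E)\<^sup>2 / S\<^sup>2) ^ (2 * j)"
      proof (cases "x \<in> ball E (\<kappa> / 2)")
        case True
        then have "\<bar>x - E\<bar> \<le> \<kappa> / 2" by (simp add: dist_real_def abs_minus_commute)
        then have "(x - E)\<^sup>2 \<le> (\<kappa> / 2)\<^sup>2" by (metis abs_ge_zero power2_abs power_mono)
        then have "(x - E)\<^sup>2 / S\<^sup>2 \<le> (\<kappa> / 2)\<^sup>2 / S\<^sup>2" by (rule divide_right_mono) simp
        also have "\<dots> = d / 4" by (simp add: d_def power_divide)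
        finally have "1 - d / 4 \<le> 1 - (x - E)\<^sup>2 / S\<^sup>2" by simp
        then have "(1 - d / 4)\<^sup>2 \<le> (1 - (x - E)\<^sup>2 / S\<^sup>2)\<^sup>2" using d by (intro power_mono) auto
        moreover have "1 - d / 2 \<le> (1 - d / 4)\<^sup>2" by (simp add: power2_eq_square algebra_simps)
        ultimately have "1 - d / 2 \<le> (1 - (x - E)\<^sup>2 / S\<^sup>2)\<^sup>2" by linarith
        then have "(1 - d / 2) ^ j \<le> ((1 - (x - E)\<^sup>2 / S\<^sup>2)\<^sup>2) ^ j" using d by (intro power_mono) auto
        then show ?thesis using True by (simp add: power_mult)
      qed (simp add: power_mult)
    qed (use rep(1) in \<open>auto simp: sets integrable_indicator_iff less_top[symmetric]\<close>)
    also have "\<dots> \<le> (1 - d) ^ j * (norm w)\<^sup>2" unfolding rep(2) using pow[of j] unfolding Q_def B_def .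
    finally show ?thesis .
  qed
  have "m \<le> ((1 - d) / (1 - d / 2)) ^ j * (norm w)\<^sup>2" for j
  proof -
    have "(1 - d / 2) ^ j > 0" using d by (intro zero_less_power) simp
    then have "m \<le> (1 - d) ^ j * (norm w)\<^sup>2 / (1 - d / 2) ^ j" using le[of j] by (simp only: pos_le_divide_eq)
    then show ?thesis by (simp add: power_divide)
  qed
  moreover have "(\<lambda>j. ((1 - d) / (1 - d / 2)) ^ j * (norm w)\<^sup>2) \<longlonglongrightarrow> 0 * (norm w)\<^sup>2"
    using d by (intro tendsto_intros LIMSEQ_power_zero) auto
  ultimately have "m \<le> 0 * (norm w)\<^sup>2" by (intro LIMSEQ_le_const) auto
  then have "m = 0" by (simp add: m_def measure_le_0_iff)
  then show ?thesis using \<kappa>(1) by (intro exI[of _ "\<kappa> / 2"]) (simp add: m_def emeasure_eq_measure)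
qed

lemma (in offdiagonal) generic_spectral_properties:
  assumes bd: "bounded (range b)" and cov: "\<And>k. covered a b k" and G: "\<And>k. gordon a b k"
  shows "cantor_set (jac_spectrum a b)" "lower_box_dim (jac_spectrum a b) = 0" "purely_sing_cont a b"
proof -
  have comp: "compact (jac_spectrum a b)" by (rule compact_jac_spectrum[OF bd])
  have small: "\<exists>F r. finite F \<and> F \<noteq> {} \<and> 0 < r \<and> r \<le> 1 / (real k + 2) \<and>
    (real k + 1) * ln (real (card F)) \<le> ln (1 / r) \<and> jac_spectrum a b \<subseteq> (\<Union>c\<in>F. cball c r)" for k
    by (rule covered_spectrum[OF bounded_a bd cov[of k]]) blast
  have null: "emeasure lborel (jac_spectrum a b) = 0" by (rule covered_null[OF small comp])
  show "cantor_set (jac_spectrum a b)"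
    unfolding cantor_set_def
    using comp interior_empty_if_null[OF null comp] jac_spectrum_no_isolated[OF bounded_a bd G] by blast
  show "lower_box_dim (jac_spectrum a b) = 0" by (rule lower_box_dim_zero[OF small])
  show "purely_sing_cont a b"
    unfolding purely_sing_cont_def
  proof (intro ballI allI impI conjI)
    fix \<psi> \<mu> assume \<psi>: "\<psi> \<in> l2" and sm: "spectral_measure a b \<psi> \<mu>"
    have sets: "sets \<mu> = sets borel" using sm by (simp add: spectral_measure_def)
    show "emeasure \<mu> {x} = 0" for x
      by (rule spectral_measure_no_atoms[OF bounded_a bd sm \<psi>])
         (rule gordon_no_eigenvector[OF bounded_a bd G])
    \<comment> \<open>Null balls around the points of the complement have a countable subfamily with
      the same union. The measure is thus carried by the spectrum, which is the required Lebesgue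
      null set.\<close>
    define \<F> where "\<F> = {ball E r |E r. E \<notin> jac_spectrum a b \<and> r > 0 \<and> emeasure \<mu> (ball E r) = 0}"
    have "\<And>U. U \<in> \<F> \<Longrightarrow> open U" by (auto simp: \<F>_def)
    then obtain \<G> where \<G>: "\<G> \<subseteq> \<F>" "countable \<G>" "\<Union>\<G> = \<Union>\<F>" using Lindelof[of \<F>] by blast
    have "UNIV - jac_spectrum a b \<subseteq> \<Union>\<G>"
    proof
      fix E assume "E \<in> UNIV - jac_spectrum a b"
      then have E: "E \<notin> jac_spectrum a b" by simp
      obtain r where r: "r > 0" "emeasure \<mu> (ball E r) = 0"
        using spectral_measure_null_near_resolvent[OF bounded_a bd sm \<psi> E] by blast
      then have "ball E r \<in> \<F>" using E unfolding \<F>_def by blast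
      then show "E \<in> \<Union>\<G>" unfolding \<G>(3) using r(1) by (meson UnionI centre_in_ball)
    qed
    moreover have "(\<Union>U\<in>\<G>. U) \<in> null_sets \<mu>"
    proof (rule null_sets_UN')
      show "countable \<G>" by (rule \<G>(2))
      show "U \<in> null_sets \<mu>" if "U \<in> \<G>" for U
        using that \<G>(1) by (auto simp: \<F>_def null_sets_def sets)
    qed
    ultimately have "emeasure \<mu> (UNIV - jac_spectrum a b) \<le> 0"
      using emeasure_mono[of "UNIV - jac_spectrum a b" "\<Union>\<G>" \<mu>] by (simp add: null_sets_def)
    moreover have "jac_spectrum a b \<in> sets borel" using comp by (simp add: compact_imp_closed borel_closed)
    ultimately show "\<exists>N\<in>sets borel. emeasure lborel N = 0 \<and> emeasure \<mu> (UNIV - N) = 0" using null by auto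
  qed
qed

section \<open>Density\<close>

lemma nonneg_jac_dist:
  assumes "bounded (range a)" "bounded (range b)" "bounded (range a')" "bounded (range b')"
  shows "jac_dist (a, b) (a', b') \<ge> 0"
  using coeff_diff_le_jac_dist(1)[OF assms, of 0] by linarith

lemma clamp_diff_le:
  fixes x y l u :: real
  assumes "\<bar>x - y\<bar> \<le> e" "l \<le> y" "y \<le> u"
  shows "\<bar>max l (min u x) - y\<bar> \<le> e"
  using assms by linarith

text \<open>A state \<open>(b, P, \<delta>)\<close> carries the radius \<open>\<delta>\<close>
  within which all later steps must stay. Moving by at most half the radius and at least halving it
  nests the closed balls, so the limit inherits every requirement; the same radii give the rate of
  the periodic approximation.\<close>

lemma (in offdiagonal) generic_near_periodic:
  assumes p: "p > 0" and per: "has_period p a" "has_period p b0" and \<eta>: "\<eta> > 0"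
  shows "\<exists>b bs. (\<forall>n. \<bar>b n - b0 n\<bar> \<le> \<eta>) \<and> (\<forall>k. covered a b k \<and> gordon a b k) \<and>
    (\<forall>k. \<exists>P>0. has_period P a \<and> has_period P (bs k)) \<and> (\<forall>k n. \<bar>bs k n - b n\<bar> \<le> \<eta> / 2 ^ k)"
proof -
  define Inv where "Inv s = (case s of (b, P, \<delta>) \<Rightarrow> P > 0 \<and> has_period P a \<and> has_period P b \<and> \<delta> > 0)"
    for s :: "(int \<Rightarrow> real) \<times> nat \<times> real"
  define Step where "Step k s s' = (case s of (b, P, \<delta>) \<Rightarrow> case s' of (b', P', \<delta>') \<Rightarrow>
      (\<forall>n. \<bar>b' n - b n\<bar> \<le> \<delta> / 2) \<and> \<delta>' \<le> \<delta> / 2 \<and>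
      (\<forall>b''. (\<forall>n. \<bar>b'' n - b' n\<bar> \<le> \<delta>') \<longrightarrow> covered a b'' k \<and> gordon a b'' k))"
    for k :: nat and s s' :: "(int \<Rightarrow> real) \<times> nat \<times> real"
  have "\<exists>f. \<forall>k. (Inv (f k) \<and> (k = 0 \<longrightarrow> f k = (b0, p, \<eta>))) \<and> Step k (f k) (f (Suc k))"
  proof (rule dependent_nat_choice)
    show "\<exists>s. Inv s \<and> ((0::nat) = 0 \<longrightarrow> s = (b0, p, \<eta>))" using p per \<eta> by (simp add: Inv_def)
  next
    fix s :: "(int \<Rightarrow> real) \<times> nat \<times> real" and k :: nat
    assume s: "Inv s \<and> (k = 0 \<longrightarrow> s = (b0, p, \<eta>))"
    obtain b P \<delta> where sd: "s = (b, P, \<delta>)" by (cases s)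
    have I: "P > 0" "has_period P a" "has_period P b" "\<delta> > 0" using s by (auto simp: Inv_def sd)
    obtain b' P' \<delta>' where *: "P' > 0" "has_period P' a" "has_period P' b'" "\<And>n. \<bar>b' n - b n\<bar> \<le> \<delta> / 2"
      "\<delta>' > 0" "\<And>b''. (\<And>n. \<bar>b'' n - b' n\<bar> \<le> \<delta>') \<Longrightarrow> covered a b'' k \<and> gordon a b'' k"
      using generic_step[OF I(1-3), of "\<delta> / 2" k] I(4) by auto
    have "Inv (b', P', min \<delta>' (\<delta> / 2))" using * I(4) by (simp add: Inv_def)
    moreover have "Step k s (b', P', min \<delta>' (\<delta> / 2))" using * by (simp add: Step_def sd)
    ultimately show "\<exists>s'. (Inv s' \<and> (Suc k = 0 \<longrightarrow> s' = (b0, p, \<eta>))) \<and> Step k s s'" by blast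
  qed
  then obtain f where f: "\<And>k. Inv (f k)" "f 0 = (b0, p, \<eta>)" "\<And>k. Step k (f k) (f (Suc k))" by blast
  define B where "B k = fst (f k)" for k
  define d where "d k = snd (snd (f k))" for k
  have d0: "d k > 0" for k using f(1)[of k] by (auto simp: Inv_def d_def split: prod.splits)
  have perB: "\<exists>P>0. has_period P a \<and> has_period P (B k)" for k
    using f(1)[of k] by (auto simp: Inv_def B_def split: prod.splits)
  have st: "\<bar>B (Suc k) n - B k n\<bar> \<le> d k / 2" "d (Suc k) \<le> d k / 2" for k n
    using f(3)[of k] by (auto simp: Step_def B_def d_def split: prod.splits)
  have good: "covered a b k \<and> gordon a b k" if "\<And>n. \<bar>b n - B (Suc k) n\<bar> \<le> d (Suc k)" for k b
    using f(3)[of k] that by (auto simp: Step_def B_def d_def split: prod.splits)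
  have dle: "d k \<le> \<eta> / 2 ^ k" for k
  proof (induction k)
    case 0 show ?case by (simp add: d_def f(2))
  next
    case (Suc k) then show ?case using st(2)[of k] by simp
  qed
  \<comment> \<open>Each step moves by at most \<open>d k / 2\<close>, which is at most
    \<open>d k - d (Suc k)\<close>; the sum telescopes.\<close>
  have far: "\<bar>B (k + i) n - B k n\<bar> \<le> d k - d (k + i)" for k i n
  proof (induction i)
    case (Suc i)
    then show ?case using st(1)[of "k + i" n] st(2)[of "k + i"] unfolding add_Suc_right by linarith
  qed simp
  have far': "\<bar>B m n - B k n\<bar> \<le> d k" if "m \<ge> k" for m n k
    using far[of k "m - k" n] d0[of m] that by simp
  have "Cauchy (\<lambda>k. B k n)" for n
  proof (rule metric_CauchyI)
    fix e :: real assume e: "e > 0"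
    obtain N where N: "(1/2 :: real) ^ N < e / (2 * \<eta>)"
      using real_arch_pow_inv[of "e / (2 * \<eta>)" "1/2"] e \<eta> by auto
    have "2 * d N < e"
    proof -
      have "2 * d N \<le> 2 * \<eta> * (1/2) ^ N" using dle[of N] by (simp add: power_divide)
      also have "\<dots> < e" using N \<eta> by (simp add: field_simps)
      finally show ?thesis .
    qed
    then have "dist (B m n) (B k n) < e" if "m \<ge> N" "k \<ge> N" for m k
      using far'[OF that(1), of n] far'[OF that(2), of n] by (simp add: dist_real_def)
    then show "\<exists>N. \<forall>m\<ge>N. \<forall>k\<ge>N. dist (B m n) (B k n) < e" by blast
  qed
  then have "\<exists>l. (\<lambda>k. B k n) \<longlonglongrightarrow> l" for n
    unfolding Cauchy_convergent_iff convergent_def by blast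
  then obtain b where b: "\<And>n. (\<lambda>k. B k n) \<longlonglongrightarrow> b n" by metis
  have close: "\<bar>b n - B k n\<bar> \<le> d k" for n k
  proof (rule LIMSEQ_le_const2)
    show "(\<lambda>m. \<bar>B m n - B k n\<bar>) \<longlonglongrightarrow> \<bar>b n - B k n\<bar>" by (intro tendsto_intros b)
    show "\<exists>N. \<forall>m\<ge>N. \<bar>B m n - B k n\<bar> \<le> d k" using far' by blast
  qed
  have "\<bar>b n - b0 n\<bar> \<le> \<eta>" for n using close[of n 0] by (simp add: B_def d_def f(2))
  moreover have "covered a b k \<and> gordon a b k" for k by (rule good) (rule close)
  moreover have "\<bar>B k n - b n\<bar> \<le> \<eta> / 2 ^ k" for k n
    using close[of n k] dle[of k] by linarith
  ultimately show ?thesis using perB by blast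
qed

lemma jac_periodic_iff_has_period:
  "jac_periodic a b \<longleftrightarrow> jacobi_coeffs a b \<and> (\<exists>p>0. has_period p a \<and> has_period p b)"
proof
  assume "jac_periodic a b"
  then obtain p :: int where p: "p > 0" "\<forall>n. a (n + p) = a n \<and> b (n + p) = b n" "jacobi_coeffs a b"
    unfolding jac_periodic_def by blast
  then have "nat p > 0" "has_period (nat p) a" "has_period (nat p) b" by (auto simp: has_period_def)
  with p(3) show "jacobi_coeffs a b \<and> (\<exists>p>0. has_period p a \<and> has_period p b)" by blast
next
  assume *: "jacobi_coeffs a b \<and> (\<exists>p>0. has_period p a \<and> has_period p b)"
  then obtain p :: nat where "p > 0" "has_period p a" "has_period p b" by blast
  then have "int p > 0 \<and> (\<forall>n. a (n + int p) = a n \<and> b (n + int p) = b n)" by (simp add: has_period_def)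
  with * show "jac_periodic a b" unfolding jac_periodic_def by blast
qed

lemma limit_periodic_approximation:
  assumes M: "M > 1" and J: "(a0, b0) \<in> LP M" and \<epsilon>: "\<epsilon> > 0"
  shows "\<exists>a b. (a, b) \<in> LP M \<and> jac_dist (a0, b0) (a, b) < \<epsilon> \<and> cantor_set (jac_spectrum a b) \<and>
    lower_box_dim (jac_spectrum a b) = 0 \<and> purely_sing_cont a b"
proof -
  have LP0: "jacobi_coeffs a0 b0" "\<And>n. \<bar>a0 n\<bar> \<le> M" "\<And>n. \<bar>1 / a0 n\<bar> \<le> M" "\<And>n. \<bar>b0 n\<bar> \<le> M"
    using J by (auto simp: LP_def jac_limit_periodic_def)
  obtain P where P: "\<And>k. jac_periodic (fst (P k)) (snd (P k))" "(\<lambda>k. jac_dist (P k) (a0, b0)) \<longlonglongrightarrow> 0"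
    using J by (auto simp: LP_def jac_limit_periodic_def)
  \<comment> \<open>The final distance is at most 5 \<open>\<eta>\<close>: \<open>a\<close> moves by
    \<open>\<eta>\<close>, counted twice by \<open>jac_dist_le\<close>, and \<open>b\<close> by 3
    \<open>\<eta>\<close>, for the periodic approximation, the clamping and the generic
    perturbation. \<open>\<eta> < M\<close> keeps the clamping interval for \<open>b\<close>
    nonempty.\<close>
  define \<eta> where "\<eta> = min (\<epsilon> / 6) (M / 2)"
  have \<eta>: "\<eta> > 0" "6 * \<eta> \<le> \<epsilon>" "\<eta> < M" using \<epsilon> M by (auto simp: \<eta>_def)
  have "\<forall>\<^sub>F k in sequentially. jac_dist (P k) (a0, b0) < \<eta>" using P(2) \<eta>(1) by (rule order_tendstoD)
  then obtain k where k: "jac_dist (P k) (a0, b0) < \<eta>" by (auto simp: eventually_sequentially)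
  obtain a1 b1 where Pk: "P k = (a1, b1)" by (cases "P k")
  have per1: "jacobi_coeffs a1 b1" "\<exists>p>0. has_period p a1 \<and> has_period p b1"
    using P(1)[of k] by (auto simp: Pk jac_periodic_iff_has_period)
  have bds: "bounded (range a1)" "bounded (range b1)" "bounded (range a0)" "bounded (range b0)"
    using per1(1) LP0(1) by (auto simp: jacobi_coeffs_def)
  have diff1: "\<bar>a1 n - a0 n\<bar> \<le> \<eta>" "\<bar>b1 n - b0 n\<bar> \<le> \<eta>" for n
    using coeff_diff_le_jac_dist[OF bds, of n] k by (auto simp: Pk)
  \<comment> \<open>The periodic approximant may violate the bounds of \<open>LP M\<close>. Clamping
    restores them and keeps the period; \<open>b\<close> is clamped to \<open>M - \<eta>\<close> to
    leave room for its later perturbation.\<close>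
  define a where "a n = max (1 / M) (min M (a1 n))" for n
  define b2 where "b2 n = max (- (M - \<eta>)) (min (M - \<eta>) (b1 n))" for n
  have a0: "1 / M \<le> a0 n" "a0 n \<le> M" for n
  proof -
    have p: "a0 n > 0" using LP0(1) by (simp add: jacobi_coeffs_def)
    show "a0 n \<le> M" using LP0(2)[of n] by simp
    have "1 / a0 n \<le> M" using LP0(3)[of n] by linarith
    then show "1 / M \<le> a0 n" using p M by (simp add: field_simps)
  qed
  have M1: "1 / M \<le> M"
  proof -
    have "1 / M \<le> 1" using M by simp
    then show ?thesis using M by linarith
  qed
  have aM: "1 / M \<le> a n" "a n \<le> M" for n using M1 by (auto simp: a_def)
  have da: "\<bar>a n - a0 n\<bar> \<le> \<eta>" for n unfolding a_def by (rule clamp_diff_le[OF diff1(1) a0])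
  have db2: "\<bar>b2 n - b0 n\<bar> \<le> 2 * \<eta>" for n
    using LP0(4)[of n] diff1(2)[of n] \<eta> unfolding b2_def by linarith
  have b2M: "\<bar>b2 n\<bar> \<le> M - \<eta>" for n using \<eta> by (auto simp: b2_def)
  obtain p :: nat where p: "p > 0" "has_period p a1" "has_period p b1" using per1(2) by blast
  have perp: "has_period p a" "has_period p b2" using p(2,3) by (simp_all add: has_period_def a_def b2_def)
  interpret offdiagonal a "1 / M" M by unfold_locales (use M aM in auto)
  obtain b bs where b: "\<And>n. \<bar>b n - b2 n\<bar> \<le> \<eta>" "\<And>k. covered a b k" "\<And>k. gordon a b k"
    "\<And>k. \<exists>P>0. has_period P a \<and> has_period P (bs k)" "\<And>k n. \<bar>bs k n - b n\<bar> \<le> \<eta> / 2 ^ k"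
    using generic_near_periodic[OF p(1) perp \<eta>(1)] by blast
  have bM: "\<bar>b n\<bar> \<le> M" for n using b(1)[of n] b2M[of n] by linarith
  have bb: "bounded (range b)" by (rule bounded_rangeI_real) (rule bM)
  have inv: "\<bar>1 / a n\<bar> \<le> M" for n
  proof -
    have "a n > 0" using aM(1)[of n] M by (meson less_le_trans zero_less_divide_1_iff zero_less_one order_less_trans)
    then show ?thesis using aM(1)[of n] M by (simp add: field_simps)
  qed
  have coeffs: "jacobi_coeffs a c" if "bounded (range c)" for c
    unfolding jacobi_coeffs_def
  proof (intro conjI allI)
    show "a n > 0" for n using aM(1)[of n] M by (meson less_le_trans zero_less_divide_1_iff zero_less_one order_less_trans)
    show "bounded (range (\<lambda>n. 1 / a n))" by (rule bounded_rangeI_real) (rule inv)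
  qed (use bounded_a that in auto)
  have bbs: "bounded (range (bs k))" for k
    by (rule bounded_range_close[OF bb b(5)])
  have "jac_limit_periodic a b"
    unfolding jac_limit_periodic_def
  proof (intro conjI exI[of _ "\<lambda>k. (a, bs k)"] allI)
    show "jacobi_coeffs a b" by (rule coeffs[OF bb])
    show "jac_periodic (fst (a, bs k)) (snd (a, bs k))" for k
      using coeffs[OF bbs] b(4)[of k] by (simp add: jac_periodic_iff_has_period)
    show "(\<lambda>k. jac_dist (a, bs k) (a, b)) \<longlonglongrightarrow> 0"
    proof (rule tendsto_sandwich)
      show "\<forall>\<^sub>F k in sequentially. 0 \<le> jac_dist (a, bs k) (a, b)"
        using nonneg_jac_dist[OF bounded_a bbs bounded_a bb] by simp
      show "\<forall>\<^sub>F k in sequentially. jac_dist (a, bs k) (a, b) \<le> \<eta> / 2 ^ k"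
      proof (rule always_eventually, rule allI)
        show "jac_dist (a, bs k) (a, b) \<le> \<eta> / 2 ^ k" for k
          using jac_dist_le[OF bounded_a bbs bounded_a bb, where K = 0 and L = "\<eta> / 2 ^ k"] b(5) by simp
      qed
      have "(\<lambda>k. \<eta> * (1 / 2) ^ k) \<longlonglongrightarrow> \<eta> * 0" by (intro tendsto_intros LIMSEQ_power_zero) auto
      then show "(\<lambda>k. \<eta> / 2 ^ k) \<longlonglongrightarrow> 0" by (simp add: power_divide)
    qed simp
  qed
  then have "(a, b) \<in> LP M" using inv bM abs_a_le by (simp add: LP_def)
  moreover have "jac_dist (a0, b0) (a, b) < \<epsilon>"
  proof -
    have "jac_dist (a0, b0) (a, b) \<le> 2 * \<eta> + 3 * \<eta>"
    proof (rule jac_dist_le[OF bds(3,4) bounded_a bb])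
      show "\<bar>a0 n - a n\<bar> \<le> \<eta>" for n using da[of n] by linarith
      show "\<bar>b0 n - b n\<bar> \<le> 3 * \<eta>" for n using db2[of n] b(1)[of n] by linarith
    qed
    with \<eta> show ?thesis by linarith
  qed
  moreover note generic_spectral_properties[OF bb b(2,3)]
  ultimately show ?thesis by blast
qed

theorem theorem1p2:
  fixes M :: real
  assumes "M > 1"
  shows "\<exists>D. D \<subseteq> LP M \<and>
           (\<forall>J \<in> LP M. \<forall>\<epsilon>>0. \<exists>J' \<in> D. jac_dist J J' < \<epsilon>) \<and>
           (\<forall>(a, b) \<in> D. cantor_set (jac_spectrum a b) \<and>
                          lower_box_dim (jac_spectrum a b) = 0 \<and>
                          purely_sing_cont a b)"
proof -
  define D where "D = {(a, b) \<in> LP M. cantor_set (jac_spectrum a b) \<and>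
    lower_box_dim (jac_spectrum a b) = 0 \<and> purely_sing_cont a b}"
  have "\<exists>J'\<in>D. jac_dist J J' < \<epsilon>" if J: "J \<in> LP M" and \<epsilon>: "\<epsilon> > 0" for J \<epsilon>
  proof -
    obtain a0 b0 where "J = (a0, b0)" by (cases J)
    with limit_periodic_approximation[OF assms _ \<epsilon>, of a0 b0] J show ?thesis
      unfolding D_def by fastforce
  qed
  then show ?thesis by (intro exI[of _ D]) (auto simp: D_def)
qed

end
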